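(* Let $F\in S_{k+n}(\Gamma_{2n})$ be the Ikeda lift of a Hecke eigenform $f\in S_k(\Gamma_1)$, and let $\lambda_F(p^r)$ be the eigenvalue of $F$ for the Hecke operator $T(p^r)$. Fix $r\ge1$. Then $\lambda_F(p^r)>0$ for every prime $p>\big(4n(2rn^2+2n(2n-1))\big)^2$.
   Context: $\Gamma_m={\rm Sp}_{2m}(\mathbb Z)$, $S_\ell(\Gamma_m)$ the space of Siegel cusp forms of weight $\ell$, genus $m$. $T(p^r)$ is the sum of all distinct double cosets $\Gamma_{2n}g\Gamma_{2n}$ with $g\in{\rm GSp}_{4n}(\mathbb Q)^+\cap M_{4n}(\mathbb Z)$ and similitude factor $\mu(g)=p^r$, acting via $(\Gamma g\Gamma)F=\sum_iF|_\ell g_i$ ($\Gamma g\Gamma=\bigsqcup\Gamma g_i$), where $(F|_\ell g)(Z)=\mu(g)^{\frac{m\ell}2-\frac{m(m+1)}2}\det(CZ+D)^{-\ell}F((AZ+B)(CZ+D)^{-1})$ for $g=\begin{pmatrix}A&B\\C&D\end{pmatrix}$ in genus $m$. The Ikeda lift $F$ of $f$ is a Hecke eigenform whose classical Satake $p$-parameters are $\alpha_0=p^{nk-\frac n2}a^{-n}$, $\alpha_i=a\,p^{-n-\frac12+i}$ ($1\le i\le 2n$), where $a,a^{-1}$ are the Satake $p$-parameters of $f$ and $|a|=1$. *)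

theory Defs
  imports "Jordan_Normal_Form.Matrix" "HOL-Computational_Algebra.Primes" Complex_Main
begin

definition Jmat :: "nat \<Rightarrow> int mat" where
  "Jmat m = four_block_mat (0\<^sub>m m m) (1\<^sub>m m) (- 1\<^sub>m m) (0\<^sub>m m m)"

definition GSp_int :: "nat \<Rightarrow> int \<Rightarrow> int mat set" where
  "GSp_int m q = {g \<in> carrier_mat (2*m) (2*m). transpose_mat g * Jmat m * g = q \<cdot>\<^sub>m Jmat m}"

definition Gamma :: "nat \<Rightarrow> int mat set" where
  "Gamma m = GSp_int m 1"

text \<open>The left cosets Gamma g making up T(p^r) (the union of all double cosets with
  similitude p^r is the set of all integral g with mu(g) = p^r).\<close>
definition Tcosets :: "nat \<Rightarrow> nat \<Rightarrow> nat \<Rightarrow> int mat set set" where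
  "Tcosets m p r = (\<lambda>g. (\<lambda>\<gamma>. \<gamma> * g) ` Gamma m) ` GSp_int m (int p ^ r)"

definition good_rep :: "nat \<Rightarrow> int mat \<Rightarrow> bool" where
  "good_rep m g = (case split_block g m m of (A, B, C, D) \<Rightarrow>
      C = 0\<^sub>m m m \<and> upper_triangular D \<and> (\<forall>i<m. D $$ (i,i) > 0))"

text \<open>Satake (spherical) map on a left coset (Andrianov):
  Gamma (p^r D*, B; 0, D) |-> x_0^r prod_i (x_i p^{-i})^{d_i}, where D is upper triangular
  with diagonal entries p^{d_i}.\<close>
definition satake_coset :: "nat \<Rightarrow> nat \<Rightarrow> nat \<Rightarrow> (nat \<Rightarrow> complex) \<Rightarrow> int mat set \<Rightarrow> complex" where
  "satake_coset m p r x c =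
     (let g = (SOME g. g \<in> c \<and> good_rep m g);
          D = snd (snd (snd (split_block g m m)))
      in x 0 ^ r * (\<Prod>i<m. (x (Suc i) / of_nat p ^ Suc i) ^ multiplicity (int p) (D $$ (i,i))))"

text \<open>Eigenvalue of T(p^r) on a genus-m eigenform with classical Satake p-parameters
  x_0, x_1, ..., x_m: the Satake image of T(p^r) evaluated at these parameters.\<close>
definition hecke_eigenvalue :: "nat \<Rightarrow> nat \<Rightarrow> nat \<Rightarrow> (nat \<Rightarrow> complex) \<Rightarrow> complex" where
  "hecke_eigenvalue m p r x = (\<Sum>c\<in>Tcosets m p r. satake_coset m p r x c)"

text \<open>Classical Satake p-parameters of the Ikeda lift F in S_{k+n}(Gamma_2n) of f, where a, a^{-1}
  are the Satake p-parameters of f.\<close>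
definition ikeda_satake :: "nat \<Rightarrow> nat \<Rightarrow> nat \<Rightarrow> complex \<Rightarrow> nat \<Rightarrow> complex" where
  "ikeda_satake n k p a i =
     (if i = 0 then complex_of_real (real p powr (real (n*k) - real n / 2)) * a powi (- int n)
      else a * complex_of_real (real p powr (real i - real n - 1/2)))"

end

(*
  For every i the Ikeda parameters satisfy alpha_i p^(-i) = a y with y = p^(-n-1/2), so a left coset
  with lower right block D contributes alpha_0^r (a y)^v, where v is the p-adic valuation of det D.
  The cosets correspond to pairs (D, S): D runs over the integral divisors of p^r modulo left
  multiplication by GL_2n(Z), and S over the symmetric matrices modulo p^r with S D = 0 modulo p^r.
  In Smith normal form D = diag(p^(e_i)), the number s(D) of such S is p to the sum of min(e_i, e_j)
  over i <= j.

  Reality: the involution D -> p^r D^(-T) replaces v by 2nr - v and preserves the weight s(D) y^v, so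
  the eigenvalue is its own complex conjugate.

  Positivity: the terms with v = nr carry the phase a^0, and block matrices (1, X; 0, p^r) alone
  contribute p^(r n^2/2) to them. The total weight is submultiplicative in r (peel off one factor p
  from each nontrivial elementary divisor), and for r = 1 it is at most the product of the
  1 + p^(j-n-1/2), 1 <= j <= 2n; altogether it is at most p^(r n^2/2) (1 + p^(-1/2))^(2nr), less than
  twice the middle part.
*)

theory Submission
  imports Defs "Jordan_Normal_Form.Determinant" "HOL-Library.FuncSet"
begin

subsection \<open>Unimodular integer matrices\<close>

text \<open>The diagonal exponents of D determine the weight of its coset, but the number of left
  cosets with given exponents is not easily counted for general r. Hence two normal forms: the
  diagonal one serves weights, duality and factoring; the Hermite one serves counting, and only for
  r = 1, where every pivot is 1 or p and the free entries are visible. The estimate closes because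
  both bounds have the same leading power. The exponents j - n - 1/2 with j > n add up to n^2/2. The
  middle family has p^(r n^2) blocks X, each with p^(r n(n+1)/2) matrices S, and the factor y^(n r)
  = p^(-r n(n+1/2)) leaves p^(r n^2/2). What remains is (1 + p^(-1/2))^(2 n r) < 2, which holds once
  sqrt p >= 4 n r. Everything stays integral: D^(-1) and B D^(-1) are replaced by an integral A with
  A^T D = p^r and by S = B A^T, and a cancellation lemma takes the place of inverses.\<close>

definition unimod :: "nat \<Rightarrow> int mat set" where
  "unimod m = {U \<in> carrier_mat m m. \<bar>det U\<bar> = 1}"

lemma unimod_carrier: "U \<in> unimod m \<Longrightarrow> U \<in> carrier_mat m m"
  by (simp add: unimod_def)

lemma one_unimod: "1\<^sub>m m \<in> unimod m"
  by (simp add: unimod_def)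

lemma mult_unimod: "U \<in> unimod m \<Longrightarrow> V \<in> unimod m \<Longrightarrow> U * V \<in> unimod m"
  by (auto simp: unimod_def det_mult abs_mult)

lemma transpose_unimod: "U \<in> unimod m \<Longrightarrow> U\<^sup>T \<in> unimod m"
  by (auto simp: unimod_def det_transpose)

lemma unimod_if_left_inverse:
  assumes "U \<in> carrier_mat m m" "V \<in> carrier_mat m m" "V * U = 1\<^sub>m m"
  shows "U \<in> unimod m"
proof -
  have "det V * det U = 1"
    using assms det_mult[of V m U] by simp
  then show ?thesis
    using assms(1) abs_zmult_eq_1[of "det U" "det V"] by (simp add: unimod_def mult.commute)
qed

lemma smult_smult_mat: "k \<cdot>\<^sub>m (l \<cdot>\<^sub>m A) = (k * l) \<cdot>\<^sub>m (A :: 'a :: semigroup_mult mat)"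
  by (intro eq_matI) (auto simp: mult.assoc)

lemma one_smult: "1 \<cdot>\<^sub>m A = (A :: 'a :: monoid_mult mat)"
  by (intro eq_matI) auto

lemma mult_scalar_mat:
  "A \<in> carrier_mat k m \<Longrightarrow> A * (q \<cdot>\<^sub>m 1\<^sub>m m) = q \<cdot>\<^sub>m (A :: 'a :: comm_semiring_1 mat)"
  by (simp add: mult_smult_distrib[of _ k m _ m])

text \<open>Multiplying A B = q by the adjugate of A expresses det A times B as q times the
  adjugate, which commutes with A up to the scalar det A. That scalar is nonzero because det A * det
  B = q^m, so it can be cancelled entrywise.\<close>

lemma scalar_left_inverse_imp_right:
  fixes A :: "'a :: idom mat"
  assumes A: "A \<in> carrier_mat m m" and B: "B \<in> carrier_mat m m"
    and AB: "A * B = q \<cdot>\<^sub>m 1\<^sub>m m" and q: "q \<noteq> 0"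
  shows "B * A = q \<cdot>\<^sub>m 1\<^sub>m m"
proof -
  have "det A * det B = q ^ m"
    using det_mult[OF A B] AB by simp
  with q have dA: "det A \<noteq> 0" by auto
  note ad = adj_mat[OF A]
  have "det A \<cdot>\<^sub>m B = (adj_mat A * A) * B"
    using ad B by (simp add: mult_smult_assoc_mat[of _ m m])
  also have "\<dots> = adj_mat A * (A * B)"
    using ad(1) A B by (simp add: assoc_mult_mat[of _ m m _ m _ m])
  also have "\<dots> = q \<cdot>\<^sub>m adj_mat A"
    using ad(1) AB by (simp add: mult_scalar_mat[of _ m m])
  finally have e: "det A \<cdot>\<^sub>m B = q \<cdot>\<^sub>m adj_mat A" .
  have "det A \<cdot>\<^sub>m (B * A) = (det A \<cdot>\<^sub>m B) * A"
    using A B by (simp add: mult_smult_assoc_mat[of _ m m])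
  also have "\<dots> = q \<cdot>\<^sub>m (adj_mat A * A)"
    unfolding e using A ad(1) by (simp add: mult_smult_assoc_mat[of _ m m])
  also have "\<dots> = det A \<cdot>\<^sub>m (q \<cdot>\<^sub>m 1\<^sub>m m)"
    using ad by (simp add: smult_smult_mat mult.commute)
  finally have f: "det A \<cdot>\<^sub>m (B * A) = det A \<cdot>\<^sub>m (q \<cdot>\<^sub>m 1\<^sub>m m)" .
  show ?thesis
  proof (rule eq_matI)
    fix i j assume ij: "i < dim_row (q \<cdot>\<^sub>m 1\<^sub>m m)" "j < dim_col (q \<cdot>\<^sub>m 1\<^sub>m m)"
    then have "(det A \<cdot>\<^sub>m (B * A)) $$ (i,j) = (det A \<cdot>\<^sub>m (q \<cdot>\<^sub>m 1\<^sub>m m)) $$ (i,j)"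
      using f by simp
    with dA ij A B show "(B * A) $$ (i,j) = (q \<cdot>\<^sub>m 1\<^sub>m m) $$ (i,j)"
      by (auto split: if_splits)
  qed (use A B in auto)
qed

lemma unimod_inverse:
  assumes "U \<in> unimod m"
  obtains V where "V \<in> unimod m" "V * U = 1\<^sub>m m" "U * V = 1\<^sub>m m"
proof -
  have U: "U \<in> carrier_mat m m" and d: "\<bar>det U\<bar> = 1"
    using assms by (auto simp: unimod_def)
  note ad = adj_mat[OF U]
  \<comment> \<open>Since det U is 1 or -1, multiplying the adjugate by it is the same as dividing
    by it.\<close>
  define V where "V = det U \<cdot>\<^sub>m adj_mat U"
  have V: "V \<in> carrier_mat m m" using ad by (simp add: V_def)
  have dd: "det U * det U = 1" using d by (auto simp: abs_if split: if_splits)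
  have VU: "V * U = 1\<^sub>m m"
    using ad U dd by (simp add: V_def mult_smult_assoc_mat[of _ m m] smult_smult_mat one_smult)
  have UV: "U * V = 1\<^sub>m m"
    using scalar_left_inverse_imp_right[OF V U, of 1] VU by (simp add: one_smult)
  show thesis
    by (rule that[OF _ VU UV]) (rule unimod_if_left_inverse[OF V U UV])
qed

lemma smult_mat_cancel:
  fixes A :: "'a :: idom mat"
  assumes "q \<cdot>\<^sub>m A = q \<cdot>\<^sub>m B" "q \<noteq> 0" "A \<in> carrier_mat k l" "B \<in> carrier_mat k l"
  shows "A = B"
proof (rule eq_matI)
  fix i j assume ij: "i < dim_row B" "j < dim_col B"
  then have "(q \<cdot>\<^sub>m A) $$ (i,j) = (q \<cdot>\<^sub>m B) $$ (i,j)"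
    using assms(1) by simp
  with assms(2-4) ij show "A $$ (i,j) = B $$ (i,j)" by auto
qed (use assms in auto)

text \<open>\<open>E\<close> plays the part of q D^(-1), so D cancels without passing to rational
  matrices.\<close>

lemma mult_mat_right_cancel:
  fixes D :: "'a :: idom mat"
  assumes "X * D = Y * D" and X: "X \<in> carrier_mat k m" and Y: "Y \<in> carrier_mat k m"
    and D: "D \<in> carrier_mat m m" and E: "E \<in> carrier_mat m m" and DE: "D * E = q \<cdot>\<^sub>m 1\<^sub>m m"
    and q: "q \<noteq> 0"
  shows "X = Y"
proof -
  have "X * (D * E) = Y * (D * E)"
    using assms(1) assoc_mult_mat[OF X D E] assoc_mult_mat[OF Y D E] by simp
  then have "q \<cdot>\<^sub>m X = q \<cdot>\<^sub>m Y"
    using X Y by (simp add: DE mult_scalar_mat[of _ k m])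
  then show ?thesis
    using smult_mat_cancel q X Y by blast
qed

lemma index_mult_square:
  assumes "A \<in> carrier_mat m m" "B \<in> carrier_mat m m" "i < m" "j < m"
  shows "(A * B) $$ (i,j) = (\<Sum>k<m. A $$ (i,k) * B $$ (k,j))"
  using assms by (auto simp: scalar_prod_def atLeast0LessThan intro!: sum.cong)

section \<open>Elementary row and column operations\<close>

definition elim_mat :: "nat \<Rightarrow> nat \<Rightarrow> (nat \<Rightarrow> int) \<Rightarrow> int mat" where
  "elim_mat m k c = mat m m (\<lambda>(i,j). if i = j then 1 else if j = k \<and> k < i then c i else 0)"

lemma elim_mat_carrier [simp]: "elim_mat m k c \<in> carrier_mat m m"
  by (simp add: elim_mat_def)

lemma elim_mat_unimod: "elim_mat m k c \<in> unimod m"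
proof -
  have "det (elim_mat m k c) = prod_list (diag_mat (elim_mat m k c))"
    by (rule det_lower_triangular[of m]) (auto simp: elim_mat_def)
  also have "\<dots> = 1"
    unfolding prod_list_diag_prod by (rule prod.neutral) (auto simp: elim_mat_def)
  finally show ?thesis by (simp add: unimod_def)
qed

text \<open>Row k itself is untouched and each row below it has its own multiplier, so one product
  clears a whole column.\<close>

lemma index_elim_mat_mult:
  assumes M: "M \<in> carrier_mat m m" and "i < m" "j < m" "k < m"
  shows "(elim_mat m k c * M) $$ (i,j) = M $$ (i,j) + (if k < i then c i * M $$ (k,j) else 0)"
proof -
  have "(elim_mat m k c * M) $$ (i,j) = (\<Sum>l<m. elim_mat m k c $$ (i,l) * M $$ (l,j))"
    using assms by (intro index_mult_square) auto
  also have "\<dots> = (\<Sum>l<m. (if l = i then M $$ (i,j) else 0) + (if l = k then if k < i then c i * M $$ (k,j) else 0 else 0))"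
    using assms by (intro sum.cong) (auto simp: elim_mat_def)
  also have "\<dots> = M $$ (i,j) + (if k < i then c i * M $$ (k,j) else 0)"
    using assms by (simp add: sum.distrib)
  finally show ?thesis .
qed

text \<open>M N^T is the transpose of N M^T; this turns the entry formulas for row operations into
  those for column operations.\<close>

lemma index_mult_transpose_right:
  fixes M N :: "'a :: comm_semiring_0 mat"
  assumes "M \<in> carrier_mat m m" "N \<in> carrier_mat m m" "i < m" "j < m"
  shows "(M * N\<^sup>T) $$ (i,j) = (N * M\<^sup>T) $$ (j,i)"
  using assms by (auto simp: scalar_prod_def intro!: sum.cong mult.commute)

lemma index_mult_elim_mat_transpose:
  assumes M: "M \<in> carrier_mat m m" and "i < m" "j < m" "k < m"
  shows "(M * (elim_mat m k c)\<^sup>T) $$ (i,j) = M $$ (i,j) + (if k < j then c j * M $$ (i,k) else 0)"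
  using assms by (subst index_mult_transpose_right[of _ m]) (auto simp: index_elim_mat_mult)

definition swap_mat :: "nat \<Rightarrow> nat \<Rightarrow> nat \<Rightarrow> int mat" where
  "swap_mat m k l = swaprows_mat m k l"

lemma swap_mat_carrier [simp]: "swap_mat m k l \<in> carrier_mat m m"
  by (simp add: swap_mat_def)

text \<open>The case k = l is included so that a pivot already in place needs no separate
  treatment.\<close>

lemma swap_mat_unimod:
  assumes "k < m" "l < m"
  shows "swap_mat m k l \<in> unimod m"
proof (cases "k = l")
  case True
  then have "swap_mat m k l = 1\<^sub>m m"
    by (intro eq_matI) (auto simp: swap_mat_def)
  then show ?thesis by (simp add: one_unimod)
next
  case False
  then show ?thesis
    using assms by (simp add: unimod_def det_swaprows_mat swap_mat_def del: swaprows_mat_def)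
qed

lemma index_swap_mat_mult:
  assumes "M \<in> carrier_mat m m" "i < m" "j < m" "k < m" "l < m"
  shows "(swap_mat m k l * M) $$ (i,j) =
    M $$ (if i = k then l else if i = l then k else i, j)"
proof -
  have "swap_mat m k l * M = swaprows k l M"
    unfolding swap_mat_def using assms by (intro swaprows_mat[symmetric, of _ _ m]) auto
  then show ?thesis using assms by auto
qed

lemma index_mult_swap_mat_transpose:
  assumes "M \<in> carrier_mat m m" "i < m" "j < m" "k < m" "l < m"
  shows "(M * (swap_mat m k l)\<^sup>T) $$ (i,j) =
    M $$ (i, if j = k then l else if j = l then k else j)"
  using assms by (subst index_mult_transpose_right[of _ m]) (auto simp: index_swap_mat_mult)

section \<open>Elimination with a minimal pivot\<close>

definition left_triangular :: "nat \<Rightarrow> nat \<Rightarrow> int mat \<Rightarrow> bool" where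
  "left_triangular m k M \<longleftrightarrow> (\<forall>j<k. \<forall>i<m. j < i \<longrightarrow> M $$ (i,j) = 0)"

definition corner_diagonal :: "nat \<Rightarrow> nat \<Rightarrow> int mat \<Rightarrow> bool" where
  "corner_diagonal m k M \<longleftrightarrow> (\<forall>i<m. \<forall>j<m. i \<noteq> j \<longrightarrow> i < k \<or> j < k \<longrightarrow> M $$ (i,j) = 0)"

text \<open>A pivot of minimal absolute value divides its column: otherwise one division step followed by
  a swap would produce a smaller one.\<close>
lemma triangularize_step:
  assumes M: "M \<in> carrier_mat m m" and k: "k < m" and P: "left_triangular m k M"
  shows "\<exists>U\<in>unimod m. left_triangular m (Suc k) (U * M)"
proof (cases "\<forall>i<m. k \<le> i \<longrightarrow> M $$ (i,k) = 0")
  case True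
  with P M show ?thesis
    by (intro bexI[of _ "1\<^sub>m m"]) (auto simp: one_unimod left_triangular_def less_Suc_eq)
next
  case False
  then obtain i0 where i0: "i0 < m" "k \<le> i0" "M $$ (i0,k) \<noteq> 0" by auto
  define Q where "Q U \<longleftrightarrow> U \<in> unimod m \<and> left_triangular m k (U * M) \<and> (U * M) $$ (k,k) \<noteq> 0" for U
  have car: "U * M \<in> carrier_mat m m" if "U \<in> unimod m" for U
    using M unimod_carrier[OF that] by simp
  have swap: "Q (swap_mat m k i * U)"
    if "U \<in> unimod m" "left_triangular m k (U * M)" "i < m" "k \<le> i" "(U * M) $$ (i,k) \<noteq> 0" for U i
  proof -
    have e: "swap_mat m k i * U * M = swap_mat m k i * (U * M)"
      using M unimod_carrier[OF that(1)] by (simp add: assoc_mult_mat[of _ m m _ m _ m])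
    show ?thesis
      unfolding Q_def e using that k car[OF that(1)]
      by (auto simp: mult_unimod swap_mat_unimod left_triangular_def index_swap_mat_mult)
  qed
  have "Q (swap_mat m k i0 * 1\<^sub>m m)"
    using i0 P M k by (intro swap) (auto simp: one_unimod)
  then obtain U where QU: "Q U"
    and min: "\<And>U'. Q U' \<Longrightarrow> nat \<bar>(U * M) $$ (k,k)\<bar> \<le> nat \<bar>(U' * M) $$ (k,k)\<bar>"
    using ex_has_least_nat[of Q _ "\<lambda>U. nat \<bar>(U * M) $$ (k,k)\<bar>"] by blast
  define N where "N = U * M"
  define d where "d = N $$ (k,k)"
  have U: "U \<in> unimod m" and N: "N \<in> carrier_mat m m" and PN: "left_triangular m k N" and d0: "d \<noteq> 0"
    using QU car unfolding Q_def N_def d_def by auto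
  have assoc: "elim_mat m k c * U * M = elim_mat m k c * N" for c
    unfolding N_def using M unimod_carrier[OF U] by (simp add: assoc_mult_mat[of _ m m _ m _ m])
  have PE: "left_triangular m k (elim_mat m k c * N)" for c
    using PN k N by (auto simp: left_triangular_def index_elim_mat_mult)
  have dv: "d dvd N $$ (i,k)" if i: "i < m" "k < i" for i
  proof (rule ccontr)
    assume nd: "\<not> d dvd N $$ (i,k)"
    \<comment> \<open>The multiplier is the same for all rows below k; only row i matters, where it
      leaves the remainder of the division by d.\<close>
    define c where "c = (\<lambda>_::nat. - (N $$ (i,k) div d))"
    have e: "(elim_mat m k c * N) $$ (i,k) = N $$ (i,k) mod d"
      using i k N by (simp add: index_elim_mat_mult c_def d_def minus_div_mult_eq_mod[symmetric])
    have "Q (swap_mat m k i * (elim_mat m k c * U))"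
      using i PE e nd by (intro swap)
        (auto simp: mult_unimod elim_mat_unimod U assoc dvd_eq_mod_eq_0)
    from min[OF this] have "nat \<bar>d\<bar> \<le> nat \<bar>(swap_mat m k i * (elim_mat m k c * U) * M) $$ (k,k)\<bar>"
      by (simp add: d_def N_def)
    also have "swap_mat m k i * (elim_mat m k c * U) * M = swap_mat m k i * (elim_mat m k c * N)"
      unfolding assoc[symmetric]
      using M unimod_carrier[OF U] by (intro assoc_mult_mat[of _ m m _ m _ m] mult_carrier_mat[of _ m m]) auto
    also have "(swap_mat m k i * (elim_mat m k c * N)) $$ (k,k) = N $$ (i,k) mod d"
      using i k N e by (subst index_swap_mat_mult) (auto intro!: mult_carrier_mat[of _ m m])
    finally have "\<bar>d\<bar> \<le> \<bar>N $$ (i,k) mod d\<bar>" by simp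
    with abs_mod_less[OF d0, of "N $$ (i,k)"] show False by simp
  qed
  \<comment> \<open>Now each row has its own quotient, and the division is exact in every row by
    \<open>dv\<close>.\<close>
  define c where "c i = - (N $$ (i,k) div d)" for i
  have "left_triangular m (Suc k) (elim_mat m k c * N)"
    using PE[of c] dv N k by (auto simp: left_triangular_def less_Suc_eq index_elim_mat_mult c_def d_def[symmetric])
  then show ?thesis
    using assoc[of c] by (intro bexI[of _ "elim_mat m k c * U"]) (auto simp: mult_unimod elim_mat_unimod U)
qed

lemma unimod_triangularize:
  assumes M: "M \<in> carrier_mat m m"
  obtains U where "U \<in> unimod m" "upper_triangular (U * M)"
proof -
  have "\<exists>U\<in>unimod m. left_triangular m k (U * M)" if "k \<le> m" for k
    using that
  proof (induction k)
    case 0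
    show ?case by (intro bexI[of _ "1\<^sub>m m"]) (auto simp: left_triangular_def one_unimod)
  next
    case (Suc k)
    then obtain U where U: "U \<in> unimod m" "left_triangular m k (U * M)" by auto
    have "U * M \<in> carrier_mat m m" using M unimod_carrier[OF U(1)] by simp
    from triangularize_step[OF this _ U(2)] Suc.prems
    obtain V where V: "V \<in> unimod m" "left_triangular m (Suc k) (V * (U * M))" by auto
    have "V * (U * M) = V * U * M"
      using M unimod_carrier[OF U(1)] unimod_carrier[OF V(1)]
      by (simp add: assoc_mult_mat[of _ m m _ m _ m])
    with V U show ?case by (intro bexI[of _ "V * U"]) (auto simp: mult_unimod)
  qed
  then obtain U where U: "U \<in> unimod m" "left_triangular m m (U * M)" by blast
  then have "upper_triangular (U * M)"
    using M unimod_carrier[OF U(1)] by (intro upper_triangularI) (auto simp: left_triangular_def)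
  with that U show thesis by blast
qed

lemma corner_diagonal_SucI:
  assumes "corner_diagonal m k M"
    and "\<And>i. i < m \<Longrightarrow> k < i \<Longrightarrow> M $$ (i,k) = 0" "\<And>i. i < m \<Longrightarrow> k < i \<Longrightarrow> M $$ (k,i) = 0"
  shows "corner_diagonal m (Suc k) M"
  unfolding corner_diagonal_def
proof (intro allI impI)
  fix i j assume ij: "i < m" "j < m" "i \<noteq> j" "i < Suc k \<or> j < Suc k"
  then consider "i < k \<or> j < k" | "i = k" "k < j" | "j = k" "k < i" by linarith
  then show "M $$ (i,j) = 0"
    by cases (use assms ij in \<open>auto simp: corner_diagonal_def\<close>)
qed

text \<open>Row and column operations are mixed here, so minimality of the pivot is taken over the
  whole equivalence class of M. A nonzero remainder in the row or in the column of the pivot could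
  be swapped into the corner and would be a smaller pivot.\<close>

lemma diagonalize_step:
  assumes M: "M \<in> carrier_mat m m" and k: "k < m" and P: "corner_diagonal m k M"
  shows "\<exists>U\<in>unimod m. \<exists>V\<in>unimod m. corner_diagonal m (Suc k) (U * M * V)"
proof (cases "\<forall>i<m. \<forall>j<m. k \<le> i \<longrightarrow> k \<le> j \<longrightarrow> M $$ (i,j) = 0")
  case True
  with P M k have "corner_diagonal m (Suc k) M"
    by (intro corner_diagonal_SucI) auto
  with M show ?thesis
    by (intro bexI[of _ "1\<^sub>m m"] bexI[of _ "1\<^sub>m m"]) (auto simp: one_unimod)
next
  case False
  then obtain i0 j0 where i0: "i0 < m" "k \<le> i0" "j0 < m" "k \<le> j0" "M $$ (i0,j0) \<noteq> 0" by auto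
  \<comment> \<open>The competitors for a minimal pivot: matrices equivalent to M whose first k rows
    and columns are already diagonal. All swaps and eliminations used below stay inside this
    class.\<close>
  define R where "R N \<longleftrightarrow> (\<exists>U\<in>unimod m. \<exists>V\<in>unimod m. N = U * M * V) \<and> corner_diagonal m k N" for N
  have RC: "N \<in> carrier_mat m m" if "R N" for N
    using that M unfolding R_def by (auto dest!: unimod_carrier)
  have Rmul: "R (U * N * V)" if "R N" "U \<in> unimod m" "V \<in> unimod m" "corner_diagonal m k (U * N * V)" for U N V
  proof -
    obtain U' V' where w: "U' \<in> unimod m" "V' \<in> unimod m" "N = U' * M * V'" using \<open>R N\<close> unfolding R_def by auto
    have "U * N * V = (U * U') * M * (V' * V)"
      using w(3) M that(2,3) w(1,2)[THEN unimod_carrier] that(2,3)[THEN unimod_carrier]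
      by (simp add: assoc_mult_mat[of _ m m _ m _ m] mult_carrier_mat[of _ m m _ m])
    moreover have "U * U' \<in> unimod m" "V' * V \<in> unimod m"
      using that w by (auto intro: mult_unimod)
    ultimately show ?thesis
      unfolding R_def using that(4) by blast
  qed
  have RL: "R (U * N)" if "R N" "U \<in> unimod m" "corner_diagonal m k (U * N)" for U N
    using Rmul[OF that(1,2) one_unimod] that RC[OF that(1)] unimod_carrier[OF that(2)] by simp
  have RR: "R (N * V)" if "R N" "V \<in> unimod m" "corner_diagonal m k (N * V)" for V N
    using Rmul[OF that(1) one_unimod that(2)] that RC[OF that(1)] unimod_carrier[OF that(2)] by simp
  have RsL: "R (swap_mat m k i * N)" if "R N" "i < m" "k \<le> i" for i N
    using that RC[OF that(1)] k
    by (intro RL) (auto simp: swap_mat_unimod corner_diagonal_def index_swap_mat_mult R_def)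
  have RsR: "R (N * (swap_mat m k i)\<^sup>T)" if "R N" "i < m" "k \<le> i" for i N
    using that RC[OF that(1)] k
    by (intro RR) (auto simp: swap_mat_unimod transpose_unimod corner_diagonal_def index_mult_swap_mat_transpose R_def)
  have ReL: "R (elim_mat m k c * N)" if "R N" for c N
    using that RC[OF that(1)] k
    by (intro RL) (auto simp: elim_mat_unimod corner_diagonal_def index_elim_mat_mult R_def)
  have ReR: "R (N * (elim_mat m k c)\<^sup>T)" if "R N" for c N
    using that RC[OF that(1)] k
    by (intro RR) (auto simp: elim_mat_unimod transpose_unimod corner_diagonal_def index_mult_elim_mat_transpose R_def)
  have RM: "R M"
    unfolding R_def using P M by (auto intro!: bexI[of _ "1\<^sub>m m"] simp: one_unimod)
  define N0 where "N0 = swap_mat m k i0 * M * (swap_mat m k j0)\<^sup>T"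
  have "R N0" unfolding N0_def by (rule RsR[OF RsL[OF RM]]) (use i0 in auto)
  moreover have "N0 $$ (k,k) \<noteq> 0"
  proof -
    have "swap_mat m k i0 * M \<in> carrier_mat m m" using M by (auto intro: mult_carrier_mat[of _ m m])
    then have "N0 $$ (k,k) = M $$ (i0,j0)"
      unfolding N0_def using i0 k M by (simp add: index_mult_swap_mat_transpose index_swap_mat_mult)
    with i0 show ?thesis by simp
  qed
  ultimately obtain N where RN: "R N" and d0: "N $$ (k,k) \<noteq> 0"
    and min: "\<And>N'. R N' \<Longrightarrow> N' $$ (k,k) \<noteq> 0 \<Longrightarrow> nat \<bar>N $$ (k,k)\<bar> \<le> nat \<bar>N' $$ (k,k)\<bar>"
    using ex_has_least_nat[of "\<lambda>N. R N \<and> N $$ (k,k) \<noteq> 0" N0 "\<lambda>N. nat \<bar>N $$ (k,k)\<bar>"] by blast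
  define d where "d = N $$ (k,k)"
  have N: "N \<in> carrier_mat m m" using RC RN .
  have small: "N' $$ (k,k) = 0" if "R N'" "\<bar>N' $$ (k,k)\<bar> < \<bar>d\<bar>" for N'
  proof (rule ccontr)
    assume "N' $$ (k,k) \<noteq> 0"
    from min[OF that(1) this] that(2) show False unfolding d_def by linarith
  qed
  have dv: "d dvd N $$ (i,k)" if i: "i < m" "k < i" for i
  proof -
    define c where "c = (\<lambda>_::nat. - (N $$ (i,k) div d))"
    have e: "(elim_mat m k c * N) $$ (i,k) = N $$ (i,k) mod d"
      using i k N by (simp add: index_elim_mat_mult c_def d_def minus_div_mult_eq_mod[symmetric])
    let ?N = "swap_mat m k i * (elim_mat m k c * N)"
    have f: "?N $$ (k,k) = N $$ (i,k) mod d"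
      using i k N e by (subst index_swap_mat_mult) (auto intro!: mult_carrier_mat[of _ m m])
    have "R ?N" by (rule RsL[OF ReL[OF RN]]) (use i in auto)
    moreover have "\<bar>?N $$ (k,k)\<bar> < \<bar>d\<bar>"
      unfolding f using d0 by (intro abs_mod_less) (simp add: d_def)
    ultimately have "?N $$ (k,k) = 0" by (rule small)
    with f show ?thesis by (simp only: dvd_eq_mod_eq_0)
  qed
  have dv': "d dvd N $$ (k,j)" if j: "j < m" "k < j" for j
  proof -
    define c where "c = (\<lambda>_::nat. - (N $$ (k,j) div d))"
    have e: "(N * (elim_mat m k c)\<^sup>T) $$ (k,j) = N $$ (k,j) mod d"
      using j k N by (simp add: index_mult_elim_mat_transpose c_def d_def minus_div_mult_eq_mod[symmetric])
    let ?N = "N * (elim_mat m k c)\<^sup>T * (swap_mat m k j)\<^sup>T"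
    have f: "?N $$ (k,k) = N $$ (k,j) mod d"
      using j k N e by (subst index_mult_swap_mat_transpose) (auto intro!: mult_carrier_mat[of _ m m])
    have "R ?N" by (rule RsR[OF ReR[OF RN]]) (use j in auto)
    moreover have "\<bar>?N $$ (k,k)\<bar> < \<bar>d\<bar>"
      unfolding f using d0 by (intro abs_mod_less) (simp add: d_def)
    ultimately have "?N $$ (k,k) = 0" by (rule small)
    with f show ?thesis by (simp only: dvd_eq_mod_eq_0)
  qed
  define c where "c i = - (N $$ (i,k) div d)" for i
  define c' where "c' j = - (N $$ (k,j) div d)" for j
  \<comment> \<open>The row elimination leaves row k alone, so \<open>E\<close> still has there the
    multiples of d found in \<open>N\<close>. The column elimination leaves column k alone, so the
    zeros already produced survive.\<close>
  define E where "E = elim_mat m k c * N"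
  define F where "F = E * (elim_mat m k c')\<^sup>T"
  have RE: "R E" unfolding E_def by (rule ReL[OF RN])
  have RF: "R F" unfolding F_def by (rule ReR[OF RE])
  have Eik: "E $$ (i,k) = 0" if "i < m" "k < i" for i
    using that dv[OF that] N k by (simp add: E_def index_elim_mat_mult c_def d_def[symmetric])
  have Ekj: "E $$ (k,j) = N $$ (k,j)" if "j < m" for j
    using that N k by (simp add: E_def index_elim_mat_mult)
  have Fij: "F $$ (i,j) = E $$ (i,j) + (if k < j then c' j * E $$ (i,k) else 0)" if "i < m" "j < m" for i j
    using that RC[OF RE] k by (simp add: F_def index_mult_elim_mat_transpose)
  have Fik: "F $$ (i,k) = 0" if "i < m" "k < i" for i
    using that Eik k by (simp add: Fij)
  have Fkj: "F $$ (k,j) = 0" if "j < m" "k < j" for j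
    using that dv'[OF that] k by (simp add: Fij Ekj c'_def d_def[symmetric])
  have "corner_diagonal m k F" using RF by (simp add: R_def)
  with Fik Fkj have "corner_diagonal m (Suc k) F"
    by (intro corner_diagonal_SucI)
  with RF show ?thesis unfolding R_def by auto
qed

text \<open>The form reached is diagonal without a divisibility chain; this fits
  \<open>min_sum\<close>, which is defined for exponents in any order.\<close>

lemma unimod_diagonalize:
  assumes M: "M \<in> carrier_mat m m"
  obtains U V where "U \<in> unimod m" "V \<in> unimod m"
    "\<And>i j. i < m \<Longrightarrow> j < m \<Longrightarrow> i \<noteq> j \<Longrightarrow> (U * M * V) $$ (i,j) = 0"
proof -
  have "\<exists>U\<in>unimod m. \<exists>V\<in>unimod m. corner_diagonal m k (U * M * V)" if "k \<le> m" for k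
    using that
  proof (induction k)
    case 0
    show ?case
      by (intro bexI[of _ "1\<^sub>m m"]) (auto simp: corner_diagonal_def one_unimod)
  next
    case (Suc k)
    then obtain U V where U: "U \<in> unimod m" "V \<in> unimod m" "corner_diagonal m k (U * M * V)" by auto
    have "U * M * V \<in> carrier_mat m m" using M U(1,2)[THEN unimod_carrier] by simp
    from diagonalize_step[OF this _ U(3)] Suc.prems
    obtain U' V' where V: "U' \<in> unimod m" "V' \<in> unimod m" "corner_diagonal m (Suc k) (U' * (U * M * V) * V')"
      by auto
    have "U' * (U * M * V) * V' = (U' * U) * M * (V * V')"
      using M U(1,2)[THEN unimod_carrier] V(1,2)[THEN unimod_carrier]
      by (simp add: assoc_mult_mat[of _ m m _ m _ m] mult_carrier_mat[of _ m m _ m])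
    with V U show ?case
      by (intro bexI[of _ "U' * U"] bexI[of _ "V * V'"]) (auto simp: mult_unimod)
  qed
  from this[of m] that show thesis by (auto simp: corner_diagonal_def)
qed

subsection \<open>Symmetric annihilators modulo a prime power\<close>

definition mat_dvd :: "nat \<Rightarrow> int \<Rightarrow> int mat \<Rightarrow> bool" where
  "mat_dvd m q M \<longleftrightarrow> (\<forall>i<m. \<forall>j<m. q dvd M $$ (i,j))"

definition mat_mod :: "int \<Rightarrow> int mat \<Rightarrow> int mat" where
  "mat_mod q M = map_mat (\<lambda>x. x mod q) M"

definition symmetric_mat :: "nat \<Rightarrow> int mat \<Rightarrow> bool" where
  "symmetric_mat m M \<longleftrightarrow> (\<forall>i<m. \<forall>j<m. M $$ (i,j) = M $$ (j,i))"

text \<open>Reduced representatives S of symmetric matrices modulo q. In an upper block triangular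
  similitude with blocks A, B, D the rational symmetric matrix B D^(-1) is S / q up to integral
  translations, and the annihilation condition makes B = S D / q integral.\<close>

definition sym_ann :: "nat \<Rightarrow> int \<Rightarrow> int mat \<Rightarrow> int mat set" where
  "sym_ann m q D = {S \<in> carrier_mat m m. symmetric_mat m S \<and> (\<forall>i<m. \<forall>j<m. S $$ (i,j) \<in> {0..<q}) \<and>
     mat_dvd m q (S * D)}"

lemma mat_mod_carrier [simp]: "mat_mod q M \<in> carrier_mat k l \<longleftrightarrow> M \<in> carrier_mat k l"
  by (simp add: mat_mod_def)

lemma index_mat_mod [simp]: "M \<in> carrier_mat k l \<Longrightarrow> i < k \<Longrightarrow> j < l \<Longrightarrow> mat_mod q M $$ (i,j) = M $$ (i,j) mod q"
  by (simp add: mat_mod_def)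

lemma symmetric_mat_iff_transpose:
  "M \<in> carrier_mat m m \<Longrightarrow> symmetric_mat m M \<longleftrightarrow> M\<^sup>T = M"
proof
  assume "M \<in> carrier_mat m m" "M\<^sup>T = M"
  then show "symmetric_mat m M"
    unfolding symmetric_mat_def by (metis carrier_matD index_transpose_mat(1))
qed (auto simp: symmetric_mat_def)

lemma mat_dvd_mult_right:
  assumes "mat_dvd m q M" "M \<in> carrier_mat m m" "N \<in> carrier_mat m m"
  shows "mat_dvd m q (M * N)"
  using assms unfolding mat_dvd_def by (auto simp: index_mult_square simp del: index_mult_mat intro!: dvd_sum)

lemma mat_dvd_mult_left:
  assumes "mat_dvd m q M" "M \<in> carrier_mat m m" "N \<in> carrier_mat m m"
  shows "mat_dvd m q (N * M)"
  using assms unfolding mat_dvd_def by (auto simp: index_mult_square simp del: index_mult_mat intro!: dvd_sum)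

lemma mat_mod_mult_dvd_iff:
  assumes S: "S \<in> carrier_mat m m" and D: "D \<in> carrier_mat m m"
  shows "mat_dvd m q (mat_mod q S * D) \<longleftrightarrow> mat_dvd m q (S * D)"
proof -
  have "q dvd (mat_mod q S * D) $$ (i,j) \<longleftrightarrow> q dvd (S * D) $$ (i,j)" if "i < m" "j < m" for i j
  proof -
    have "(\<Sum>k<m. S $$ (i,k) mod q * D $$ (k,j)) mod q = (\<Sum>k<m. S $$ (i,k) * D $$ (k,j)) mod q"
      by (subst (1 2) mod_sum_eq[symmetric]) (simp add: mod_mult_left_eq)
    then show ?thesis
      using that S D by (simp add: index_mult_square dvd_eq_mod_eq_0 del: index_mult_mat)
  qed
  then show ?thesis unfolding mat_dvd_def by auto
qed

lemma mat_mod_eq_iff: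
  assumes "M \<in> carrier_mat m m" "N \<in> carrier_mat m m"
  shows "mat_mod q M = mat_mod q N \<longleftrightarrow> mat_dvd m q (M - N)"
proof
  assume e: "mat_mod q M = mat_mod q N"
  show "mat_dvd m q (M - N)"
    unfolding mat_dvd_def
  proof (intro allI impI)
    fix i j assume ij: "i < m" "j < m"
    have "mat_mod q M $$ (i,j) = mat_mod q N $$ (i,j)" by (simp add: e)
    then show "q dvd (M - N) $$ (i,j)"
      using assms ij by (simp add: mod_eq_dvd_iff)
  qed
next
  assume "mat_dvd m q (M - N)"
  then show "mat_mod q M = mat_mod q N"
    using assms by (intro eq_matI) (auto simp: mat_dvd_def mat_mod_def mod_eq_dvd_iff)
qed

lemma finite_bounded_mats:
  assumes "finite F"
  shows "finite {S \<in> carrier_mat m k. \<forall>i<m. \<forall>j<k. S $$ (i,j) \<in> F}"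
proof -
  have "{S \<in> carrier_mat m k. \<forall>i<m. \<forall>j<k. S $$ (i,j) \<in> F}
      \<subseteq> (\<lambda>f. mat m k f) ` (({..<m} \<times> {..<k}) \<rightarrow>\<^sub>E F)"
  proof
    fix S assume S: "S \<in> {S \<in> carrier_mat m k. \<forall>i<m. \<forall>j<k. S $$ (i,j) \<in> F}"
    then have "S = mat m k (restrict (\<lambda>ij. S $$ ij) ({..<m} \<times> {..<k}))"
      by (intro eq_matI) auto
    moreover have "restrict (\<lambda>ij. S $$ ij) ({..<m} \<times> {..<k}) \<in> ({..<m} \<times> {..<k}) \<rightarrow>\<^sub>E F"
      using S by auto
    ultimately show "S \<in> (\<lambda>f. mat m k f) ` (({..<m} \<times> {..<k}) \<rightarrow>\<^sub>E F)" by blast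
  qed
  then show ?thesis
    by (rule finite_subset) (intro finite_imageI finite_PiE, auto simp: assms)
qed

lemma finite_sym_ann: "finite (sym_ann m q D)"
  by (rule finite_subset[OF _ finite_bounded_mats[of "{0..<q}" m m]]) (auto simp: sym_ann_def)

text \<open>V acts on the columns of S D and does not touch S, so even the set is unchanged; one
  inclusion, applied to V and to its inverse, suffices.\<close>

lemma sym_ann_mult_unimod_right:
  assumes V: "V \<in> unimod m" and D: "D \<in> carrier_mat m m"
  shows "sym_ann m q (D * V) = sym_ann m q D"
proof -
  have sub: "sym_ann m q D \<subseteq> sym_ann m q (D * V)" if "V \<in> unimod m" "D \<in> carrier_mat m m" for V D
  proof
    fix S assume S: "S \<in> sym_ann m q D"
    then have "S \<in> carrier_mat m m" by (simp add: sym_ann_def)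
    then show "S \<in> sym_ann m q (D * V)"
      using S that unimod_carrier[OF that(1)] mat_dvd_mult_right[of m q "S * D" V]
      by (auto simp: sym_ann_def assoc_mult_mat[of _ m m _ m _ m])
  qed
  obtain W where W: "W \<in> unimod m" "V * W = 1\<^sub>m m" using unimod_inverse[OF V] by metis
  have "D * V * W = D"
    using W D unimod_carrier[OF V] unimod_carrier[OF W(1)] by (simp add: assoc_mult_mat[of _ m m _ m _ m])
  with sub[OF W(1), of "D * V"] sub[OF V D] D unimod_carrier[OF V] show ?thesis by auto
qed

text \<open>The congruence S -> U^T S U keeps symmetry and sends annihilators of U D to annihilators
  of D. It is injective modulo q because U is invertible, and the same inequality for the inverse of
  U gives equality.\<close>

lemma card_sym_ann_mult_unimod_left:
  assumes U: "U \<in> unimod m" and D: "D \<in> carrier_mat m m" and q: "q > 0"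
  shows "card (sym_ann m q (U * D)) = card (sym_ann m q D)"
proof -
  have le: "card (sym_ann m q (U * D)) \<le> card (sym_ann m q D)"
    if U: "U \<in> unimod m" and D: "D \<in> carrier_mat m m" for U D
  proof (rule card_inj_on_le[where f = "\<lambda>S. mat_mod q (U\<^sup>T * S * U)"])
    note Uc = unimod_carrier[OF U]
    obtain V where V: "V \<in> unimod m" "U * V = 1\<^sub>m m" using unimod_inverse[OF U] by metis
    note Vc = unimod_carrier[OF V(1)]
    have VU': "V\<^sup>T * U\<^sup>T = 1\<^sub>m m" using V(2) Uc Vc by (metis transpose_mult transpose_one)
    show "inj_on (\<lambda>S. mat_mod q (U\<^sup>T * S * U)) (sym_ann m q (U * D))"
    proof (rule inj_onI)
      fix S S' assume S: "S \<in> sym_ann m q (U * D)" and S': "S' \<in> sym_ann m q (U * D)"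
        and e: "mat_mod q (U\<^sup>T * S * U) = mat_mod q (U\<^sup>T * S' * U)"
      have c: "S \<in> carrier_mat m m" "S' \<in> carrier_mat m m" using S S' by (auto simp: sym_ann_def)
      have "U\<^sup>T * S * U - U\<^sup>T * S' * U = U\<^sup>T * (S - S') * U"
        using c Uc by (simp add: minus_mult_distrib_mat[of _ m m] mult_minus_distrib_mat[of _ m m])
      then have "mat_dvd m q (U\<^sup>T * (S - S') * U)"
        using e c Uc by (subst (asm) mat_mod_eq_iff[of _ m]) auto
      \<comment> \<open>The congruence is undone by \<open>V\<close>, the inverse of
        \<open>U\<close>, which preserves divisibility by q.\<close>
      then have "mat_dvd m q (V\<^sup>T * (U\<^sup>T * (S - S') * U) * V)"
        using c Uc Vc
        by (intro mat_dvd_mult_right[of m q "V\<^sup>T * (U\<^sup>T * (S - S') * U)"]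
            mat_dvd_mult_left[of m q "U\<^sup>T * (S - S') * U"]) auto
      also have "V\<^sup>T * (U\<^sup>T * (S - S') * U) * V = (V\<^sup>T * U\<^sup>T) * (S - S') * (U * V)"
        using minus_carrier_mat[OF c(2), of S] Uc Vc by (simp add: assoc_mult_mat[of _ m m _ m _ m] mult_carrier_mat[of _ m m _ m])
      finally have "mat_dvd m q (S - S')"
        using c by (simp add: VU' V(2))
      then have "mat_mod q S = mat_mod q S'" using c by (simp add: mat_mod_eq_iff[of _ m])
      moreover have "mat_mod q S = S" "mat_mod q S' = S'"
        using S S' by (auto simp: sym_ann_def mat_mod_def intro!: eq_matI)
      ultimately show "S = S'" by simp
    qed
    show "(\<lambda>S. mat_mod q (U\<^sup>T * S * U)) ` sym_ann m q (U * D) \<subseteq> sym_ann m q D"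
    proof (rule image_subsetI)
      fix S assume S: "S \<in> sym_ann m q (U * D)"
      then have c: "S \<in> carrier_mat m m" and sy: "S\<^sup>T = S"
        using symmetric_mat_iff_transpose by (auto simp: sym_ann_def)
      have c': "U\<^sup>T * S * U \<in> carrier_mat m m" using c Uc by simp
      have "(U\<^sup>T * S * U)\<^sup>T = U\<^sup>T * S * U"
        using c Uc sy by (simp add: transpose_mult[of _ m m _ m] assoc_mult_mat[of _ m m _ m _ m])
      then have "symmetric_mat m (U\<^sup>T * S * U)" using symmetric_mat_iff_transpose[OF c'] by simp
      moreover have "mat_dvd m q (U\<^sup>T * S * U * D)"
      proof -
        have "U\<^sup>T * S * U * D = U\<^sup>T * (S * (U * D))"
          using c Uc D by (simp add: assoc_mult_mat[of _ m m _ m _ m] mult_carrier_mat[of _ m m _ m])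
        then show ?thesis
          using S c Uc D by (auto simp: sym_ann_def intro!: mat_dvd_mult_left)
      qed
      ultimately show "mat_mod q (U\<^sup>T * S * U) \<in> sym_ann m q D"
        using c' D q by (auto simp: sym_ann_def mat_mod_mult_dvd_iff symmetric_mat_def)
    qed
  qed (rule finite_sym_ann)
  obtain W where W: "W \<in> unimod m" "W * U = 1\<^sub>m m" using unimod_inverse[OF U] by metis
  have "W * (U * D) = D"
    using W D unimod_carrier[OF U] unimod_carrier[OF W(1)]
    by (simp add: assoc_mult_mat[of _ m m _ m _ m, symmetric])
  with le[OF W(1), of "U * D"] le[OF U D] D unimod_carrier[OF U] show ?thesis by simp
qed

section \<open>Counting the symmetric annihilators of a diagonal matrix\<close>

definition diag_pow :: "nat \<Rightarrow> nat \<Rightarrow> (nat \<Rightarrow> nat) \<Rightarrow> int mat" where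
  "diag_pow m p e = mat m m (\<lambda>(i,j). if i = j then int p ^ e i else 0)"

text \<open>The exponent of p in the number of symmetric annihilators of
  \<open>diag_pow m p e\<close>; the pairs i <= j are the free entries of a symmetric
  matrix.\<close>

definition min_sum :: "nat \<Rightarrow> (nat \<Rightarrow> nat) \<Rightarrow> nat" where
  "min_sum m e = (\<Sum>j<m. \<Sum>i\<le>j. min (e i) (e j))"

lemma diag_pow_carrier [simp]: "diag_pow m p e \<in> carrier_mat m m"
  by (simp add: diag_pow_def)

lemma index_mult_diag_pow:
  assumes "S \<in> carrier_mat m m" "i < m" "j < m"
  shows "(S * diag_pow m p e) $$ (i,j) = S $$ (i,j) * int p ^ e j"
proof -
  have "(S * diag_pow m p e) $$ (i,j) = (\<Sum>k<m. if k = j then S $$ (i,j) * int p ^ e j else 0)"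
    using assms unfolding index_mult_square[OF assms(1) diag_pow_carrier assms(2,3)]
    by (intro sum.cong) (auto simp: diag_pow_def)
  then show ?thesis using assms by simp
qed

lemma diag_pow_mult: "diag_pow m p e * diag_pow m p f = diag_pow m p (\<lambda>i. e i + f i)"
proof (rule eq_matI)
  fix i j assume "i < dim_row (diag_pow m p (\<lambda>i. e i + f i))" "j < dim_col (diag_pow m p (\<lambda>i. e i + f i))"
  then have ij: "i < m" "j < m" by (simp_all add: diag_pow_def)
  then show "(diag_pow m p e * diag_pow m p f) $$ (i,j) = diag_pow m p (\<lambda>i. e i + f i) $$ (i,j)"
    unfolding index_mult_diag_pow[OF diag_pow_carrier ij] by (simp add: diag_pow_def power_add)
qed (simp_all add: diag_pow_def)

lemma det_diag_pow: "det (diag_pow m p e) = int p ^ (\<Sum>i<m. e i)"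
proof -
  have "det (diag_pow m p e) = prod_list (diag_mat (diag_pow m p e))"
    by (rule det_upper_triangular[of _ m]) (auto simp: diag_pow_def)
  also have "\<dots> = (\<Prod>i<m. int p ^ e i)"
    unfolding prod_list_diag_prod by (auto simp: diag_pow_def atLeast0LessThan intro!: prod.cong)
  finally show ?thesis by (simp add: power_sum)
qed

lemma card_multiples_below_power:
  assumes p: "p > 0" and k: "k \<le> r"
  shows "card {x \<in> {0..<int p ^ r}. int p ^ (r - k) dvd x} = p ^ k"
proof -
  have pr: "int p ^ r = int p ^ k * int p ^ (r - k)"
    using k by (simp add: power_add[symmetric])
  have "{x \<in> {0..<int p ^ r}. int p ^ (r - k) dvd x} = (\<lambda>t. t * int p ^ (r - k)) ` {0..<int p ^ k}"
  proof (intro equalityI subsetI)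
    fix x assume x: "x \<in> {x \<in> {0..<int p ^ r}. int p ^ (r - k) dvd x}"
    then obtain t where t: "x = t * int p ^ (r - k)" by (auto simp: dvd_def mult.commute)
    have pos: "int p ^ (r - k) > 0" using p by simp
    from x t have "0 \<le> t * int p ^ (r - k)" "t * int p ^ (r - k) < int p ^ k * int p ^ (r - k)"
      by (auto simp: pr)
    with pos have "0 \<le> t" "t < int p ^ k"
      by (simp_all only: mult_less_cancel_right_pos zero_le_mult_iff) linarith
    with t show "x \<in> (\<lambda>t. t * int p ^ (r - k)) ` {0..<int p ^ k}" by auto
  qed (use p in \<open>auto simp: pr\<close>)
  then have "card {x \<in> {0..<int p ^ r}. int p ^ (r - k) dvd x} = card {0..<int p ^ k}"
    using p by (simp add: card_image inj_on_def)
  then show ?thesis by (simp add: nat_power_eq)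
qed

lemma power_dvd_mult_power_iff:
  assumes "p > 0" "k \<le> r"
  shows "int p ^ r dvd x * int p ^ k \<longleftrightarrow> int p ^ (r - k) dvd x"
proof -
  have "int p ^ r = int p ^ (r - k) * int p ^ k"
    using assms by (simp add: power_add[symmetric])
  then show ?thesis using assms by simp
qed

text \<open>Column j of S must be divisible by p^(r - e j). By symmetry the entry (i,j) must also be
  divisible by p^(r - e i), so it has p^min(e i, e j) possible residues, and the entries on and
  above the diagonal are chosen independently.\<close>

lemma card_sym_ann_diag_pow:
  assumes p: "p > 0" and e: "\<And>i. e i \<le> r"
  shows "card (sym_ann m (int p ^ r) (diag_pow m p e)) = p ^ min_sum m e"
proof -
  \<comment> \<open>Indices are (column, row), so that \<open>I\<close> is a \<open>SIGMA\<close>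
    over columns and the product takes the shape of \<open>min_sum\<close>. One index stands for two
    symmetric positions, hence the minimum of both exponents.\<close>
  define B where "B = (\<lambda>(j,i). {x \<in> {0..<int p ^ r}. int p ^ (r - min (e i) (e j)) dvd x})"
  define I where "I = (SIGMA j:{..<m}. {..j})"
  define g where "g S = restrict (\<lambda>(j,i). S $$ (i,j)) I" for S :: "int mat"
  have mem: "S \<in> sym_ann m (int p ^ r) (diag_pow m p e) \<longleftrightarrow>
     S \<in> carrier_mat m m \<and> symmetric_mat m S \<and> (\<forall>j<m. \<forall>i\<le>j. S $$ (i,j) \<in> B (j,i))" for S
  proof -
    have "S \<in> sym_ann m (int p ^ r) (diag_pow m p e) \<longleftrightarrow> S \<in> carrier_mat m m \<and> symmetric_mat m S \<and>
       (\<forall>i<m. \<forall>j<m. S $$ (i,j) \<in> {0..<int p ^ r} \<and> int p ^ (r - e j) dvd S $$ (i,j))"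
      using e p by (auto simp: sym_ann_def mat_dvd_def index_mult_diag_pow power_dvd_mult_power_iff simp del: index_mult_mat)
    moreover have "(\<forall>i<m. \<forall>j<m. S $$ (i,j) \<in> {0..<int p ^ r} \<and> int p ^ (r - e j) dvd S $$ (i,j))
       \<longleftrightarrow> (\<forall>j<m. \<forall>i\<le>j. S $$ (i,j) \<in> B (j,i))" if sy: "symmetric_mat m S"
    proof (intro iffI allI impI)
      fix i j assume a: "\<forall>i<m. \<forall>j<m. S $$ (i,j) \<in> {0..<int p ^ r} \<and> int p ^ (r - e j) dvd S $$ (i,j)"
        and ij: "j < m" "i \<le> j"
      have "int p ^ (r - e j) dvd S $$ (i,j)" "int p ^ (r - e i) dvd S $$ (j,i)" using a ij by auto
      moreover have "S $$ (j,i) = S $$ (i,j)" using sy ij unfolding symmetric_mat_def by auto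
      ultimately show "S $$ (i,j) \<in> B (j,i)" using a ij by (auto simp: B_def min_def)
    next
      fix i j assume a: "\<forall>j<m. \<forall>i\<le>j. S $$ (i,j) \<in> B (j,i)" and ij: "i < m" "j < m"
      have s: "S $$ (j,i) = S $$ (i,j)" using sy ij unfolding symmetric_mat_def by auto
      have "S $$ (i,j) \<in> {0..<int p ^ r} \<and> int p ^ (r - min (e i) (e j)) dvd S $$ (i,j)"
      proof (cases "i \<le> j")
        case True
        with a ij show ?thesis by (auto simp: B_def)
      next
        case False
        then have "S $$ (j,i) \<in> B (i,j)" using a ij by auto
        with s show ?thesis by (auto simp: B_def min.commute)
      qed
      moreover have "int p ^ (r - e j) dvd int p ^ (r - min (e i) (e j))"
        by (intro le_imp_power_dvd) auto
      ultimately show "S $$ (i,j) \<in> {0..<int p ^ r} \<and> int p ^ (r - e j) dvd S $$ (i,j)"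
        using dvd_trans by blast
    qed
    ultimately show ?thesis by blast
  qed
  have "bij_betw g (sym_ann m (int p ^ r) (diag_pow m p e)) (Pi\<^sub>E I B)"
  proof (rule bij_betw_byWitness[where f' = "\<lambda>f. mat m m (\<lambda>(i,j). if i \<le> j then f (j,i) else f (i,j))"])
    show "\<forall>S\<in>sym_ann m (int p ^ r) (diag_pow m p e). mat m m (\<lambda>(i,j). if i \<le> j then g S (j,i) else g S (i,j)) = S"
      by (auto simp: mem g_def I_def symmetric_mat_def intro!: eq_matI)
    show "\<forall>f\<in>Pi\<^sub>E I B. g (mat m m (\<lambda>(i,j). if i \<le> j then f (j,i) else f (i,j))) = f"
    proof
      fix f assume f: "f \<in> Pi\<^sub>E I B"
      show "g (mat m m (\<lambda>(i,j). if i \<le> j then f (j,i) else f (i,j))) = f"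
      proof
        fix x show "g (mat m m (\<lambda>(i,j). if i \<le> j then f (j,i) else f (i,j))) x = f x"
          using PiE_arb[OF f, of x] by (cases x) (auto simp: g_def I_def restrict_def)
      qed
    qed
    show "g ` sym_ann m (int p ^ r) (diag_pow m p e) \<subseteq> Pi\<^sub>E I B"
      by (auto simp: mem g_def I_def intro!: restrict_PiE_iff[THEN iffD2])
    show "(\<lambda>f. mat m m (\<lambda>(i,j). if i \<le> j then f (j,i) else f (i,j))) ` Pi\<^sub>E I B
        \<subseteq> sym_ann m (int p ^ r) (diag_pow m p e)"
    proof (rule image_subsetI)
      fix f assume f: "f \<in> Pi\<^sub>E I B"
      then have "f (j,i) \<in> B (j,i)" if "j < m" "i \<le> j" for i j
        using that by (auto simp: I_def)
      then show "mat m m (\<lambda>(i,j). if i \<le> j then f (j,i) else f (i,j)) \<in> sym_ann m (int p ^ r) (diag_pow m p e)"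
        unfolding mem symmetric_mat_def by auto
    qed
  qed
  then have "card (sym_ann m (int p ^ r) (diag_pow m p e)) = card (Pi\<^sub>E I B)"
    by (rule bij_betw_same_card)
  also have "\<dots> = (\<Prod>x\<in>I. card (B x))"
    by (rule card_PiE) (simp add: I_def)
  also have "\<dots> = (\<Prod>(j,i)\<in>I. p ^ min (e i) (e j))"
  proof (rule prod.cong, simp, clarify)
    fix j i show "card (B (j,i)) = p ^ min (e i) (e j)"
      unfolding B_def prod.case by (intro card_multiples_below_power p min.coboundedI1 e)
  qed
  also have "\<dots> = (\<Prod>j<m. \<Prod>i\<le>j. p ^ min (e i) (e j))"
    unfolding I_def by (subst prod.Sigma[symmetric]) auto
  also have "\<dots> = p ^ min_sum m e"
    by (simp add: min_sum_def power_sum)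
  finally show ?thesis .
qed

text \<open>For each pair it is the identity r - max(a,b) + a + b = r + min(a,b). Each index occurs
  m + 1 times among the pairs i <= j, the diagonal pair counting twice.\<close>

lemma min_sum_complement:
  assumes "\<And>i. e i \<le> r"
  shows "min_sum m (\<lambda>i. r - e i) + (m + 1) * (\<Sum>i<m. e i) = min_sum m e + r * (\<Sum>j<m. Suc j)"
proof (induction m)
  case (Suc m)
  have "(\<Sum>i\<le>m. min (r - e i) (r - e m)) + (\<Sum>i\<le>m. e i + e m) = (\<Sum>i\<le>m. min (e i) (e m)) + (\<Sum>i\<le>m. r)"
    unfolding sum.distrib[symmetric]
  proof (rule sum.cong)
    fix i show "min (r - e i) (r - e m) + (e i + e m) = min (e i) (e m) + r"
      using assms[of i] assms[of m] by (auto simp: min_def)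
  qed simp
  moreover have "(\<Sum>i\<le>m. e i + e m) = (\<Sum>i<m. e i) + e m + (m + 1) * e m"
    by (simp add: sum.distrib lessThan_Suc_atMost[symmetric])
  ultimately show ?case
    using Suc by (simp add: min_sum_def algebra_simps)
qed (simp add: min_sum_def)

section \<open>Integral divisors of a prime power and their diagonal form\<close>

definition divisor_mats :: "nat \<Rightarrow> int \<Rightarrow> int mat set" where
  "divisor_mats m q = {D \<in> carrier_mat m m. \<exists>A\<in>carrier_mat m m. A * D = q \<cdot>\<^sub>m 1\<^sub>m m}"

lemma divisor_mats_carrier: "D \<in> divisor_mats m q \<Longrightarrow> D \<in> carrier_mat m m"
  by (simp add: divisor_mats_def)

text \<open>The cofactor of D transforms into a cofactor of its diagonal form, so every diagonal
  entry divides p^r and is a power of p up to sign. The signs are absorbed into the left unimodular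
  factor.\<close>

lemma divisor_mats_diagonal_form:
  assumes p: "prime p" and D: "D \<in> divisor_mats m (int p ^ r)"
  obtains U V e where "U \<in> unimod m" "V \<in> unimod m" "\<And>i. e i \<le> r" "D = U * diag_pow m p e * V"
proof -
  let ?q = "int p ^ r"
  obtain A where Dc: "D \<in> carrier_mat m m" and A: "A \<in> carrier_mat m m" and AD: "A * D = ?q \<cdot>\<^sub>m 1\<^sub>m m"
    using D by (auto simp: divisor_mats_def)
  have q0: "?q \<noteq> 0" using p by auto
  have DA: "D * A = ?q \<cdot>\<^sub>m 1\<^sub>m m" by (rule scalar_left_inverse_imp_right[OF A Dc AD q0])
  obtain U V where U: "U \<in> unimod m" and V: "V \<in> unimod m"
    and od: "\<And>i j. i < m \<Longrightarrow> j < m \<Longrightarrow> i \<noteq> j \<Longrightarrow> (U * D * V) $$ (i,j) = 0"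
    using unimod_diagonalize[OF Dc] by blast
  note Uc = unimod_carrier[OF U] and Vc = unimod_carrier[OF V]
  define N where "N = U * D * V"
  have Nc: "N \<in> carrier_mat m m" unfolding N_def using Uc Vc Dc by simp
  obtain U' where U': "U' \<in> unimod m" "U' * U = 1\<^sub>m m" "U * U' = 1\<^sub>m m" using unimod_inverse[OF U] by metis
  obtain V' where V': "V' \<in> unimod m" "V' * V = 1\<^sub>m m" "V * V' = 1\<^sub>m m" using unimod_inverse[OF V] by metis
  note Uc' = unimod_carrier[OF U'(1)] and Vc' = unimod_carrier[OF V'(1)]
  have "N * (V' * A * U') = U * D * (V * V') * A * U'"
    unfolding N_def using Uc Vc Uc' Vc' Dc A
    by (simp add: assoc_mult_mat[of _ m m _ m _ m] mult_carrier_mat[of _ m m _ m])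
  also have "\<dots> = U * (D * A) * U'"
    unfolding V'(3) using Uc Vc Uc' Vc' Dc A
    by (simp add: assoc_mult_mat[of _ m m _ m _ m] mult_carrier_mat[of _ m m _ m])
  also have "\<dots> = ?q \<cdot>\<^sub>m 1\<^sub>m m"
    unfolding DA using Uc Uc' U'(3) by (simp add: mult_scalar_mat[of _ m m] mult_smult_assoc_mat[of _ m m _ m])
  finally have NX: "N * (V' * A * U') = ?q \<cdot>\<^sub>m 1\<^sub>m m" .
  have "N $$ (i,i) dvd ?q" if i: "i < m" for i
  proof -
    have X: "V' * A * U' \<in> carrier_mat m m" using Vc' A Uc' by simp
    have "(N * (V' * A * U')) $$ (i,i) = (\<Sum>k<m. if k = i then N $$ (i,i) * (V' * A * U') $$ (i,i) else 0)"
      unfolding index_mult_square[OF Nc X i i]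
      using i od unfolding N_def[symmetric] by (intro sum.cong) auto
    with i NX show ?thesis by (simp del: index_mult_mat)
  qed
  then have "\<exists>l\<le>r. \<bar>N $$ (i,i)\<bar> = int p ^ l" if i: "i < m" for i
    using i p divides_primepow[of "int p" "N $$ (i,i)" r] by (metis normalize_int_def prime_nat_int_transfer normalize_power prime_int_nat_transfer)
  then obtain e0 where e0: "\<And>i. i < m \<Longrightarrow> e0 i \<le> r \<and> \<bar>N $$ (i,i)\<bar> = int p ^ e0 i" by metis
  \<comment> \<open>The value 0 outside the matrix makes the bound e i <= r valid for every index,
    as the counting lemmas ask.\<close>
  define e where "e i = (if i < m then e0 i else 0)" for i
  define G where "G = mat m m (\<lambda>(i,j). if i = j then sgn (N $$ (i,i)) else 0)"
  have G: "G \<in> unimod m"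
  proof -
    have "det G = prod_list (diag_mat G)"
      by (rule det_upper_triangular[of _ m]) (auto simp: G_def)
    also have "\<dots> = (\<Prod>i<m. sgn (N $$ (i,i)))"
      unfolding prod_list_diag_prod by (auto simp: G_def atLeast0LessThan intro!: prod.cong)
    finally have "\<bar>det G\<bar> = (\<Prod>i<m. \<bar>sgn (N $$ (i,i))\<bar>)" by (simp add: abs_prod)
    also have "\<dots> = 1"
    proof (rule prod.neutral, rule ballI)
      fix i assume "i \<in> {..<m}"
      then have "N $$ (i,i) \<noteq> 0" using e0[of i] p by auto
      then show "\<bar>sgn (N $$ (i,i))\<bar> = 1" by (simp add: abs_sgn_eq)
    qed
    finally show ?thesis by (simp add: unimod_def G_def)
  qed
  have NG: "N = G * diag_pow m p e"
  proof (rule eq_matI)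
    fix i j assume "i < dim_row (G * diag_pow m p e)" "j < dim_col (G * diag_pow m p e)"
    then have ij: "i < m" "j < m" by (auto simp: G_def diag_pow_def)
    have "(G * diag_pow m p e) $$ (i,j) = G $$ (i,j) * int p ^ e j"
      using ij by (intro index_mult_diag_pow) (auto simp: G_def)
    also have "\<dots> = N $$ (i,j)"
    proof (cases "i = j")
      case True
      have "int p ^ e j = \<bar>N $$ (j,j)\<bar>" using e0[OF ij(2)] ij by (simp add: e_def)
      with True ij show ?thesis by (simp add: G_def sgn_mult_abs)
    next
      case False
      with ij od show ?thesis by (simp add: G_def N_def)
    qed
    finally show "N $$ (i,j) = (G * diag_pow m p e) $$ (i,j)" by simp
  qed (use Nc in \<open>auto simp: G_def diag_pow_def\<close>)
  have "D = (U' * U) * D * (V * V')" using Dc U' V' by simp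
  also have "\<dots> = U' * N * V'"
    unfolding N_def using Uc Vc Uc' Vc' Dc
    by (simp add: assoc_mult_mat[of _ m m _ m _ m] mult_carrier_mat[of _ m m _ m])
  also have "\<dots> = (U' * G) * diag_pow m p e * V'"
    unfolding NG using Uc' unimod_carrier[OF G] by (simp add: assoc_mult_mat[of _ m m _ m _ m])
  finally have "D = (U' * G) * diag_pow m p e * V'" .
  moreover have "e i \<le> r" for i using e0 by (simp add: e_def)
  ultimately show thesis
    using that[of "U' * G" V' e] U' V' G mult_unimod by blast
qed

lemma card_sym_ann_diagonal_form:
  assumes "p > 0" "U \<in> unimod m" "V \<in> unimod m" "\<And>i. e i \<le> r"
  shows "card (sym_ann m (int p ^ r) (U * diag_pow m p e * V)) = p ^ min_sum m e"
proof -
  have "U * diag_pow m p e \<in> carrier_mat m m" using unimod_carrier[OF assms(2)] by simp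
  then show ?thesis
    using assms by (simp add: sym_ann_mult_unimod_right card_sym_ann_mult_unimod_left card_sym_ann_diag_pow)
qed

lemma multiplicity_det_diagonal_form:
  assumes "prime p" "U \<in> unimod m" "V \<in> unimod m"
  shows "multiplicity (int p) (det (U * diag_pow m p e * V)) = (\<Sum>i<m. e i)"
proof -
  have "det (U * diag_pow m p e * V) = det U * det V * int p ^ (\<Sum>i<m. e i)"
    using unimod_carrier[OF assms(2)] unimod_carrier[OF assms(3)]
    by (simp add: det_mult[of _ m] det_diag_pow)
  moreover have "is_unit (det U * det V)"
    using assms by (simp add: unimod_def abs_mult)
  ultimately show ?thesis
    using assms(1) by (simp add: multiplicity_times_unit_right multiplicity_times_unit_left)
qed

subsection \<open>Cosets of divisors and Hermite forms\<close>

definition lcoset :: "nat \<Rightarrow> int mat \<Rightarrow> int mat set" where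
  "lcoset m D = (\<lambda>U. U * D) ` unimod m"

definition lcosets :: "nat \<Rightarrow> int \<Rightarrow> int mat set set" where
  "lcosets m q = lcoset m ` divisor_mats m q"

definition coset_rep :: "int mat set \<Rightarrow> int mat" where
  "coset_rep C = (SOME D. D \<in> C)"

text \<open>This count and \<open>det_val\<close> are read off a chosen representative;
  \<open>sym_count_lcoset\<close> and \<open>det_val_lcoset\<close> show that any representative
  gives the same value.\<close>

definition sym_count :: "nat \<Rightarrow> int \<Rightarrow> int mat set \<Rightarrow> nat" where
  "sym_count m q C = card (sym_ann m q (coset_rep C))"

definition det_val :: "nat \<Rightarrow> int mat set \<Rightarrow> nat" where
  "det_val p C = multiplicity (int p) (det (coset_rep C))"

lemma lcoset_self: "D \<in> carrier_mat m m \<Longrightarrow> D \<in> lcoset m D"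
  unfolding lcoset_def using one_unimod by (auto intro!: rev_image_eqI[of "1\<^sub>m m"])

lemma lcoset_sym:
  assumes "D' \<in> lcoset m D" "D \<in> carrier_mat m m"
  shows "D \<in> lcoset m D'"
proof -
  obtain U where U: "U \<in> unimod m" "D' = U * D" using assms by (auto simp: lcoset_def)
  obtain V where V: "V \<in> unimod m" "V * U = 1\<^sub>m m" using unimod_inverse[OF U(1)] by metis
  have "V * D' = D"
    using U(2) V(2) assms(2) assoc_mult_mat[OF unimod_carrier[OF V(1)] unimod_carrier[OF U(1)] assms(2)] by simp
  with V show ?thesis unfolding lcoset_def by blast
qed

lemma lcoset_carrier: "D' \<in> lcoset m D \<Longrightarrow> D \<in> carrier_mat m m \<Longrightarrow> D' \<in> carrier_mat m m"
  by (auto simp: lcoset_def dest: unimod_carrier)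

lemma lcoset_subset:
  assumes "D' \<in> lcoset m D" "D \<in> carrier_mat m m"
  shows "lcoset m D' \<subseteq> lcoset m D"
proof
  fix M assume "M \<in> lcoset m D'"
  then obtain V U where V: "V \<in> unimod m" "M = V * D'" "U \<in> unimod m" "D' = U * D"
    using assms(1) by (auto simp: lcoset_def)
  then have "M = (V * U) * D"
    using assoc_mult_mat[OF unimod_carrier[OF V(1)] unimod_carrier[OF V(3)] assms(2)] by simp
  with V show "M \<in> lcoset m D" unfolding lcoset_def using mult_unimod by blast
qed

lemma lcoset_eq:
  assumes "D' \<in> lcoset m D" "D \<in> carrier_mat m m"
  shows "lcoset m D' = lcoset m D"
  using lcoset_subset[OF assms] lcoset_subset[OF lcoset_sym[OF assms] lcoset_carrier[OF assms]] by blast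

lemma lcoset_unimod_mult:
  "U \<in> unimod m \<Longrightarrow> D \<in> carrier_mat m m \<Longrightarrow> lcoset m (U * D) = lcoset m D"
  by (rule lcoset_eq) (auto simp: lcoset_def)

lemma coset_rep_in: "D \<in> carrier_mat m m \<Longrightarrow> coset_rep (lcoset m D) \<in> lcoset m D"
  unfolding coset_rep_def by (rule someI) (rule lcoset_self)

lemma divisor_mats_unimod_left:
  assumes U: "U \<in> unimod m" and D: "D \<in> divisor_mats m q"
  shows "U * D \<in> divisor_mats m q"
proof -
  obtain V where V: "V \<in> unimod m" "V * U = 1\<^sub>m m" using unimod_inverse[OF U] by metis
  obtain A where A: "D \<in> carrier_mat m m" "A \<in> carrier_mat m m" "A * D = q \<cdot>\<^sub>m 1\<^sub>m m"
    using D by (auto simp: divisor_mats_def)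
  note c = unimod_carrier[OF U] unimod_carrier[OF V(1)]
  have "A * V * (U * D) = A * (V * U) * D"
    using A(1,2) c by (simp add: assoc_mult_mat[of _ m m _ m _ m] mult_carrier_mat[of _ m m _ m])
  also have "\<dots> = q \<cdot>\<^sub>m 1\<^sub>m m" using A V by simp
  finally show ?thesis
    unfolding divisor_mats_def using A(1,2) c by (auto intro!: bexI[of _ "A * V"])
qed

lemma lcoset_divisor_mats: "D' \<in> lcoset m D \<Longrightarrow> D \<in> divisor_mats m q \<Longrightarrow> D' \<in> divisor_mats m q"
  by (auto simp: lcoset_def divisor_mats_unimod_left)

lemma lcosetsE:
  assumes "C \<in> lcosets m q"
  obtains D where "D \<in> divisor_mats m q" "C = lcoset m D" "coset_rep C = D"
proof -
  obtain D where D: "D \<in> divisor_mats m q" "C = lcoset m D" using assms by (auto simp: lcosets_def)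
  have r: "coset_rep C \<in> lcoset m D" unfolding D(2) by (rule coset_rep_in[OF divisor_mats_carrier[OF D(1)]])
  show thesis
    using that[of "coset_rep C"] lcoset_divisor_mats[OF r D(1)] lcoset_eq[OF r divisor_mats_carrier[OF D(1)]] D(2)
    by simp
qed

lemma sym_count_lcoset:
  assumes "D \<in> carrier_mat m m" "q > 0"
  shows "sym_count m q (lcoset m D) = card (sym_ann m q D)"
  using coset_rep_in[OF assms(1)] assms card_sym_ann_mult_unimod_left
  by (auto simp: sym_count_def lcoset_def)

lemma det_val_lcoset:
  assumes "D \<in> carrier_mat m m"
  shows "det_val p (lcoset m D) = multiplicity (int p) (det D)"
proof -
  obtain U where "U \<in> unimod m" "coset_rep (lcoset m D) = U * D"
    using coset_rep_in[OF assms] by (auto simp: lcoset_def)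
  then show ?thesis
    using assms by (simp add: det_val_def det_mult[of _ m] unimod_def multiplicity_times_unit_right)
qed

lemma divisor_mats_diagonal_formI:
  assumes U: "U \<in> unimod m" and V: "V \<in> unimod m" and e: "\<And>i. i < m \<Longrightarrow> e i \<le> r"
  shows "U * diag_pow m p e * V \<in> divisor_mats m (int p ^ r)"
proof -
  obtain U' where U': "U' \<in> unimod m" "U' * U = 1\<^sub>m m" using unimod_inverse[OF U] by metis
  obtain V' where V': "V' \<in> unimod m" "V' * V = 1\<^sub>m m" using unimod_inverse[OF V] by metis
  note c = unimod_carrier[OF U] unimod_carrier[OF V] unimod_carrier[OF U'(1)] unimod_carrier[OF V'(1)]
  let ?A = "V' * diag_pow m p (\<lambda>i. r - e i) * U'"
  have dd: "diag_pow m p (\<lambda>i. r - e i) * diag_pow m p e = int p ^ r \<cdot>\<^sub>m 1\<^sub>m m"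
    unfolding diag_pow_mult using e by (intro eq_matI) (auto simp: diag_pow_def)
  have "?A * (U * diag_pow m p e * V) = V' * (diag_pow m p (\<lambda>i. r - e i) * (U' * U) * diag_pow m p e) * V"
    using c by (simp add: assoc_mult_mat[of _ m m _ m _ m] mult_carrier_mat[of _ m m _ m])
  also have "\<dots> = V' * (int p ^ r \<cdot>\<^sub>m 1\<^sub>m m) * V"
    unfolding U'(2) by (simp add: dd right_mult_one_mat[of _ m m])
  also have "\<dots> = int p ^ r \<cdot>\<^sub>m 1\<^sub>m m"
    using c V'(2) by (simp add: mult_scalar_mat[of _ m m] mult_smult_assoc_mat[of _ m m _ m])
  finally show ?thesis
    unfolding divisor_mats_def using c by (auto intro!: bexI[of _ ?A])
qed

section \<open>Hermite forms under left multiplication by unimodular matrices\<close>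

definition hermite :: "nat \<Rightarrow> int mat \<Rightarrow> bool" where
  "hermite m D \<longleftrightarrow> D \<in> carrier_mat m m \<and> upper_triangular D \<and> (\<forall>i<m. D $$ (i,i) > 0) \<and>
     (\<forall>j<m. \<forall>i<j. D $$ (i,j) \<in> {0..<D $$ (j,j)})"

text \<open>The condition in column j involves only the multipliers up to j, so they can be chosen
  from left to right: the newest one is minus the quotient by the pivot
  \<open>T j j\<close>.\<close>

lemma reduce_row:
  fixes b :: "nat \<Rightarrow> int"
  assumes "\<And>j. j < m \<Longrightarrow> T j j > 0" "l \<le> m"
  shows "\<exists>x. \<forall>j\<in>{i<..<l}. b j + (\<Sum>k\<in>{i<..j}. x k * T k j) \<in> {0..<T j j}"
  using \<open>l \<le> m\<close>
proof (induction l)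
  case (Suc l)
  then obtain x where x: "\<And>j. j \<in> {i<..<l} \<Longrightarrow> b j + (\<Sum>k\<in>{i<..j}. x k * T k j) \<in> {0..<T j j}"
    by (meson Suc_leD)
  define t where "t = b l + (\<Sum>k\<in>{i<..<l}. x k * T k l)"
  define x' where "x' = x(l := - (t div T l l))"
  have "b j + (\<Sum>k\<in>{i<..j}. x' k * T k j) \<in> {0..<T j j}" if j: "j \<in> {i<..<Suc l}" for j
  proof (cases "j = l")
    case False
    then have "(\<Sum>k\<in>{i<..j}. x' k * T k j) = (\<Sum>k\<in>{i<..j}. x k * T k j)"
      using j by (intro sum.cong) (auto simp: x'_def)
    with x[of j] j False show ?thesis by auto
  next
    case True
    have "{i<..l} = insert l {i<..<l}" using j True by auto
    then have "(\<Sum>k\<in>{i<..l}. x' k * T k l) = x' l * T l l + (\<Sum>k\<in>{i<..<l}. x' k * T k l)"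
      by simp
    also have "(\<Sum>k\<in>{i<..<l}. x' k * T k l) = (\<Sum>k\<in>{i<..<l}. x k * T k l)"
      by (intro sum.cong) (auto simp: x'_def)
    finally have "b l + (\<Sum>k\<in>{i<..l}. x' k * T k l) = t mod T l l"
      by (simp add: t_def[symmetric] x'_def minus_div_mult_eq_mod[symmetric])
    with True assms(1)[of l] Suc.prems show ?thesis by auto
  qed
  then show ?case by blast
qed auto

lemma upper_triangular_unitriangular_unimod:
  assumes "U \<in> carrier_mat m m" "upper_triangular U" "\<And>i. i < m \<Longrightarrow> \<bar>U $$ (i,i)\<bar> = 1"
  shows "U \<in> unimod m"
proof -
  have "det U = (\<Prod>i<m. U $$ (i,i))"
    using det_upper_triangular[OF assms(2,1)] assms(1) by (simp add: prod_list_diag_prod atLeast0LessThan)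
  then show ?thesis using assms by (simp add: unimod_def abs_prod)
qed

lemma hermite_form:
  assumes D: "D \<in> carrier_mat m m" and d: "det D \<noteq> 0"
  obtains U where "U \<in> unimod m" "hermite m (U * D)"
proof -
  obtain U where U: "U \<in> unimod m" and ut: "upper_triangular (U * D)"
    using unimod_triangularize[OF D] by blast
  note Uc = unimod_carrier[OF U]
  define T where "T = U * D"
  have T: "T \<in> carrier_mat m m" using Uc D by (simp add: T_def)
  have utT: "upper_triangular T" using ut by (simp add: T_def)
  have "det T \<noteq> 0"
    using U d by (auto simp: T_def det_mult[OF Uc D] unimod_def)
  then have "(\<Prod>i<m. T $$ (i,i)) \<noteq> 0"
    using det_upper_triangular[OF utT T] T by (simp add: prod_list_diag_prod atLeast0LessThan)
  then have T0: "T $$ (i,i) \<noteq> 0" if "i < m" for i using that by auto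
  define G where "G = mat m m (\<lambda>(i,j). if i = j then sgn (T $$ (i,i)) else 0)"
  have G: "G \<in> unimod m"
    using T0 by (intro upper_triangular_unitriangular_unimod) (auto simp: G_def abs_sgn_eq)
  have Gc: "G \<in> carrier_mat m m" by (simp add: G_def)
  define T' where "T' = G * T"
  have T': "T' \<in> carrier_mat m m" using T Gc by (simp add: T'_def)
  have GT: "T' $$ (i,j) = sgn (T $$ (i,i)) * T $$ (i,j)" if "i < m" "j < m" for i j
  proof -
    have "T' $$ (i,j) = (\<Sum>k<m. if k = i then sgn (T $$ (i,i)) * T $$ (i,j) else 0)"
      unfolding T'_def index_mult_square[OF Gc T that] using that by (intro sum.cong) (auto simp: G_def)
    with that show ?thesis by simp
  qed
  have T'0: "T' $$ (i,j) = 0" if "i < m" "j < i" for i j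
    using GT[of i j] that upper_triangularD[OF utT that(2)] T by simp
  have T'p: "T' $$ (i,i) > 0" if "i < m" for i
    using GT[OF that that] T0[OF that] by (simp add: mult.commute abs_sgn[symmetric])
  have "\<exists>x. \<forall>j\<in>{i<..<m}. T' $$ (i,j) + (\<Sum>k\<in>{i<..j}. x k * T' $$ (k,j)) \<in> {0..<T' $$ (j,j)}" for i
    by (rule reduce_row[where T = "\<lambda>i j. T' $$ (i,j)" and m = m]) (auto simp: T'p)
  then obtain x where x: "\<And>i j. j \<in> {i<..<m} \<Longrightarrow>
      T' $$ (i,j) + (\<Sum>k\<in>{i<..j}. x i k * T' $$ (k,j)) \<in> {0..<T' $$ (j,j)}"
    by metis
  \<comment> \<open>Row i of \<open>X\<close> holds the multipliers that reduce row i. All rows are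
    reduced at once against the rows of \<open>T'\<close>, so that reducing one row cannot spoil
    another.\<close>
  define X where "X = mat m m (\<lambda>(i,k). if i = k then 1 else if i < k then x i k else 0)"
  have Xc: "X \<in> carrier_mat m m" by (simp add: X_def)
  have X: "X \<in> unimod m"
    by (intro upper_triangular_unitriangular_unimod) (auto simp: X_def)
  have XT: "(X * T') $$ (i,j) = (if j < i then 0 else T' $$ (i,j) + (\<Sum>k\<in>{i<..j}. x i k * T' $$ (k,j)))"
    if ij: "i < m" "j < m" for i j
  proof -
    have "(X * T') $$ (i,j) = (\<Sum>k<m. (if k = i then T' $$ (i,j) else 0) +
        (if k \<in> {i<..j} then x i k * T' $$ (k,j) else 0))"
      unfolding index_mult_square[OF Xc T' ij] using ij T'0
      by (intro sum.cong) (auto simp: X_def)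
    also have "\<dots> = T' $$ (i,j) + (\<Sum>k\<in>{i<..j}. x i k * T' $$ (k,j))"
    proof -
      have "(\<Sum>k<m. if k \<in> {i<..j} then x i k * T' $$ (k,j) else 0) = (\<Sum>k\<in>{i<..j}. x i k * T' $$ (k,j))"
        using ij by (intro sum.mono_neutral_cong_right) auto
      with ij show ?thesis by (simp add: sum.distrib)
    qed
    also have "\<dots> = (if j < i then 0 else T' $$ (i,j) + (\<Sum>k\<in>{i<..j}. x i k * T' $$ (k,j)))"
      using ij T'0 by auto
    finally show ?thesis .
  qed
  have e: "X * G * U * D = X * T'"
    using Xc Gc Uc D unfolding T'_def T_def
    by (simp add: assoc_mult_mat[of _ m m _ m _ m] mult_carrier_mat[of _ m m _ m])
  have "hermite m (X * T')"
    unfolding hermite_def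
  proof (intro conjI allI impI)
    show c: "X * T' \<in> carrier_mat m m" using Xc T' by simp
    show "upper_triangular (X * T')"
      using Xc T' XT by (intro upper_triangularI) (auto simp del: index_mult_mat(1))
    show "(X * T') $$ (i,i) > 0" if "i < m" for i using XT[OF that that] T'p[OF that] by simp
    show "(X * T') $$ (i,j) \<in> {0..<(X * T') $$ (j,j)}" if "j < m" "i < j" for i j
      using XT[of i j] XT[of j j] x[of j i] that by simp
  qed
  with e show thesis
    using that[of "X * G * U"] X G U mult_unimod by auto
qed

text \<open>The cofactor of a triangular matrix is triangular, so the diagonals multiply to q. If A
  has a 1 on its diagonal, the equation for the entry (i,j) shows that the pivot of column j divides
  D at (i,j); a reduced entry divisible by its pivot is zero.\<close>

lemma hermite_divisor:
  assumes H: "hermite m D" and A: "A \<in> carrier_mat m m" and AD: "A * D = q \<cdot>\<^sub>m 1\<^sub>m m" and i: "i < m"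
  shows "A $$ (i,i) * D $$ (i,i) = q"
    and "A $$ (i,i) = 1 \<Longrightarrow> i < j \<Longrightarrow> j < m \<Longrightarrow> D $$ (i,j) = 0"
proof -
  have D: "D \<in> carrier_mat m m" and ut: "\<And>i j. j < i \<Longrightarrow> i < m \<Longrightarrow> D $$ (i,j) = 0"
    and pos: "\<And>i. i < m \<Longrightarrow> D $$ (i,i) > 0"
    and red: "\<And>i j. i < j \<Longrightarrow> j < m \<Longrightarrow> D $$ (i,j) \<in> {0..<D $$ (j,j)}"
    using H by (auto simp: hermite_def)
  have prd: "(\<Sum>k\<le>j. A $$ (i,k) * D $$ (k,j)) = (if i = j then q else 0)" if j: "j < m" for j
  proof -
    have "(\<Sum>k\<le>j. A $$ (i,k) * D $$ (k,j)) = (\<Sum>k<m. A $$ (i,k) * D $$ (k,j))"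
      using j ut by (intro sum.mono_neutral_left) auto
    also have "\<dots> = (A * D) $$ (i,j)" using index_mult_square[OF A D i j] by simp
    also have "\<dots> = (if i = j then q else 0)" using AD i j by simp
    finally show ?thesis .
  qed
  have A0: "A $$ (i,j) = 0" if "j < i" for j
    using that
  proof (induction j rule: less_induct)
    case (less j)
    have "(\<Sum>k\<le>j. A $$ (i,k) * D $$ (k,j)) = A $$ (i,j) * D $$ (j,j)"
      using less by (simp add: lessThan_Suc_atMost[symmetric])
    with prd[of j] less.prems i pos[of j] show ?case by auto
  qed
  have "(\<Sum>k\<le>i. A $$ (i,k) * D $$ (k,i)) = A $$ (i,i) * D $$ (i,i)"
    using A0 by (simp add: lessThan_Suc_atMost[symmetric])
  with prd[OF i] show "A $$ (i,i) * D $$ (i,i) = q" by simp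
  assume A1: "A $$ (i,i) = 1"
  \<comment> \<open>The vanishing of A at (i,j) is carried along because it removes the intermediate
    terms in the later columns.\<close>
  have "D $$ (i,j) = 0 \<and> A $$ (i,j) = 0" if "i < j" "j < m" for j
    using that
  proof (induction j rule: less_induct)
    case (less j)
    have "(\<Sum>k\<le>j. A $$ (i,k) * D $$ (k,j)) = (\<Sum>k<j. A $$ (i,k) * D $$ (k,j)) + A $$ (i,j) * D $$ (j,j)"
      by (simp add: lessThan_Suc_atMost[symmetric])
    also have "(\<Sum>k<j. A $$ (i,k) * D $$ (k,j)) = (\<Sum>k<j. if k = i then D $$ (i,j) else 0)"
    proof (rule sum.cong)
      fix k assume "k \<in> {..<j}"
      then show "A $$ (i,k) * D $$ (k,j) = (if k = i then D $$ (i,j) else 0)"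
        using A0[of k] A1 less by (cases k i rule: linorder_cases) auto
    qed simp
    finally have e: "D $$ (i,j) + A $$ (i,j) * D $$ (j,j) = 0"
      using prd[of j] less.prems by simp
    have "D $$ (j,j) dvd D $$ (i,j)"
      using e by (metis add.commute dvd_add_right_iff dvd_0_right dvd_triv_right)
    with red[OF less.prems] have "D $$ (i,j) = 0"
      using zdvd_not_zless[of "D $$ (i,j)" "D $$ (j,j)"] by force
    with e pos[OF less.prems(2)] show ?case by simp
  qed
  then show "i < j \<Longrightarrow> j < m \<Longrightarrow> D $$ (i,j) = 0" by blast
qed

lemma divisor_mats_det_nonzero:
  assumes "D \<in> divisor_mats m q" "q \<noteq> 0"
  shows "det D \<noteq> 0"
proof -
  obtain A where A: "D \<in> carrier_mat m m" "A \<in> carrier_mat m m" "A * D = q \<cdot>\<^sub>m 1\<^sub>m m"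
    using assms(1) by (auto simp: divisor_mats_def)
  have "det A * det D = q ^ m" using A by (simp add: det_mult[symmetric, of A m D])
  with assms(2) show ?thesis by auto
qed

lemma lcosets_hermite:
  assumes C: "C \<in> lcosets m q" and q: "q \<noteq> 0"
  obtains D where "hermite m D" "D \<in> divisor_mats m q" "C = lcoset m D"
proof -
  obtain D where D: "D \<in> divisor_mats m q" "C = lcoset m D" using lcosetsE[OF C] by metis
  note Dc = divisor_mats_carrier[OF D(1)]
  obtain U where U: "U \<in> unimod m" "hermite m (U * D)"
    using hermite_form[OF Dc divisor_mats_det_nonzero[OF D(1) q]] by blast
  show thesis
    by (rule that[OF U(2) divisor_mats_unimod_left[OF U(1) D(1)]]) (simp add: D(2) lcoset_unimod_mult[OF U(1) Dc])
qed

text \<open>Every pivot divides q and bounds the entries above it, so all entries lie between 0 and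
  q.\<close>

lemma finite_hermite_divisors:
  assumes q: "q > 0"
  shows "finite {D \<in> divisor_mats m q. hermite m D}"
proof (rule finite_subset[OF _ finite_bounded_mats[of "{0..q}" m m]])
  show "{D \<in> divisor_mats m q. hermite m D} \<subseteq> {S \<in> carrier_mat m m. \<forall>i<m. \<forall>j<m. S $$ (i,j) \<in> {0..q}}"
  proof (clarify, intro conjI allI impI)
    fix D i j assume D: "D \<in> divisor_mats m q" and H: "hermite m D"
    show "D \<in> carrier_mat m m" using divisor_mats_carrier[OF D] .
    assume ij: "i < m" "j < m"
    obtain A where A: "A \<in> carrier_mat m m" "A * D = q \<cdot>\<^sub>m 1\<^sub>m m" using D by (auto simp: divisor_mats_def)
    have "D $$ (j,j) dvd q" using hermite_divisor(1)[OF H A ij(2)] by (metis dvd_triv_right)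
    then have jq: "D $$ (j,j) \<le> q" using q by (rule zdvd_imp_le)
    have "D $$ (i,j) \<in> {0..D $$ (j,j)}"
      using H ij unfolding hermite_def upper_triangular_def
      by (cases i j rule: linorder_cases) (auto simp: less_imp_le)
    with jq show "D $$ (i,j) \<in> {0..q}" by auto
  qed
qed simp

lemma finite_lcosets:
  assumes "q > 0"
  shows "finite (lcosets m q)"
proof (rule finite_surj[OF finite_hermite_divisors[OF assms]])
  show "lcosets m q \<subseteq> lcoset m ` {D \<in> divisor_mats m q. hermite m D}"
    using lcosets_hermite assms by (metis (no_types, lifting) image_eqI less_irrefl mem_Collect_eq subsetI)
qed

subsection \<open>Duality and submultiplicativity\<close>

lemma lcosets_invariants:
  assumes p: "prime p" and C: "C \<in> lcosets m (int p ^ r)"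
  obtains U V e where "U \<in> unimod m" "V \<in> unimod m" "\<And>i. e i \<le> r"
    "C = lcoset m (U * diag_pow m p e * V)" "sym_count m (int p ^ r) C = p ^ min_sum m e"
    "det_val p C = (\<Sum>i<m. e i)"
proof -
  obtain D where D: "D \<in> divisor_mats m (int p ^ r)" "C = lcoset m D" using lcosetsE[OF C] by metis
  obtain U V e where w: "U \<in> unimod m" "V \<in> unimod m" "\<And>i. e i \<le> r" "D = U * diag_pow m p e * V"
    using divisor_mats_diagonal_form[OF p D(1)] by blast
  have p0: "p > 0" using p by (simp add: prime_gt_0_nat)
  show thesis
    using that[OF w(1-3)] D(2) w(4) card_sym_ann_diagonal_form[OF p0 w(1-3)]
      multiplicity_det_diagonal_form[OF p w(1,2)] divisor_mats_carrier[OF D(1)] p0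
    by (simp add: sym_count_lcoset det_val_lcoset)
qed

lemma lcoset_diagonal_form_invariants:
  assumes p: "prime p" and w: "U \<in> unimod m" "V \<in> unimod m" "\<And>i. e i \<le> r"
  shows "lcoset m (U * diag_pow m p e * V) \<in> lcosets m (int p ^ r)"
    and "sym_count m (int p ^ r) (lcoset m (U * diag_pow m p e * V)) = p ^ min_sum m e"
    and "det_val p (lcoset m (U * diag_pow m p e * V)) = (\<Sum>i<m. e i)"
proof -
  have p0: "p > 0" using p by (simp add: prime_gt_0_nat)
  have D: "U * diag_pow m p e * V \<in> divisor_mats m (int p ^ r)"
    using w by (intro divisor_mats_diagonal_formI)
  then show "lcoset m (U * diag_pow m p e * V) \<in> lcosets m (int p ^ r)"
    by (simp add: lcosets_def)
  show "sym_count m (int p ^ r) (lcoset m (U * diag_pow m p e * V)) = p ^ min_sum m e"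
    using card_sym_ann_diagonal_form[OF p0 w] divisor_mats_carrier[OF D] p0 by (simp add: sym_count_lcoset)
  show "det_val p (lcoset m (U * diag_pow m p e * V)) = (\<Sum>i<m. e i)"
    using multiplicity_det_diagonal_form[OF p w(1,2)] divisor_mats_carrier[OF D] by (simp add: det_val_lcoset)
qed

text \<open>An inverse-free description of the matrices q D^(-T) with D in C. They form a left coset
  again because (U D)^(-T) = U^(-T) D^(-T).\<close>

definition dual_coset :: "nat \<Rightarrow> int \<Rightarrow> int mat set \<Rightarrow> int mat set" where
  "dual_coset m q C = {A \<in> carrier_mat m m. \<exists>D\<in>C. A\<^sup>T * D = q \<cdot>\<^sub>m 1\<^sub>m m}"

lemma dual_coset_lcoset:
  assumes D: "D \<in> carrier_mat m m" and A: "A \<in> carrier_mat m m" and AD: "A\<^sup>T * D = q \<cdot>\<^sub>m 1\<^sub>m m"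
    and q: "q \<noteq> 0"
  shows "dual_coset m q (lcoset m D) = lcoset m A"
proof (intro equalityI subsetI)
  fix B assume "B \<in> dual_coset m q (lcoset m D)"
  then obtain U where B: "B \<in> carrier_mat m m" "B\<^sup>T * (U * D) = q \<cdot>\<^sub>m 1\<^sub>m m" and U: "U \<in> unimod m"
    by (auto simp: dual_coset_def lcoset_def)
  note Uc = unimod_carrier[OF U]
  obtain V where V: "V \<in> unimod m" "U * V = 1\<^sub>m m" using unimod_inverse[OF U] by metis
  note Vc = unimod_carrier[OF V(1)]
  have DA: "D * A\<^sup>T = q \<cdot>\<^sub>m 1\<^sub>m m"
    using A by (intro scalar_left_inverse_imp_right[OF _ D AD q]) auto
  have "(B\<^sup>T * U) * D = A\<^sup>T * D"
    by (rule trans[OF assoc_mult_mat[OF _ Uc D] trans[OF B(2) AD[symmetric]]]) (use B(1) in simp)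
  then have "B\<^sup>T * U = A\<^sup>T"
    by (rule mult_mat_right_cancel[OF _ _ _ D _ DA q]) (use A B(1) Uc in \<open>auto intro: mult_carrier_mat\<close>)
  then have "A\<^sup>T * V = B\<^sup>T * (U * V)"
    using assoc_mult_mat[of "B\<^sup>T" m m U m V m] B Uc Vc by simp
  then have "(A\<^sup>T * V)\<^sup>T = B" using V(2) B by simp
  then have "B = V\<^sup>T * A" using A Vc by (simp add: transpose_mult[of _ m m _ m])
  then show "B \<in> lcoset m A" using V(1) by (auto simp: lcoset_def transpose_unimod)
next
  fix B assume "B \<in> lcoset m A"
  then obtain U where U: "U \<in> unimod m" "B = U * A" by (auto simp: lcoset_def)
  note Uc = unimod_carrier[OF U(1)]
  obtain V where V: "V \<in> unimod m" "V * U = 1\<^sub>m m" using unimod_inverse[OF U(1)] by metis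
  note Vc = unimod_carrier[OF V(1)]
  have "U\<^sup>T * V\<^sup>T = (V * U)\<^sup>T" using Uc Vc by (simp add: transpose_mult[of _ m m _ m])
  then have UV: "U\<^sup>T * V\<^sup>T = 1\<^sub>m m" using V(2) by simp
  have "B\<^sup>T * (V\<^sup>T * D) = A\<^sup>T * (U\<^sup>T * V\<^sup>T) * D"
    unfolding U(2) using A D Uc Vc
    by (simp add: transpose_mult[of _ m m _ m] assoc_mult_mat[of _ m m _ m _ m] mult_carrier_mat[of _ m m _ m])
  also have "\<dots> = q \<cdot>\<^sub>m 1\<^sub>m m" unfolding UV using A AD by simp
  finally show "B \<in> dual_coset m q (lcoset m D)"
    unfolding dual_coset_def lcoset_def using V(1) U(2) Uc A
    by (auto intro!: bexI[of _ "V\<^sup>T"] simp: transpose_unimod)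
qed

text \<open>In diagonal form duality replaces every exponent e i by r - e i. The last identity is
  \<open>min_sum_complement\<close> in the exponent of p, kept multiplicative to avoid
  subtraction.\<close>

lemma dual_coset_invariants:
  assumes p: "prime p" and C: "C \<in> lcosets m (int p ^ r)"
  shows "dual_coset m (int p ^ r) C \<in> lcosets m (int p ^ r)"
    and "dual_coset m (int p ^ r) (dual_coset m (int p ^ r) C) = C"
    and "det_val p (dual_coset m (int p ^ r) C) + det_val p C = m * r"
    and "sym_count m (int p ^ r) (dual_coset m (int p ^ r) C) * p ^ ((m + 1) * det_val p C)
       = sym_count m (int p ^ r) C * p ^ (r * (\<Sum>j<m. Suc j))"
proof -
  let ?q = "int p ^ r"
  have p0: "p > 0" and q0: "?q \<noteq> 0" using p by (auto simp: prime_gt_0_nat)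
  obtain U V e where w: "U \<in> unimod m" "V \<in> unimod m" "\<And>i. e i \<le> r" and C_eq: "C = lcoset m (U * diag_pow m p e * V)"
    and sC: "sym_count m ?q C = p ^ min_sum m e" and dC: "det_val p C = (\<Sum>i<m. e i)"
    using lcosets_invariants[OF p C] by metis
  define D where "D = U * diag_pow m p e * V"
  obtain U' where U': "U' \<in> unimod m" "U' * U = 1\<^sub>m m" using unimod_inverse[OF w(1)] by metis
  obtain V' where V': "V' \<in> unimod m" "V' * V = 1\<^sub>m m" using unimod_inverse[OF w(2)] by metis
  note c = unimod_carrier[OF w(1)] unimod_carrier[OF w(2)] unimod_carrier[OF U'(1)] unimod_carrier[OF V'(1)]
  let ?e = "\<lambda>i. r - e i"
  \<comment> \<open>This is q D^(-T), computed from the factors of D.\<close>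
  define A where "A = U'\<^sup>T * diag_pow m p ?e * V'\<^sup>T"
  have D: "D \<in> carrier_mat m m" and A: "A \<in> carrier_mat m m" using c by (auto simp: D_def A_def)
  have dT: "(diag_pow m p ?e)\<^sup>T = diag_pow m p ?e" by (rule eq_matI) (auto simp: diag_pow_def)
  have dd: "diag_pow m p ?e * diag_pow m p e = ?q \<cdot>\<^sub>m 1\<^sub>m m"
    unfolding diag_pow_mult using w(3) by (intro eq_matI) (auto simp: diag_pow_def)
  have AT: "A\<^sup>T = V' * diag_pow m p ?e * U'"
    unfolding A_def using c
    by (simp add: transpose_mult[of _ m m _ m] dT assoc_mult_mat[of _ m m _ m _ m] mult_carrier_mat[of _ m m _ m])
  have "A\<^sup>T * D = V' * (diag_pow m p ?e * (U' * U) * diag_pow m p e) * V"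
    unfolding AT D_def
    using c by (simp add: assoc_mult_mat[of _ m m _ m _ m] mult_carrier_mat[of _ m m _ m])
  also have "\<dots> = V' * (?q \<cdot>\<^sub>m 1\<^sub>m m) * V"
    unfolding U'(2) by (simp add: dd right_mult_one_mat[of _ m m])
  also have "\<dots> = ?q \<cdot>\<^sub>m 1\<^sub>m m"
    using c V'(2) by (simp add: mult_scalar_mat[of _ m m] mult_smult_assoc_mat[of _ m m _ m])
  finally have AD: "A\<^sup>T * D = ?q \<cdot>\<^sub>m 1\<^sub>m m" .
  have dual: "dual_coset m ?q C = lcoset m A"
    unfolding C_eq D_def[symmetric] by (rule dual_coset_lcoset[OF D A AD q0])
  have "D\<^sup>T * A = (A\<^sup>T * D)\<^sup>T" using A D by (simp add: transpose_mult[of _ m m _ m])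
  also have "\<dots> = ?q \<cdot>\<^sub>m 1\<^sub>m m" unfolding AD by (rule eq_matI) auto
  finally have "dual_coset m ?q (lcoset m A) = lcoset m D"
    by (rule dual_coset_lcoset[OF A D _ q0])
  then show "dual_coset m ?q (dual_coset m ?q C) = C"
    unfolding dual by (simp add: C_eq D_def)
  note inv = lcoset_diagonal_form_invariants[OF p transpose_unimod[OF U'(1)] transpose_unimod[OF V'(1)], of ?e r, OF diff_le_self, folded A_def]
  show "dual_coset m ?q C \<in> lcosets m ?q" using inv(1) by (simp add: dual)
  have "(\<Sum>i<m. r - e i) + (\<Sum>i<m. e i) = (\<Sum>i<m. r)"
    unfolding sum.distrib[symmetric] using w(3) by (intro sum.cong) auto
  then show "det_val p (dual_coset m ?q C) + det_val p C = m * r"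
    using inv(3) by (simp add: dual dC)
  show "sym_count m ?q (dual_coset m ?q C) * p ^ ((m + 1) * det_val p C) = sym_count m ?q C * p ^ (r * (\<Sum>j<m. Suc j))"
    using inv(2) min_sum_complement[of e r m, OF w(3)] by (simp only: dual dC sC power_add[symmetric])
qed

lemma bij_betw_dual_coset:
  assumes "prime p"
  shows "bij_betw (dual_coset m (int p ^ r)) (lcosets m (int p ^ r)) (lcosets m (int p ^ r))"
  by (rule bij_betw_byWitness[where f' = "dual_coset m (int p ^ r)"])
    (use dual_coset_invariants[OF assms] in auto)

text \<open>For m = 2 n and y = p^(-n-1/2) this is the sum of the absolute values of the terms of
  the eigenvalue, up to the common factor coming from alpha_0.\<close>

definition coset_sum :: "nat \<Rightarrow> nat \<Rightarrow> nat \<Rightarrow> real \<Rightarrow> real" where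
  "coset_sum m p r y = (\<Sum>C\<in>lcosets m (int p ^ r). real (sym_count m (int p ^ r) C) * y ^ det_val p C)"

text \<open>C is recovered from the chosen representatives of \<open>C1\<close> and
  \<open>C2\<close> by multiplying them; this is what makes the factoring injective in
  \<open>coset_sum_Suc_le\<close>.\<close>

lemma lcosets_factor:
  assumes p: "prime p" and C: "C \<in> lcosets m (int p ^ Suc r)"
  obtains C1 C2 where "C1 \<in> lcosets m (int p ^ r)" "C2 \<in> lcosets m (int p ^ 1)"
    "C = lcoset m (coset_rep C1 * coset_rep C2)"
    "sym_count m (int p ^ Suc r) C = sym_count m (int p ^ r) C1 * sym_count m (int p ^ 1) C2"
    "det_val p C = det_val p C1 + det_val p C2"
proof -
  obtain U V e where w: "U \<in> unimod m" "V \<in> unimod m" "\<And>i. e i \<le> Suc r" and C_eq: "C = lcoset m (U * diag_pow m p e * V)"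
    and sC: "sym_count m (int p ^ Suc r) C = p ^ min_sum m e" and dC: "det_val p C = (\<Sum>i<m. e i)"
    using lcosets_invariants[OF p C] by metis
  \<comment> \<open>Truncated subtraction keeps exponent 0 at 0; there \<open>e2\<close> is 0 too,
    so that \<open>e1\<close> and \<open>e2\<close> always add up to \<open>e\<close>.\<close>
  define e1 where "e1 i = e i - 1" for i
  define e2 where "e2 i = min (e i) 1" for i
  have e1: "e1 i \<le> r" and e2: "e2 i \<le> 1" and ee: "e i = e1 i + e2 i" for i
    using w(3)[of i] by (auto simp: e1_def e2_def)
  define C2 where "C2 = lcoset m (1\<^sub>m m * diag_pow m p e2 * V)"
  note inv2 = lcoset_diagonal_form_invariants[where e = e2, OF p one_unimod w(2) e2, folded C2_def]
  have D2: "1\<^sub>m m * diag_pow m p e2 * V \<in> carrier_mat m m"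
    by (intro mult_carrier_mat[of _ m m] one_carrier_mat diag_pow_carrier unimod_carrier[OF w(2)])
  obtain W where W: "W \<in> unimod m" "coset_rep C2 = W * (1\<^sub>m m * diag_pow m p e2 * V)"
    using coset_rep_in[OF D2] by (auto simp: C2_def lcoset_def)
  obtain W' where W': "W' \<in> unimod m" "W' * W = 1\<^sub>m m" using unimod_inverse[OF W(1)] by metis
  \<comment> \<open>The representative of \<open>C2\<close> carries an uncontrolled left factor
    \<open>W\<close>. Its inverse is placed at the right end of \<open>C1\<close>, so that it
    cancels in the product and only a left factor \<open>X\<close> survives.\<close>
  define C1 where "C1 = lcoset m (U * diag_pow m p e1 * W')"
  note inv1 = lcoset_diagonal_form_invariants[where e = e1, OF p w(1) W'(1) e1, folded C1_def]
  note c = unimod_carrier[OF w(1)] unimod_carrier[OF w(2)] unimod_carrier[OF W(1)] unimod_carrier[OF W'(1)]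
  have D1: "U * diag_pow m p e1 * W' \<in> carrier_mat m m"
    by (intro mult_carrier_mat[of _ m m] diag_pow_carrier c)
  obtain X where X: "X \<in> unimod m" "coset_rep C1 = X * (U * diag_pow m p e1 * W')"
    using coset_rep_in[OF D1] by (auto simp: C1_def lcoset_def)
  have "coset_rep C1 * coset_rep C2 = X * (U * diag_pow m p e1 * (W' * W) * diag_pow m p e2 * V)"
    unfolding X(2) W(2) using c unimod_carrier[OF X(1)]
    by (simp add: left_mult_one_mat[of _ m m] assoc_mult_mat[of _ m m _ m _ m] mult_carrier_mat[of _ m m _ m])
  also have "U * diag_pow m p e1 * (W' * W) * diag_pow m p e2 * V = U * (diag_pow m p e1 * diag_pow m p e2) * V"
    unfolding W'(2) using c
    by (simp add: assoc_mult_mat[of _ m m _ m _ m] mult_carrier_mat[of _ m m _ m] right_mult_one_mat[of _ m m])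
  also have "diag_pow m p e1 * diag_pow m p e2 = diag_pow m p e"
    unfolding diag_pow_mult ee[symmetric] by simp
  finally have "coset_rep C1 * coset_rep C2 = X * (U * diag_pow m p e * V)" .
  then have "lcoset m (coset_rep C1 * coset_rep C2) = C"
    unfolding C_eq by (simp only:) (intro lcoset_unimod_mult X(1) mult_carrier_mat[of _ m m] diag_pow_carrier c)
  \<comment> \<open>Termwise min(a,b) = min(a-1, b-1) + min(a,b,1) with truncated subtraction, so
    the weight is multiplicative although general products of cosets do not have this
    property.\<close>
  moreover have "min_sum m e = min_sum m e1 + min_sum m e2"
    unfolding min_sum_def sum.distrib[symmetric] by (intro sum.cong) (auto simp: e1_def e2_def min_def)
  moreover have "(\<Sum>i<m. e i) = (\<Sum>i<m. e1 i) + (\<Sum>i<m. e2 i)"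
    unfolding sum.distrib[symmetric] ee by simp
  ultimately show thesis
    using that[OF inv1(1) inv2(1)] inv1(2,3) inv2(2,3) by (simp add: sC dC power_add del: power_Suc)
qed

text \<open>A factoring chosen for each coset injects the cosets for r + 1 into pairs and multiplies
  the weights; pairs outside the image only add nonnegative terms.\<close>

lemma coset_sum_Suc_le:
  assumes p: "prime p" and y: "y \<ge> 0"
  shows "coset_sum m p (Suc r) y \<le> coset_sum m p r y * coset_sum m p 1 y"
proof -
  define w where "w r C = real (sym_count m (int p ^ r) C) * y ^ det_val p C" for r C
  have p0: "int p > 0" using p by (simp add: prime_gt_0_nat)
  note fin = finite_lcosets[OF zero_less_power[OF p0]]
  have "\<exists>x. x \<in> lcosets m (int p ^ r) \<times> lcosets m (int p ^ 1) \<and>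
      C = lcoset m (coset_rep (fst x) * coset_rep (snd x)) \<and> w (Suc r) C = w r (fst x) * w 1 (snd x)"
    if C: "C \<in> lcosets m (int p ^ Suc r)" for C
  proof -
    obtain C1 C2 where "C1 \<in> lcosets m (int p ^ r)" "C2 \<in> lcosets m (int p ^ 1)"
      "C = lcoset m (coset_rep C1 * coset_rep C2)"
      "sym_count m (int p ^ Suc r) C = sym_count m (int p ^ r) C1 * sym_count m (int p ^ 1) C2"
      "det_val p C = det_val p C1 + det_val p C2"
      by (rule lcosets_factor[OF p C])
    then show ?thesis by (intro exI[of _ "(C1, C2)"]) (simp add: w_def power_add)
  qed
  then obtain h where h: "\<And>C. C \<in> lcosets m (int p ^ Suc r) \<Longrightarrow>
      h C \<in> lcosets m (int p ^ r) \<times> lcosets m (int p ^ 1) \<and>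
      C = lcoset m (coset_rep (fst (h C)) * coset_rep (snd (h C))) \<and> w (Suc r) C = w r (fst (h C)) * w 1 (snd (h C))"
    by metis
  have inj: "inj_on h (lcosets m (int p ^ Suc r))"
  proof (rule inj_onI)
    fix C C' assume C: "C \<in> lcosets m (int p ^ Suc r)" "C' \<in> lcosets m (int p ^ Suc r)" and e: "h C = h C'"
    have "C = lcoset m (coset_rep (fst (h C)) * coset_rep (snd (h C)))" using h[OF C(1)] by blast
    also have "\<dots> = C'" unfolding e using h[OF C(2)] by (blast intro: sym)
    finally show "C = C'" .
  qed
  have "coset_sum m p (Suc r) y = (\<Sum>C\<in>lcosets m (int p ^ Suc r). w r (fst (h C)) * w 1 (snd (h C)))"
    unfolding coset_sum_def w_def[symmetric] using h by (intro sum.cong) auto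
  also have "\<dots> = (\<Sum>x\<in>h ` lcosets m (int p ^ Suc r). w r (fst x) * w 1 (snd x))"
    using inj by (simp add: sum.reindex)
  also have "\<dots> \<le> (\<Sum>x\<in>lcosets m (int p ^ r) \<times> lcosets m (int p ^ 1). w r (fst x) * w 1 (snd x))"
  proof (rule sum_mono2)
    show "finite (lcosets m (int p ^ r) \<times> lcosets m (int p ^ 1))" using fin by (intro finite_cartesian_product)
    show "h ` lcosets m (int p ^ Suc r) \<subseteq> lcosets m (int p ^ r) \<times> lcosets m (int p ^ 1)"
      by (rule image_subsetI) (use h in blast)
    show "0 \<le> w r (fst x) * w 1 (snd x)" for x using y by (simp add: w_def)
  qed
  also have "\<dots> = coset_sum m p r y * coset_sum m p 1 y"
    by (simp add: coset_sum_def w_def sum_product sum.cartesian_product case_prod_unfold)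
  finally show ?thesis .
qed

text \<open>For q = 1 every divisor is unimodular and 0 is the only residue, so there is a single
  coset, of weight at most 1.\<close>

lemma coset_sum_0_le: "coset_sum m p 0 y \<le> 1"
proof -
  have sub: "lcosets m (int p ^ 0) \<subseteq> {lcoset m (1\<^sub>m m)}"
  proof
    fix C assume "C \<in> lcosets m (int p ^ 0)"
    then obtain D A where D: "C = lcoset m D" "D \<in> carrier_mat m m" "A \<in> carrier_mat m m" "A * D = 1 \<cdot>\<^sub>m 1\<^sub>m m"
      by (auto simp: lcosets_def divisor_mats_def)
    then have "D \<in> unimod m" by (intro unimod_if_left_inverse) (auto simp: one_smult)
    then show "C \<in> {lcoset m (1\<^sub>m m)}"
      using lcoset_unimod_mult[of D m "1\<^sub>m m"] D by simp
  qed
  have "sym_ann m 1 (1\<^sub>m m) \<subseteq> {0\<^sub>m m m}"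
  proof
    fix S assume S: "S \<in> sym_ann m 1 (1\<^sub>m m)"
    have "S $$ (i,j) = 0" if "i < m" "j < m" for i j
    proof -
      have "S $$ (i,j) \<in> {0..<1}" using S that unfolding sym_ann_def by blast
      then show ?thesis by simp
    qed
    moreover have "S \<in> carrier_mat m m" using S by (simp add: sym_ann_def)
    ultimately show "S \<in> {0\<^sub>m m m}" by (auto intro!: eq_matI)
  qed
  then have "card (sym_ann m 1 (1\<^sub>m m)) \<le> 1"
    using card_mono[of "{0\<^sub>m m m}" "sym_ann m 1 (1\<^sub>m m)"] by simp
  then have "sym_count m 1 (lcoset m (1\<^sub>m m)) \<le> 1" by (simp add: sym_count_lcoset)
  moreover have "det_val p (lcoset m (1\<^sub>m m)) = 0" by (simp add: det_val_lcoset)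
  ultimately have "(\<Sum>C\<in>{lcoset m (1\<^sub>m m)}. real (sym_count m (int p ^ 0) C) * y ^ det_val p C) \<le> 1" by simp
  moreover have "coset_sum m p 0 y \<le> (\<Sum>C\<in>{lcoset m (1\<^sub>m m)}. real (sym_count m (int p ^ 0) C) * y ^ det_val p C)"
    unfolding coset_sum_def using sub \<open>det_val p (lcoset m (1\<^sub>m m)) = 0\<close> by (intro sum_mono2) auto
  ultimately show ?thesis by linarith
qed

lemma coset_sum_nonneg: "y \<ge> 0 \<Longrightarrow> coset_sum m p r y \<ge> 0"
  by (simp add: coset_sum_def sum_nonneg)

lemma coset_sum_le_power:
  assumes "prime p" "y \<ge> 0"
  shows "coset_sum m p r y \<le> coset_sum m p 1 y ^ r"
proof (induction r)
  case (Suc r)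
  have "coset_sum m p (Suc r) y \<le> coset_sum m p r y * coset_sum m p 1 y"
    by (rule coset_sum_Suc_le[OF assms])
  also have "\<dots> \<le> coset_sum m p 1 y ^ r * coset_sum m p 1 y"
    using Suc coset_sum_nonneg[OF assms(2)] by (intro mult_right_mono) auto
  finally show ?case by (simp add: mult.commute)
qed (simp add: coset_sum_0_le)

subsection \<open>The weight for exponent one and the middle weight\<close>

text \<open>If d exponents are 1, then d(d+1)/2 pairs i <= j contribute. Hence
  \<open>min_sum\<close> depends only on the sum of the exponents and not on their
  positions.\<close>

lemma twice_min_sum_01:
  assumes "\<And>i. e i \<le> 1"
  shows "2 * min_sum m e = (\<Sum>i<m. e i) * ((\<Sum>i<m. e i) + 1)"
proof (induction m)
  case (Suc m)
  have "(\<Sum>i\<le>m. min (e i) (e m)) = (if e m = 0 then 0 else (\<Sum>i<m. e i) + 1)"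
  proof (cases "e m = 0")
    case False
    with assms[of m] have "e m = 1" by simp
    moreover have "min (e i) 1 = e i" for i using assms[of i] by simp
    ultimately show ?thesis by (simp add: lessThan_Suc_atMost[symmetric])
  qed simp
  moreover have "e m = 0 \<or> e m = 1" using assms[of m] by linarith
  moreover have "min_sum (Suc m) e = min_sum m e + (\<Sum>i\<le>m. min (e i) (e m))"
    by (simp add: min_sum_def)
  ultimately show ?case
    using Suc by (auto simp: algebra_simps)
qed (simp add: min_sum_def)

text \<open>For j in I, the j + 1 indices up to j split into those in I, counted by
  \<open>min_sum\<close>, and those outside I, which are the free positions of column j in a Hermite
  form. Both counts together give the exponent j + 1 for each j in I, so the sum over all I will
  factor.\<close>

lemma min_sum_indicator:
  assumes "I \<subseteq> {..<m}"
  shows "min_sum m (\<lambda>i. if i \<in> I then 1 else 0) + (\<Sum>j\<in>I. card {i. i < j \<and> i \<notin> I}) = (\<Sum>j\<in>I. Suc j)"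
proof -
  have "(\<Sum>i\<le>j. min (if i \<in> I then 1 else 0) (if j \<in> I then 1 else (0::nat)))
      = (if j \<in> I then card {i. i \<le> j \<and> i \<in> I} else 0)" for j
  proof -
    have "(\<Sum>i\<le>j. if i \<in> I then 1 else (0::nat)) = card ({..j} \<inter> I)"
      by (simp add: sum.inter_restrict[symmetric])
    moreover have "{..j} \<inter> I = {i. i \<le> j \<and> i \<in> I}" by auto
    moreover have "min (if i \<in> I then 1 else 0) (1::nat) = (if i \<in> I then 1 else 0)" for i by simp
    ultimately show ?thesis by simp
  qed
  then have "min_sum m (\<lambda>i. if i \<in> I then 1 else 0) = (\<Sum>j<m. if j \<in> I then card {i. i \<le> j \<and> i \<in> I} else 0)"
    by (simp add: min_sum_def)
  also have "\<dots> = (\<Sum>j\<in>I. card {i. i \<le> j \<and> i \<in> I})"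
    using assms by (simp add: sum.inter_restrict[symmetric] Int_absorb1)
  finally have "min_sum m (\<lambda>i. if i \<in> I then 1 else 0) + (\<Sum>j\<in>I. card {i. i < j \<and> i \<notin> I})
      = (\<Sum>j\<in>I. card {i. i \<le> j \<and> i \<in> I} + card {i. i < j \<and> i \<notin> I})"
    by (simp add: sum.distrib)
  also have "\<dots> = (\<Sum>j\<in>I. Suc j)"
  proof (rule sum.cong)
    fix j assume j: "j \<in> I"
    have "{i. i \<le> j \<and> i \<in> I} \<union> {i. i < j \<and> i \<notin> I} = {..j}" using j by (auto simp: le_less)
    moreover have "card ({i. i \<le> j \<and> i \<in> I} \<union> {i. i < j \<and> i \<notin> I})
        = card {i. i \<le> j \<and> i \<in> I} + card {i. i < j \<and> i \<notin> I}"
      by (rule card_Un_disjoint) auto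
    ultimately show "card {i. i \<le> j \<and> i \<in> I} + card {i. i < j \<and> i \<notin> I} = Suc j" by simp
  qed simp
  finally show ?thesis .
qed

section \<open>Hermite forms of the divisors of p\<close>

definition hermite_pattern :: "nat \<Rightarrow> nat \<Rightarrow> nat set \<Rightarrow> int mat set" where
  "hermite_pattern m p I = {D \<in> divisor_mats m (int p). hermite m D \<and> {i. i < m \<and> D $$ (i,i) = int p} = I}"

text \<open>A row with pivot p has cofactor 1 on the diagonal and vanishes off the diagonal by
  \<open>hermite_divisor\<close>; above a pivot 1 the only reduced entry is 0.\<close>

lemma hermite_prime_entries:
  assumes p: "prime p" and D: "D \<in> divisor_mats m (int p)" and H: "hermite m D"
  shows "i < m \<Longrightarrow> D $$ (i,i) = 1 \<or> D $$ (i,i) = int p"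
    and "i < j \<Longrightarrow> j < m \<Longrightarrow> D $$ (i,j) \<noteq> 0 \<Longrightarrow> D $$ (i,i) = 1 \<and> D $$ (j,j) = int p"
proof -
  obtain A where A: "A \<in> carrier_mat m m" "A * D = int p \<cdot>\<^sub>m 1\<^sub>m m" using D by (auto simp: divisor_mats_def)
  have d: "D $$ (i,i) = 1 \<or> D $$ (i,i) = int p" if "i < m" for i
  proof -
    have "D $$ (i,i) dvd int p" using hermite_divisor(1)[OF H A that] by (metis dvd_triv_right)
    moreover have "D $$ (i,i) > 0" using H that by (simp add: hermite_def)
    moreover have "prime (int p)" using p by simp
    ultimately show ?thesis by (auto simp: prime_int_iff)
  qed
  then show "i < m \<Longrightarrow> D $$ (i,i) = 1 \<or> D $$ (i,i) = int p" by blast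
  assume ij: "i < j" "j < m" and nz: "D $$ (i,j) \<noteq> 0"
  have im: "i < m" using ij by simp
  have "D $$ (i,i) \<noteq> int p"
  proof
    assume "D $$ (i,i) = int p"
    then have "A $$ (i,i) = 1"
      using hermite_divisor(1)[OF H A im] p by (auto simp: prime_gt_0_nat)
    with hermite_divisor(2)[OF H A im _ ij] nz show False by simp
  qed
  moreover have "D $$ (j,j) \<noteq> 1"
  proof
    assume "D $$ (j,j) = 1"
    moreover have "D $$ (i,j) \<in> {0..<D $$ (j,j)}" using H ij by (simp add: hermite_def)
    ultimately show False using nz by simp
  qed
  ultimately show "D $$ (i,i) = 1 \<and> D $$ (j,j) = int p" using d[OF im] d[OF ij(2)] by blast
qed

text \<open>Such a form is determined by its entries at the positions (i,j) with i < j, j in I and i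
  outside I, each a residue modulo p. The injection alone gives the upper bound.\<close>

lemma card_hermite_pattern:
  assumes p: "prime p" and I: "I \<subseteq> {..<m}"
  shows "card (hermite_pattern m p I) \<le> p ^ (\<Sum>j\<in>I. card {i. i < j \<and> i \<notin> I})"
proof -
  define P where "P = (SIGMA j:I. {i. i < j \<and> i \<notin> I})"
  have finI: "finite I" using I finite_subset by blast
  have finP: "finite P" unfolding P_def using finI by (intro finite_SigmaI) auto
  define g where "g D = restrict (\<lambda>(j,i). D $$ (i,j)) P" for D :: "int mat"
  have pm: "p \<noteq> 1" "p > 0" using prime_gt_1_nat[OF p] by simp_all
  have "card (hermite_pattern m p I) \<le> card (P \<rightarrow>\<^sub>E {0..<int p})"
  proof (rule card_inj_on_le[of g])
    show "inj_on g (hermite_pattern m p I)"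
    proof (rule inj_onI)
      fix D D' assume D: "D \<in> hermite_pattern m p I" and D': "D' \<in> hermite_pattern m p I" and e: "g D = g D'"
      have c: "D \<in> carrier_mat m m" "D' \<in> carrier_mat m m"
        using D D' divisor_mats_carrier unfolding hermite_pattern_def by blast+
      have entry: "M $$ (i,j) = (if i = j then if i \<in> I then int p else 1
          else if (j,i) \<in> P then g M (j,i) else 0)"
        if M: "M \<in> hermite_pattern m p I" and ij: "i < m" "j < m" for M i j
      proof -
        have M': "M \<in> divisor_mats m (int p)" "hermite m M" and MI: "I = {i. i < m \<and> M $$ (i,i) = int p}"
          using M unfolding hermite_pattern_def by blast+
        note ent = hermite_prime_entries[OF p M']
        consider "i = j" | "j < i" | "i < j" by linarith
        then show ?thesis
        proof cases
          case 1
          with ent(1)[OF ij(1)] MI ij show ?thesis by auto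
        next
          case 2
          then have "M $$ (i,j) = 0"
            using M'(2) ij by (auto simp: hermite_def)
          with 2 show ?thesis by (auto simp: P_def)
        next
          case 3
          show ?thesis
          proof (cases "M $$ (i,j) = 0")
            case True
            with 3 show ?thesis by (auto simp: g_def)
          next
            case False
            from ent(2)[OF 3 ij(2) False] have "j \<in> I" "i \<notin> I" using MI ij pm by auto
            with 3 show ?thesis by (auto simp: P_def g_def)
          qed
        qed
      qed
      show "D = D'"
        using c entry[OF D] entry[OF D'] e by (intro eq_matI) auto
    qed
    show "g ` hermite_pattern m p I \<subseteq> P \<rightarrow>\<^sub>E {0..<int p}"
    proof (rule image_subsetI)
      fix D assume D: "D \<in> hermite_pattern m p I"
      have "D $$ (i,j) \<in> {0..<int p}" if ji: "(j,i) \<in> P" for j i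
      proof -
        have "j \<in> I" "i < j" using ji by (auto simp: P_def)
        moreover from this have "j < m" "D $$ (j,j) = int p" using D unfolding hermite_pattern_def by blast+
        moreover have "hermite m D" using D by (simp add: hermite_pattern_def)
        ultimately show ?thesis unfolding hermite_def by metis
      qed
      then show "g D \<in> P \<rightarrow>\<^sub>E {0..<int p}" unfolding g_def by (intro restrict_PiE_iff[THEN iffD2]) auto
    qed
    show "finite (P \<rightarrow>\<^sub>E {0..<int p})" using finP by (intro finite_PiE) auto
  qed
  also have "\<dots> = p ^ card P" using finP by (simp add: card_PiE)
  also have "card P = (\<Sum>j\<in>I. card {i. i < j \<and> i \<notin> I})"
    unfolding P_def using finI by (simp add: card_SigmaI)
  finally show ?thesis .
qed

text \<open>The diagonal form of D may carry its exponents 1 at other indices than I. The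
  determinant shows that there are equally many, and by \<open>twice_min_sum_01\<close> this fixes
  the number of annihilators.\<close>

lemma hermite_pattern_weights:
  assumes p: "prime p" and D: "D \<in> hermite_pattern m p I"
  shows "I \<subseteq> {..<m}"
    and "sym_count m (int p ^ 1) (lcoset m D) = p ^ min_sum m (\<lambda>i. if i \<in> I then 1 else 0)"
    and "det_val p (lcoset m D) = card I"
proof -
  have D': "D \<in> divisor_mats m (int p ^ 1)" "hermite m D" and DI: "I = {i. i < m \<and> D $$ (i,i) = int p}"
    using D unfolding hermite_pattern_def power_one_right by blast+
  show I: "I \<subseteq> {..<m}" using DI by auto
  have C: "lcoset m D \<in> lcosets m (int p ^ 1)" using D' by (simp add: lcosets_def)
  obtain e where e: "\<And>i. e i \<le> 1" "sym_count m (int p ^ 1) (lcoset m D) = p ^ min_sum m e"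
    "det_val p (lcoset m D) = (\<Sum>i<m. e i)"
    using lcosets_invariants[OF p C] by metis
  note Dc = divisor_mats_carrier[OF D'(1)]
  have "det D = (\<Prod>i<m. D $$ (i,i))"
    using det_upper_triangular[of D m] D'(2) Dc by (simp add: hermite_def prod_list_diag_prod atLeast0LessThan)
  also have "\<dots> = (\<Prod>i<m. if i \<in> I then int p else 1)"
    using hermite_prime_entries(1)[OF p _ D'(2)] D'(1) DI by (intro prod.cong) auto
  also have "\<dots> = int p ^ card I"
    using I by (simp add: prod.If_cases Int_absorb1)
  finally have "det D = int p ^ card I" .
  then show dI: "det_val p (lcoset m D) = card I"
    using p Dc by (simp add: det_val_lcoset)
  let ?i = "\<lambda>i. if i \<in> I then 1 else 0 :: nat"
  have "(\<Sum>i<m. ?i i) = card I"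
    using I by (simp add: sum.If_cases Int_absorb1)
  with e(3) dI have "2 * min_sum m e = 2 * min_sum m ?i"
    by (simp add: twice_min_sum_01[of e, OF e(1)] twice_min_sum_01[of ?i])
  with e(2) show "sym_count m (int p ^ 1) (lcoset m D) = p ^ min_sum m ?i" by simp
qed

text \<open>The Hermite forms with pattern I contribute at most the product of p^(j+1) y over j in
  I, and the sum of such products over all subsets is the expanded product.\<close>

lemma coset_sum_1_le:
  assumes p: "prime p" and y: "y \<ge> 0"
  shows "coset_sum m p 1 y \<le> (\<Prod>j<m. 1 + real p ^ Suc j * y)"
proof -
  define w where "w C = real (sym_count m (int p ^ 1) C) * y ^ det_val p C" for C
  define H where "H = {D \<in> divisor_mats m (int p). hermite m D}"
  have p0: "int p > 0" using p by (simp add: prime_gt_0_nat)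
  have finH: "finite H" unfolding H_def by (rule finite_hermite_divisors[OF p0])
  have w0: "w C \<ge> 0" for C using y by (simp add: w_def)
  have "lcosets m (int p ^ 1) \<subseteq> lcoset m ` H"
  proof
    fix C assume "C \<in> lcosets m (int p ^ 1)"
    then obtain D where "hermite m D" "D \<in> divisor_mats m (int p)" "C = lcoset m D"
      using p0 by (auto elim: lcosets_hermite)
    then show "C \<in> lcoset m ` H" by (auto simp: H_def)
  qed
  then have "coset_sum m p 1 y \<le> (\<Sum>C\<in>lcoset m ` H. w C)"
    unfolding coset_sum_def w_def[symmetric] using finH w0 by (intro sum_mono2) auto
  \<comment> \<open>Summing over Hermite forms counts each coset at least once, which is all that an
    upper bound asks.\<close>
  also have "\<dots> \<le> (\<Sum>D\<in>H. w (lcoset m D))"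
    using sum_image_le[OF finH, of w "lcoset m"] w0 by (simp add: o_def)
  also have "H = (\<Union>I\<in>Pow {..<m}. hermite_pattern m p I)"
    by (auto simp: H_def hermite_pattern_def)
  also have "(\<Sum>D\<in>(\<Union>I\<in>Pow {..<m}. hermite_pattern m p I). w (lcoset m D))
      = (\<Sum>I\<in>Pow {..<m}. \<Sum>D\<in>hermite_pattern m p I. w (lcoset m D))"
  proof (rule sum.UNION_disjoint)
    show "\<forall>I\<in>Pow {..<m}. finite (hermite_pattern m p I)"
    proof
      fix I show "finite (hermite_pattern m p I)"
        by (rule finite_subset[OF _ finH]) (auto simp only: H_def hermite_pattern_def)
    qed
    show "\<forall>I\<in>Pow {..<m}. \<forall>J\<in>Pow {..<m}. I \<noteq> J \<longrightarrow> hermite_pattern m p I \<inter> hermite_pattern m p J = {}"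
      unfolding hermite_pattern_def by blast
  qed simp
  also have "\<dots> \<le> (\<Sum>I\<in>Pow {..<m}. \<Prod>j\<in>I. real p ^ Suc j * y)"
  proof (rule sum_mono)
    fix I assume I: "I \<in> Pow {..<m}"
    let ?i = "\<lambda>i. if i \<in> I then 1 else 0 :: nat"
    have "w (lcoset m D) = real p ^ min_sum m ?i * y ^ card I" if "D \<in> hermite_pattern m p I" for D
      unfolding w_def hermite_pattern_weights(2,3)[OF p that] by simp
    then have "(\<Sum>D\<in>hermite_pattern m p I. w (lcoset m D))
        = (\<Sum>D\<in>hermite_pattern m p I. real p ^ min_sum m ?i * y ^ card I)"
      by (intro sum.cong refl)
    also have "\<dots> = real (card (hermite_pattern m p I)) * (real p ^ min_sum m ?i * y ^ card I)"
      by (rule sum_constant)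
    also have "\<dots> \<le> real p ^ (\<Sum>j\<in>I. card {i. i < j \<and> i \<notin> I}) * (real p ^ min_sum m ?i * y ^ card I)"
    proof (rule mult_right_mono)
      have "real (card (hermite_pattern m p I)) \<le> real (p ^ (\<Sum>j\<in>I. card {i. i < j \<and> i \<notin> I}))"
        using card_hermite_pattern[OF p, of I m] I by (intro of_nat_mono) auto
      then show "real (card (hermite_pattern m p I)) \<le> real p ^ (\<Sum>j\<in>I. card {i. i < j \<and> i \<notin> I})" by simp
    qed (use y in simp)
    also have "\<dots> = real p ^ (min_sum m ?i + (\<Sum>j\<in>I. card {i. i < j \<and> i \<notin> I})) * y ^ card I"
      by (simp add: power_add)
    also have "\<dots> = real p ^ (\<Sum>j\<in>I. Suc j) * y ^ card I"
      using min_sum_indicator[of I m] I by simp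
    also have "\<dots> = (\<Prod>j\<in>I. real p ^ Suc j * y)"
      by (simp only: prod.distrib power_sum prod_constant)
    finally show "(\<Sum>D\<in>hermite_pattern m p I. w (lcoset m D)) \<le> (\<Prod>j\<in>I. real p ^ Suc j * y)" .
  qed
  also have "\<dots> = (\<Prod>j<m. real p ^ Suc j * y + 1)"
    by (subst prod_add) simp_all
  finally show ?thesis by (simp add: add.commute)
qed

section \<open>A family of cosets with phase a^0\<close>

definition split_exponent :: "nat \<Rightarrow> nat \<Rightarrow> nat \<Rightarrow> nat" where
  "split_exponent n r i = (if i < n then 0 else r)"

text \<open>Multiplied from the left by diag(1, p^r), it gives the block matrix (1, X; 0, p^r),
  already written in diagonal form with unimodular factors. X is indexed by positions in the big
  matrix, so its column index starts at n.\<close>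

definition shear_mat :: "nat \<Rightarrow> (nat \<times> nat \<Rightarrow> int) \<Rightarrow> int mat" where
  "shear_mat n X = mat (2*n) (2*n) (\<lambda>(i,j). if i = j then 1 else if i < n \<and> n \<le> j then X (i,j) else 0)"

text \<open>The number l of exponents r is kept apart from the number n of zeros because the
  induction runs over l; the case l = n is the one applied.\<close>

lemma min_sum_split_exponent: "min_sum (n + l) (split_exponent n r) = r * (\<Sum>j<l. Suc j)"
proof (induction l)
  case 0
  show ?case by (simp add: min_sum_def split_exponent_def)
next
  case (Suc l)
  have "(\<Sum>i\<le>n + l. min (split_exponent n r i) (split_exponent n r (n + l))) = (\<Sum>i\<in>{n..n + l}. r)"
    by (intro sum.mono_neutral_cong_right) (auto simp: split_exponent_def)
  also have "\<dots> = Suc l * r" by simp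
  finally show ?case
    using Suc by (simp add: min_sum_def algebra_simps)
qed

lemma sum_split_exponent: "(\<Sum>i<n + l. split_exponent n r i) = l * r"
  by (induction l) (simp_all add: split_exponent_def)

lemma shear_mat_unimod: "shear_mat n X \<in> unimod (2*n)"
  by (intro upper_triangular_unitriangular_unimod) (auto simp: shear_mat_def)

lemma index_diag_pow_mult_shear:
  assumes "i < 2*n" "j < 2*n"
  shows "(diag_pow (2*n) p (split_exponent n r) * shear_mat n X) $$ (i,j) =
    (if i = j then if i < n then 1 else int p ^ r else if i < n \<and> n \<le> j then X (i,j) else 0)"
proof -
  have "(diag_pow (2*n) p (split_exponent n r) * shear_mat n X) $$ (i,j)
      = (\<Sum>k<2*n. if k = i then int p ^ split_exponent n r i * shear_mat n X $$ (i,j) else 0)"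
    unfolding index_mult_square[OF diag_pow_carrier unimod_carrier[OF shear_mat_unimod] assms]
    using assms by (intro sum.cong) (auto simp: diag_pow_def)
  then show ?thesis using assms by (auto simp: split_exponent_def shear_mat_def)
qed

text \<open>The p^(r n^2) residue matrices X give pairwise different cosets, and all of them have
  the same diagonal exponents, hence the same weight.\<close>

lemma middle_coset_sum_ge:
  assumes p: "prime p" and y: "y \<ge> 0"
  shows "real p ^ (r * n^2 + r * (\<Sum>j<n. Suc j)) * y ^ (n * r) \<le>
    (\<Sum>C\<in>{C \<in> lcosets (2*n) (int p ^ r). det_val p C = n * r}.
       real (sym_count (2*n) (int p ^ r) C) * y ^ det_val p C)"
proof -
  let ?m = "2 * n" and ?q = "int p ^ r"
  define J where "J = {..<n} \<times> {n..<2*n}"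
  define F where "F = J \<rightarrow>\<^sub>E {0..<?q}"
  define E where "E X = diag_pow ?m p (split_exponent n r) * shear_mat n X" for X
  define h where "h X = lcoset ?m (E X)" for X
  have p0: "p > 0" using p by (simp add: prime_gt_0_nat)
  have E_eq: "E X = 1\<^sub>m ?m * diag_pow ?m p (split_exponent n r) * shear_mat n X" for X
    by (simp add: E_def left_mult_one_mat[of _ ?m ?m])
  have le: "split_exponent n r i \<le> r" for i by (simp add: split_exponent_def)
  note inv = lcoset_diagonal_form_invariants[where e = "split_exponent n r", OF p one_unimod shear_mat_unimod[of n] le, folded E_eq h_def]
  have ms: "min_sum ?m (split_exponent n r) = r * (\<Sum>j<n. Suc j)" "(\<Sum>i<?m. split_exponent n r i) = n * r"
    using min_sum_split_exponent[of n n r] sum_split_exponent[of n r n] by (simp_all add: mult_2)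
  have E: "E X \<in> carrier_mat ?m ?m" for X
    unfolding E_def by (intro mult_carrier_mat[of _ ?m ?m] diag_pow_carrier unimod_carrier[OF shear_mat_unimod])
  have inj: "inj_on h F"
  proof (rule inj_onI)
    fix X Y assume X: "X \<in> F" and Y: "Y \<in> F" and "h X = h Y"
    then have "E Y \<in> lcoset ?m (E X)" using lcoset_self[OF E] by (simp add: h_def)
    then obtain U where U: "U \<in> unimod ?m" "E Y = U * E X" by (auto simp: lcoset_def)
    have UE: "E Y $$ (i,j) = (\<Sum>k<?m. U $$ (i,k) * E X $$ (k,j))" if "i < ?m" "j < ?m" for i j
      unfolding U(2) by (rule index_mult_square[OF unimod_carrier[OF U(1)] E that])
    note Eij = index_diag_pow_mult_shear[of _ n _ p r, folded E_def]
    \<comment> \<open>The first n columns of both matrices are unit vectors, so comparing them shows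
      that the upper left block of \<open>U\<close> is the identity. In a later column
      \<open>U\<close> can then change X only by a multiple of p^r.\<close>
    have U1: "U $$ (i,j) = (if i = j then 1 else 0)" if ij: "i < n" "j < n" for i j
    proof -
      have "(\<Sum>k<?m. U $$ (i,k) * E X $$ (k,j)) = (\<Sum>k<?m. if k = j then U $$ (i,j) else 0)"
        using ij by (intro sum.cong) (auto simp: Eij)
      with UE[of i j] ij show ?thesis by (auto simp: Eij split: if_splits)
    qed
    have "X (i,j) = Y (i,j)" if ij: "i < n" "n \<le> j" "j < ?m" for i j
    proof -
      have "(\<Sum>k<?m. U $$ (i,k) * E X $$ (k,j))
          = (\<Sum>k<?m. (if k = i then X (i,j) else 0) + (if k = j then U $$ (i,j) * ?q else 0))"
        using ij by (intro sum.cong) (auto simp: Eij U1)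
      then have "Y (i,j) = X (i,j) + U $$ (i,j) * ?q"
        using UE[of i j] ij by (simp add: Eij sum.distrib)
      then have "Y (i,j) mod ?q = X (i,j) mod ?q" by simp
      moreover have "X (i,j) \<in> {0..<?q}" "Y (i,j) \<in> {0..<?q}"
        using X Y ij unfolding F_def J_def by (auto dest!: PiE_mem)
      ultimately show ?thesis by simp
    qed
    then show "X = Y"
      using X Y unfolding F_def by (intro PiE_ext[of X J _ Y]) (auto simp: J_def)
  qed
  have "card F = p ^ (r * n^2)"
    unfolding F_def using p0 by (simp add: card_PiE J_def nat_power_eq power_mult[symmetric] power2_eq_square)
  then have "real p ^ (r * n^2 + r * (\<Sum>j<n. Suc j)) * y ^ (n * r)
      = (\<Sum>C\<in>h ` F. real (sym_count ?m ?q C) * y ^ det_val p C)"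
    using inj by (simp add: sum.reindex inv(2,3) ms power_add)
  also have "\<dots> \<le> (\<Sum>C\<in>{C \<in> lcosets ?m ?q. det_val p C = n * r}. real (sym_count ?m ?q C) * y ^ det_val p C)"
    using y inv(1,3) ms p0 by (intro sum_mono2) (auto simp: finite_lcosets)
  finally show ?thesis .
qed

subsection \<open>Symplectic similitudes\<close>

lemma four_block_square_carrier:
  "A \<in> carrier_mat m m \<Longrightarrow> D \<in> carrier_mat m m \<Longrightarrow> four_block_mat A B C D \<in> carrier_mat (2*m) (2*m)"
  by (simp add: mult_2)

lemma four_block_square_cases:
  assumes "g \<in> carrier_mat (2*m) (2*m)"
  obtains A B C D where "A \<in> carrier_mat m m" "B \<in> carrier_mat m m" "C \<in> carrier_mat m m" "D \<in> carrier_mat m m"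
    "g = four_block_mat A B C D" "split_block g m m = (A, B, C, D)"
proof -
  obtain A B C D where e: "split_block g m m = (A, B, C, D)" by (metis prod_cases4)
  have "dim_row g = m + m" "dim_col g = m + m" using assms by auto
  from split_block[OF e this] e that show thesis by blast
qed

lemma four_block_square_eqD:
  assumes c: "A \<in> carrier_mat m m" "B \<in> carrier_mat m m" "C \<in> carrier_mat m m" "D \<in> carrier_mat m m"
    "A' \<in> carrier_mat m m" "B' \<in> carrier_mat m m" "C' \<in> carrier_mat m m" "D' \<in> carrier_mat m m"
    and e: "four_block_mat A B C D = four_block_mat A' B' C' D'"
  shows "A = A' \<and> B = B' \<and> C = C' \<and> D = D'"
proof -
  have ent: "four_block_mat A B C D $$ (i,j) = four_block_mat A' B' C' D' $$ (i,j)" for i j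
    by (simp add: e)
  have "A $$ (i,j) = A' $$ (i,j) \<and> B $$ (i,j) = B' $$ (i,j) \<and> C $$ (i,j) = C' $$ (i,j) \<and> D $$ (i,j) = D' $$ (i,j)"
    if ij: "i < m" "j < m" for i j
    using ent[of i j] ent[of i "j + m"] ent[of "i + m" j] ent[of "i + m" "j + m"] ij c by simp
  then show ?thesis using c by (intro conjI eq_matI) auto
qed

lemma split_block_four_block:
  assumes c: "A \<in> carrier_mat m m" "B \<in> carrier_mat m m" "C \<in> carrier_mat m m" "D \<in> carrier_mat m m"
  shows "split_block (four_block_mat A B C D) m m = (A, B, C, D)"
proof -
  obtain A' B' C' D' where w: "A' \<in> carrier_mat m m" "B' \<in> carrier_mat m m" "C' \<in> carrier_mat m m" "D' \<in> carrier_mat m m"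
    "four_block_mat A B C D = four_block_mat A' B' C' D'"
    "split_block (four_block_mat A B C D) m m = (A', B', C', D')"
    by (rule four_block_square_cases[OF four_block_square_carrier[OF c(1,4)]])
  from four_block_square_eqD[OF c w(1-5)] w(6) show ?thesis by simp
qed

lemma Jmat_carrier: "Jmat m \<in> carrier_mat (2*m) (2*m)"
  by (simp add: Jmat_def mult_2)

lemma Jmat_mult:
  assumes c: "A \<in> carrier_mat m m" "B \<in> carrier_mat m m" "C \<in> carrier_mat m m" "D \<in> carrier_mat m m"
  shows "Jmat m * four_block_mat A B C D = four_block_mat C D (- A) (- B)"
  unfolding Jmat_def using c
  by (subst mult_four_block_mat[of _ m m _ m _ m _ _ m _ m]) (auto simp: left_mult_zero_mat[of _ m m] left_mult_one_mat[of _ m m])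

lemma mult_four_block_square:
  assumes "A \<in> carrier_mat m m" "B \<in> carrier_mat m m" "C \<in> carrier_mat m m" "D \<in> carrier_mat m m"
    "A' \<in> carrier_mat m m" "B' \<in> carrier_mat m m" "C' \<in> carrier_mat m m" "D' \<in> carrier_mat m m"
  shows "four_block_mat A B C D * four_block_mat A' B' C' D' =
    four_block_mat (A * A' + B * C') (A * B' + B * D') (C * A' + D * C') (C * B' + D * D')"
  by (rule mult_four_block_mat[OF assms])

lemma symplectic_form_blocks:
  assumes c: "A \<in> carrier_mat m m" "B \<in> carrier_mat m m" "C \<in> carrier_mat m m" "D \<in> carrier_mat m m"
  shows "(four_block_mat A B C D)\<^sup>T * Jmat m * four_block_mat A B C D =
    four_block_mat (A\<^sup>T * C + C\<^sup>T * - A) (A\<^sup>T * D + C\<^sup>T * - B) (B\<^sup>T * C + D\<^sup>T * - A) (B\<^sup>T * D + D\<^sup>T * - B)"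
proof -
  have "(four_block_mat A B C D)\<^sup>T * Jmat m * four_block_mat A B C D
      = (four_block_mat A B C D)\<^sup>T * (Jmat m * four_block_mat A B C D)"
    using four_block_square_carrier[OF c(1,4)] Jmat_carrier
    by (intro assoc_mult_mat[of _ "2*m" "2*m" _ "2*m" _ "2*m"]) auto
  also have "\<dots> = four_block_mat A\<^sup>T C\<^sup>T B\<^sup>T D\<^sup>T * four_block_mat C D (- A) (- B)"
    unfolding Jmat_mult[OF c] transpose_four_block_mat[OF c] ..
  also have "\<dots> = four_block_mat (A\<^sup>T * C + C\<^sup>T * - A) (A\<^sup>T * D + C\<^sup>T * - B) (B\<^sup>T * C + D\<^sup>T * - A) (B\<^sup>T * D + D\<^sup>T * - B)"
    using c by (intro mult_four_block_square) auto
  finally show ?thesis .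
qed

lemma smult_Jmat: "q \<cdot>\<^sub>m Jmat m = four_block_mat (0\<^sub>m m m) (q \<cdot>\<^sub>m 1\<^sub>m m) (- (q \<cdot>\<^sub>m 1\<^sub>m m)) (0\<^sub>m m m)"
  by (rule eq_matI) (auto simp: Jmat_def)

lemma mult_uminus_right: "A * - B = - (A * B :: 'a :: ring mat)" if "A \<in> carrier_mat k m" "B \<in> carrier_mat m l"
  using that by (simp add: uminus_mult_right_mat)

lemma mat_eq_iff_diff_zero:
  assumes "A \<in> carrier_mat k l" "B \<in> carrier_mat k l"
  shows "A + - B = 0\<^sub>m k l \<longleftrightarrow> A = (B :: 'a :: ab_group_add mat)"
proof
  assume e: "A + - B = 0\<^sub>m k l"
  show "A = B"
  proof (rule eq_matI)
    fix i j assume ij: "i < dim_row B" "j < dim_col B"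
    have "(A + - B) $$ (i,j) = 0\<^sub>m k l $$ (i,j)" by (simp only: e)
    then show "A $$ (i,j) = B $$ (i,j)" using ij assms by simp
  qed (use assms in auto)
qed (use assms in \<open>auto intro!: eq_matI\<close>)

lemma uminus_zero_mat: "- 0\<^sub>m k l = (0\<^sub>m k l :: 'a :: group_add mat)"
  by (rule eq_matI) auto

text \<open>With lower left block 0 the upper left equation is trivial and the lower left one is the
  negative transpose of the upper right one; two conditions remain.\<close>

lemma GSp_int_upper_iff:
  assumes c: "A \<in> carrier_mat m m" "B \<in> carrier_mat m m" "D \<in> carrier_mat m m"
  shows "four_block_mat A B (0\<^sub>m m m) D \<in> GSp_int m q \<longleftrightarrow>
    A\<^sup>T * D = q \<cdot>\<^sub>m 1\<^sub>m m \<and> B\<^sup>T * D = D\<^sup>T * B"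
proof -
  have z: "0\<^sub>m m m \<in> carrier_mat m m" by simp
  have zl: "A\<^sup>T * 0\<^sub>m m m + (0\<^sub>m m m)\<^sup>T * - A = 0\<^sub>m m m" "A\<^sup>T * D + (0\<^sub>m m m)\<^sup>T * - B = A\<^sup>T * D"
    "B\<^sup>T * 0\<^sub>m m m + D\<^sup>T * - A = - (D\<^sup>T * A)"
    using c by (simp_all add: uminus_zero_mat mult_uminus_right[of _ m m _ m] left_mult_zero_mat[of _ m m] right_mult_zero_mat[of _ m m])
  have "four_block_mat A B (0\<^sub>m m m) D \<in> GSp_int m q \<longleftrightarrow>
     four_block_mat (0\<^sub>m m m) (A\<^sup>T * D) (- (D\<^sup>T * A)) (B\<^sup>T * D + D\<^sup>T * - B)
     = four_block_mat (0\<^sub>m m m) (q \<cdot>\<^sub>m 1\<^sub>m m) (- (q \<cdot>\<^sub>m 1\<^sub>m m)) (0\<^sub>m m m)"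
    unfolding GSp_int_def mem_Collect_eq symplectic_form_blocks[OF c(1,2) z c(3)] zl smult_Jmat
    using four_block_square_carrier[OF c(1,3)] by blast
  also have "\<dots> \<longleftrightarrow> A\<^sup>T * D = q \<cdot>\<^sub>m 1\<^sub>m m \<and> B\<^sup>T * D = D\<^sup>T * B"
  proof
    assume "four_block_mat (0\<^sub>m m m) (A\<^sup>T * D) (- (D\<^sup>T * A)) (B\<^sup>T * D + D\<^sup>T * - B)
     = four_block_mat (0\<^sub>m m m) (q \<cdot>\<^sub>m 1\<^sub>m m) (- (q \<cdot>\<^sub>m 1\<^sub>m m)) (0\<^sub>m m m)"
    from four_block_square_eqD[OF _ _ _ _ _ _ _ _ this, of m]
    have "A\<^sup>T * D = q \<cdot>\<^sub>m 1\<^sub>m m" "B\<^sup>T * D + D\<^sup>T * - B = 0\<^sub>m m m" using c by auto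
    then show "A\<^sup>T * D = q \<cdot>\<^sub>m 1\<^sub>m m \<and> B\<^sup>T * D = D\<^sup>T * B"
      using c mat_eq_iff_diff_zero[of "B\<^sup>T * D" m m "D\<^sup>T * B"] by (simp add: mult_uminus_right[of _ m m _ m])
  next
    assume a: "A\<^sup>T * D = q \<cdot>\<^sub>m 1\<^sub>m m \<and> B\<^sup>T * D = D\<^sup>T * B"
    have "D\<^sup>T * A = (A\<^sup>T * D)\<^sup>T" using c by (simp add: transpose_mult[of _ m m _ m])
    also have "\<dots> = q \<cdot>\<^sub>m 1\<^sub>m m" using a by (auto intro!: eq_matI)
    finally have "D\<^sup>T * A = q \<cdot>\<^sub>m 1\<^sub>m m" .
    moreover have "B\<^sup>T * D + D\<^sup>T * - B = 0\<^sub>m m m"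
      using a c mat_eq_iff_diff_zero[of "B\<^sup>T * D" m m "D\<^sup>T * B"] by (simp add: mult_uminus_right[of _ m m _ m])
    ultimately show "four_block_mat (0\<^sub>m m m) (A\<^sup>T * D) (- (D\<^sup>T * A)) (B\<^sup>T * D + D\<^sup>T * - B)
     = four_block_mat (0\<^sub>m m m) (q \<cdot>\<^sub>m 1\<^sub>m m) (- (q \<cdot>\<^sub>m 1\<^sub>m m)) (0\<^sub>m m m)"
      using a by simp
  qed
  finally show ?thesis .
qed

lemma GSp_int_carrier: "g \<in> GSp_int m q \<Longrightarrow> g \<in> carrier_mat (2*m) (2*m)"
  by (simp add: GSp_int_def)

lemma Gamma_mult_GSp_int:
  assumes g: "\<gamma> \<in> Gamma m" and h: "h \<in> GSp_int m q"
  shows "\<gamma> * h \<in> GSp_int m q"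
proof -
  let ?N = "2 * m"
  have c: "\<gamma> \<in> carrier_mat ?N ?N" "h \<in> carrier_mat ?N ?N" using g h by (auto simp: Gamma_def GSp_int_def)
  have "(\<gamma> * h)\<^sup>T * Jmat m * (\<gamma> * h) = h\<^sup>T * (\<gamma>\<^sup>T * Jmat m * \<gamma>) * h"
    using c Jmat_carrier[of m]
    by (simp add: transpose_mult[of _ ?N ?N _ ?N] assoc_mult_mat[of _ ?N ?N _ ?N _ ?N] mult_carrier_mat[of _ ?N ?N _ ?N])
  also have "\<gamma>\<^sup>T * Jmat m * \<gamma> = Jmat m" using g by (simp add: Gamma_def GSp_int_def one_smult)
  also have "h\<^sup>T * Jmat m * h = q \<cdot>\<^sub>m Jmat m" using h by (simp add: GSp_int_def)
  finally show ?thesis using c by (simp add: GSp_int_def)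
qed

section \<open>Inverses and transposes of similitudes\<close>

lemma Jmat_square: "Jmat m * Jmat m = - 1\<^sub>m (2*m)"
proof -
  have "Jmat m * Jmat m = four_block_mat (- 1\<^sub>m m) (0\<^sub>m m m) (- 0\<^sub>m m m) (- 1\<^sub>m m)"
    by (subst (2) Jmat_def, subst Jmat_mult) auto
  also have "\<dots> = - 1\<^sub>m (2*m)" by (rule eq_matI) auto
  finally show ?thesis .
qed

lemma Jmat_transpose: "(Jmat m)\<^sup>T = - Jmat m"
  by (rule eq_matI) (auto simp: Jmat_def)

text \<open>Since J^(-1) = -J, this is q g^(-1) for a similitude g with factor q, and it is visibly
  integral.\<close>

definition symp_adjoint :: "nat \<Rightarrow> int mat \<Rightarrow> int mat" where
  "symp_adjoint m g = - (Jmat m * g\<^sup>T * Jmat m)"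

lemma symp_adjoint_mult:
  assumes g: "g \<in> GSp_int m q" and q: "q \<noteq> 0"
  shows "symp_adjoint m g \<in> carrier_mat (2*m) (2*m)" "symp_adjoint m g * g = q \<cdot>\<^sub>m 1\<^sub>m (2*m)"
    "g * symp_adjoint m g = q \<cdot>\<^sub>m 1\<^sub>m (2*m)"
proof -
  let ?N = "2 * m" and ?J = "Jmat m"
  have c: "g \<in> carrier_mat ?N ?N" using g by (simp add: GSp_int_def)
  note J = Jmat_carrier[of m]
  show ac: "symp_adjoint m g \<in> carrier_mat ?N ?N"
    using c J by (simp add: symp_adjoint_def mult_carrier_mat[of _ ?N ?N _ ?N])
  have "symp_adjoint m g * g = - (?J * (g\<^sup>T * ?J * g))"
    unfolding symp_adjoint_def using c J
    by (subst uminus_mult_left_mat) (auto simp: assoc_mult_mat[of _ ?N ?N _ ?N _ ?N] mult_carrier_mat[of _ ?N ?N _ ?N])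
  also have "\<dots> = - (?J * (q \<cdot>\<^sub>m ?J))" using g by (simp add: GSp_int_def)
  also have "\<dots> = - (q \<cdot>\<^sub>m (?J * ?J))" using J by (simp add: mult_smult_distrib[of _ ?N ?N _ ?N])
  also have "\<dots> = q \<cdot>\<^sub>m 1\<^sub>m ?N" unfolding Jmat_square by (rule eq_matI) auto
  finally show l: "symp_adjoint m g * g = q \<cdot>\<^sub>m 1\<^sub>m ?N" .
  show "g * symp_adjoint m g = q \<cdot>\<^sub>m 1\<^sub>m ?N" by (rule scalar_left_inverse_imp_right[OF ac c l q])
qed

text \<open>The transpose of a similitude is a similitude: rewrite g times its adjoint as q,
  multiply by J from the right and use J^2 = -1. In this form g acts on the left of J, which suits
  row operations.\<close>

lemma GSp_int_transposed_form:
  assumes g: "g \<in> GSp_int m q" and q: "q \<noteq> 0"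
  shows "g * Jmat m * g\<^sup>T = q \<cdot>\<^sub>m Jmat m"
proof -
  let ?N = "2 * m" and ?J = "Jmat m"
  have c: "g \<in> carrier_mat ?N ?N" using g by (simp add: GSp_int_def)
  note J = Jmat_carrier[of m]
  have X: "?J * g\<^sup>T * ?J \<in> carrier_mat ?N ?N" using c J by (simp add: mult_carrier_mat[of _ ?N ?N _ ?N])
  have "g * - (?J * g\<^sup>T * ?J) * ?J = q \<cdot>\<^sub>m 1\<^sub>m ?N * ?J"
    using symp_adjoint_mult(3)[OF g q] by (simp add: symp_adjoint_def)
  also have "\<dots> = q \<cdot>\<^sub>m ?J" using J by (simp add: mult_smult_assoc_mat[of _ ?N ?N _ ?N])
  also have "g * - (?J * g\<^sup>T * ?J) * ?J = - (g * (?J * g\<^sup>T * ?J) * ?J)"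
    using c J X by (simp add: mult_uminus_right[of _ ?N ?N _ ?N] uminus_mult_left_mat)
  also have "g * (?J * g\<^sup>T * ?J) * ?J = g * (?J * g\<^sup>T) * (?J * ?J)"
    using c J by (simp add: assoc_mult_mat[of _ ?N ?N _ ?N _ ?N] mult_carrier_mat[of _ ?N ?N _ ?N])
  also have "\<dots> = - (g * (?J * g\<^sup>T))"
    unfolding Jmat_square using c J
    by (subst mult_uminus_right[of _ ?N ?N _ ?N]) (auto simp: mult_carrier_mat[of _ ?N ?N _ ?N] right_mult_one_mat[of _ ?N ?N])
  finally have "g * (?J * g\<^sup>T) = q \<cdot>\<^sub>m ?J" by simp
  then show ?thesis using c J by (simp add: assoc_mult_mat[of _ ?N ?N _ ?N _ ?N])
qed

lemma Gamma_if_transposed_form: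
  assumes c: "g \<in> carrier_mat (2*m) (2*m)" and e: "g * Jmat m * g\<^sup>T = Jmat m"
  shows "g \<in> Gamma m"
proof -
  have "g\<^sup>T \<in> GSp_int m 1" using c e by (simp add: GSp_int_def one_smult)
  from GSp_int_transposed_form[OF this] c show ?thesis
    by (simp add: Gamma_def GSp_int_def)
qed

lemma Gamma_inverse:
  assumes g: "\<gamma> \<in> Gamma m"
  obtains \<delta> where "\<delta> \<in> Gamma m" "\<delta> * \<gamma> = 1\<^sub>m (2*m)" "\<gamma> * \<delta> = 1\<^sub>m (2*m)"
proof -
  let ?N = "2 * m" and ?J = "Jmat m"
  define \<delta> where "\<delta> = symp_adjoint m \<gamma>"
  have g': "\<gamma> \<in> GSp_int m 1" using g by (simp add: Gamma_def)
  have c: "\<gamma> \<in> carrier_mat ?N ?N" using GSp_int_carrier[OF g'] .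
  have d: "\<delta> \<in> carrier_mat ?N ?N" "\<delta> * \<gamma> = 1\<^sub>m ?N" "\<gamma> * \<delta> = 1\<^sub>m ?N"
    using symp_adjoint_mult[OF g'] by (simp_all add: \<delta>_def one_smult)
  note J = Jmat_carrier[of m]
  have "\<delta>\<^sup>T * ?J * \<delta> = \<delta>\<^sup>T * (\<gamma>\<^sup>T * ?J * \<gamma>) * \<delta>" using g' by (simp add: GSp_int_def one_smult)
  also have "\<dots> = (\<gamma> * \<delta>)\<^sup>T * ?J * (\<gamma> * \<delta>)"
    using c d(1) J by (simp add: transpose_mult[of _ ?N ?N _ ?N] assoc_mult_mat[of _ ?N ?N _ ?N _ ?N] mult_carrier_mat[of _ ?N ?N _ ?N])
  also have "\<dots> = ?J" unfolding d(3) using J by (simp add: left_mult_one_mat[of _ ?N ?N] right_mult_one_mat[of _ ?N ?N])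
  finally have "\<delta> \<in> Gamma m" using d(1) by (simp add: Gamma_def GSp_int_def one_smult)
  with that d show thesis by blast
qed

section \<open>Cosets of the symplectic group and block triangular representatives\<close>

lemma Gamma_coset_eq:
  assumes g: "\<gamma> \<in> Gamma m" and h: "h \<in> carrier_mat (2*m) (2*m)"
  shows "(\<lambda>\<delta>. \<delta> * (\<gamma> * h)) ` Gamma m = (\<lambda>\<delta>. \<delta> * h) ` Gamma m"
proof -
  let ?N = "2 * m"
  have Gm: "\<alpha> * \<beta> \<in> Gamma m" if "\<alpha> \<in> Gamma m" "\<beta> \<in> Gamma m" for \<alpha> \<beta>
    using that Gamma_mult_GSp_int by (simp add: Gamma_def)
  have Gc: "\<alpha> \<in> carrier_mat ?N ?N" if "\<alpha> \<in> Gamma m" for \<alpha>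
    using that GSp_int_carrier by (simp add: Gamma_def)
  obtain \<gamma>' where g': "\<gamma>' \<in> Gamma m" "\<gamma>' * \<gamma> = 1\<^sub>m ?N" using Gamma_inverse[OF g] by metis
  show ?thesis
  proof (intro equalityI image_subsetI)
    fix \<delta> assume d: "\<delta> \<in> Gamma m"
    have "\<delta> * (\<gamma> * h) = (\<delta> * \<gamma>) * h"
      using Gc[OF d] Gc[OF g] h by (simp add: assoc_mult_mat[of _ ?N ?N _ ?N _ ?N])
    then show "\<delta> * (\<gamma> * h) \<in> (\<lambda>\<delta>. \<delta> * h) ` Gamma m" using Gm[OF d g] by auto
  next
    fix \<delta> assume d: "\<delta> \<in> Gamma m"
    have "(\<delta> * \<gamma>') * (\<gamma> * h) = \<delta> * (\<gamma>' * \<gamma>) * h"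
      using Gc[OF d] Gc[OF g] Gc[OF g'(1)] h
      by (simp add: assoc_mult_mat[of _ ?N ?N _ ?N _ ?N] mult_carrier_mat[of _ ?N ?N _ ?N])
    also have "\<dots> = \<delta> * h" unfolding g'(2) using Gc[OF d] by (simp add: right_mult_one_mat[of _ ?N ?N])
    finally have "\<delta> * h = (\<delta> * \<gamma>') * (\<gamma> * h)" ..
    then show "\<delta> * h \<in> (\<lambda>\<delta>. \<delta> * (\<gamma> * h)) ` Gamma m" using Gm[OF d g'(1)] by blast
  qed
qed

text \<open>The lower left block c' satisfies c' A = 0, and A cancels because A D^T = q. So the
  symplectic matrix is itself block upper triangular, and D changes only by a unimodular left
  factor.\<close>

lemma Gamma_stabilizer_blocks:
  assumes g: "\<gamma> \<in> Gamma m" and c: "A \<in> carrier_mat m m" "B \<in> carrier_mat m m" "D \<in> carrier_mat m m"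
    "A' \<in> carrier_mat m m" "B' \<in> carrier_mat m m" "D' \<in> carrier_mat m m"
    and AD: "A\<^sup>T * D = q \<cdot>\<^sub>m 1\<^sub>m m" and q: "q \<noteq> 0"
    and e: "\<gamma> * four_block_mat A B (0\<^sub>m m m) D = four_block_mat A' B' (0\<^sub>m m m) D'"
  obtains a b d where "a \<in> carrier_mat m m" "b \<in> carrier_mat m m" "d \<in> unimod m" "a\<^sup>T * d = 1\<^sub>m m"
    "b\<^sup>T * d = d\<^sup>T * b" "A' = a * A" "B' = a * B + b * D" "D' = d * D"
proof -
  have gc: "\<gamma> \<in> carrier_mat (2*m) (2*m)" using g GSp_int_carrier by (simp add: Gamma_def)
  obtain a b c' d where w: "a \<in> carrier_mat m m" "b \<in> carrier_mat m m" "c' \<in> carrier_mat m m" "d \<in> carrier_mat m m"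
    and g_eq: "\<gamma> = four_block_mat a b c' d"
    using four_block_square_cases[OF gc] by metis
  have z: "0\<^sub>m m m \<in> carrier_mat m m" by simp
  have "four_block_mat (a * A + b * 0\<^sub>m m m) (a * B + b * D) (c' * A + d * 0\<^sub>m m m) (c' * B + d * D)
      = four_block_mat A' B' (0\<^sub>m m m) D'"
    using e unfolding g_eq mult_four_block_square[OF w c(1,2) z c(3)] .
  from four_block_square_eqD[OF _ _ _ _ c(4,5) z c(6) this]
  have eqs: "a * A + b * 0\<^sub>m m m = A'" "a * B + b * D = B'" "c' * A + d * 0\<^sub>m m m = 0\<^sub>m m m" "c' * B + d * D = D'"
    using w c by auto
  have A': "a * A = A'" and cA: "c' * A = 0\<^sub>m m m" using eqs(1,3) w c by (simp_all add: right_mult_zero_mat[of _ m m])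
  have DA: "D\<^sup>T * A = q \<cdot>\<^sub>m 1\<^sub>m m"
  proof -
    have "D\<^sup>T * A = (A\<^sup>T * D)\<^sup>T" using c by (simp add: transpose_mult[of _ m m _ m])
    also have "\<dots> = q \<cdot>\<^sub>m 1\<^sub>m m" unfolding AD by (auto intro!: eq_matI)
    finally show ?thesis .
  qed
  have "A * D\<^sup>T = q \<cdot>\<^sub>m 1\<^sub>m m" by (rule scalar_left_inverse_imp_right[OF _ c(1) DA q]) (use c in simp)
  moreover have "c' * A = 0\<^sub>m m m * A" unfolding cA using c by (simp add: left_mult_zero_mat[of _ m m])
  ultimately have c0: "c' = 0\<^sub>m m m"
    using mult_mat_right_cancel[of c' A "0\<^sub>m m m" m m "D\<^sup>T" q] w(3) c q by simp
  have D': "d * D = D'" using eqs(4) w c unfolding c0 by (simp add: left_mult_zero_mat[of _ m m])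
  have "four_block_mat a b (0\<^sub>m m m) d \<in> GSp_int m 1" using g unfolding g_eq c0 Gamma_def .
  then have ad: "a\<^sup>T * d = 1\<^sub>m m" and bd: "b\<^sup>T * d = d\<^sup>T * b"
    unfolding GSp_int_upper_iff[OF w(1,2,4)] by (simp_all add: one_smult)
  have "d \<in> unimod m" by (rule unimod_if_left_inverse[OF w(4) _ ad]) (use w in simp)
  from that[OF w(1,2) this ad bd A'[symmetric] eqs(2)[symmetric] D'[symmetric]] show thesis .
qed

lemma Gamma_block_diagonal:
  assumes U: "U \<in> unimod m"
  obtains V where "V \<in> carrier_mat m m" "V\<^sup>T * U = 1\<^sub>m m"
    "four_block_mat V (0\<^sub>m m m) (0\<^sub>m m m) U \<in> Gamma m"
proof -
  obtain W where W: "W \<in> unimod m" "W * U = 1\<^sub>m m" using unimod_inverse[OF U] by metis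
  note c = unimod_carrier[OF U] unimod_carrier[OF W(1)]
  have "four_block_mat (W\<^sup>T) (0\<^sub>m m m) (0\<^sub>m m m) U \<in> GSp_int m 1"
    using c W(2)
    by (subst GSp_int_upper_iff) (auto simp: one_smult left_mult_zero_mat[of _ m m] right_mult_zero_mat[of _ m m])
  then show thesis using that[of "W\<^sup>T"] c W(2) by (simp add: Gamma_def)
qed

lemma Gamma_translation:
  assumes T: "T \<in> carrier_mat m m" "symmetric_mat m T"
  shows "four_block_mat (1\<^sub>m m) T (0\<^sub>m m m) (1\<^sub>m m) \<in> Gamma m"
  unfolding Gamma_def using T symmetric_mat_iff_transpose[OF T(1)]
  by (subst GSp_int_upper_iff) (auto simp: one_smult left_mult_one_mat[of _ m m] right_mult_one_mat[of _ m m])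

text \<open>Integral row operations make the matrix block upper triangular; they turn the symplectic form
  into an integral skew form with a vanishing lower right block, which an operation fixing the lower
  block rows brings back to the standard one.\<close>
lemma Gamma_reduce:
  assumes g: "g \<in> GSp_int m q" and q: "q \<noteq> 0"
  obtains \<gamma> A B D where "\<gamma> \<in> Gamma m" "A \<in> carrier_mat m m" "B \<in> carrier_mat m m" "D \<in> carrier_mat m m"
    "\<gamma> * g = four_block_mat A B (0\<^sub>m m m) D"
proof -
  let ?N = "2 * m" and ?J = "Jmat m"
  note J = Jmat_carrier[of m]
  have z: "0\<^sub>m m m \<in> carrier_mat m m" and o: "1\<^sub>m m \<in> carrier_mat m m" by simp_all
  have c: "g \<in> carrier_mat ?N ?N" using GSp_int_carrier[OF g] .
  obtain U where U: "U \<in> unimod ?N" and ut: "upper_triangular (U * g)"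
    using unimod_triangularize[OF c] by blast
  note Uc = unimod_carrier[OF U]
  have gc: "U * g \<in> carrier_mat ?N ?N" using Uc c by simp
  obtain A B C D where w: "A \<in> carrier_mat m m" "B \<in> carrier_mat m m" "C \<in> carrier_mat m m" "D \<in> carrier_mat m m"
    and g_eq: "U * g = four_block_mat A B C D"
    using four_block_square_cases[OF gc] by metis
  have "C = 0\<^sub>m m m"
  proof (rule eq_matI)
    fix i j assume ij: "i < dim_row (0\<^sub>m m m)" "j < dim_col (0\<^sub>m m m)"
    have "four_block_mat A B C D $$ (i + m, j) = 0"
      using upper_triangularD[OF ut, of j "i + m"] ij w unfolding g_eq by simp
    then show "C $$ (i,j) = 0\<^sub>m m m $$ (i,j)" using ij w by simp
  qed (use w in auto)
  then have g_eq: "U * g = four_block_mat A B (0\<^sub>m m m) D" using g_eq by simp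
  \<comment> \<open>The Gram matrix of the rows of \<open>U\<close>. Multiplied by q it becomes the
    Gram matrix of the rows of \<open>U * g\<close>, whose lower block row (0, D) is isotropic for
    J; this forces the lower right block of \<open>K\<close> to vanish.\<close>
  define K where "K = U * ?J * U\<^sup>T"
  have Kc: "K \<in> carrier_mat ?N ?N" unfolding K_def using Uc J by (simp add: mult_carrier_mat[of _ ?N ?N _ ?N])
  obtain K1 N K3 K4 where k: "K1 \<in> carrier_mat m m" "N \<in> carrier_mat m m" "K3 \<in> carrier_mat m m" "K4 \<in> carrier_mat m m"
    and K_eq: "K = four_block_mat K1 N K3 K4"
    using four_block_square_cases[OF Kc] by metis
  have "q \<cdot>\<^sub>m K = U * (g * ?J * g\<^sup>T) * U\<^sup>T"
    unfolding GSp_int_transposed_form[OF g q] K_def using Uc J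
    by (simp add: mult_smult_distrib[of _ ?N ?N _ ?N] mult_smult_assoc_mat[of _ ?N ?N _ ?N] mult_carrier_mat[of _ ?N ?N _ ?N])
  also have "\<dots> = (U * g) * (?J * (U * g)\<^sup>T)"
    using Uc J c by (simp add: transpose_mult[of _ ?N ?N _ ?N] assoc_mult_mat[of _ ?N ?N _ ?N _ ?N] mult_carrier_mat[of _ ?N ?N _ ?N])
  also have "\<dots> = four_block_mat A B (0\<^sub>m m m) D * four_block_mat (B\<^sup>T) (D\<^sup>T) (- A\<^sup>T) (- (0\<^sub>m m m)\<^sup>T)"
    unfolding g_eq transpose_four_block_mat[OF w(1,2) z w(4)] using w by (subst Jmat_mult) auto
  also have "\<dots> = four_block_mat (A * B\<^sup>T + B * - A\<^sup>T) (A * D\<^sup>T + B * - (0\<^sub>m m m)\<^sup>T)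
      (0\<^sub>m m m * B\<^sup>T + D * - A\<^sup>T) (0\<^sub>m m m * D\<^sup>T + D * - (0\<^sub>m m m)\<^sup>T)"
    using w by (intro mult_four_block_square) auto
  finally have "four_block_mat (q \<cdot>\<^sub>m K1) (q \<cdot>\<^sub>m N) (q \<cdot>\<^sub>m K3) (q \<cdot>\<^sub>m K4)
      = four_block_mat (A * B\<^sup>T + B * - A\<^sup>T) (A * D\<^sup>T + B * - (0\<^sub>m m m)\<^sup>T)
      (0\<^sub>m m m * B\<^sup>T + D * - A\<^sup>T) (0\<^sub>m m m * D\<^sup>T + D * - (0\<^sub>m m m)\<^sup>T)"
    unfolding K_eq smult_four_block_mat[OF k] .
  from four_block_square_eqD[OF _ _ _ _ _ _ _ _ this, of m]
  have "q \<cdot>\<^sub>m K4 = 0\<^sub>m m m * D\<^sup>T + D * - (0\<^sub>m m m)\<^sup>T" using w k by auto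
  also have "\<dots> = q \<cdot>\<^sub>m 0\<^sub>m m m"
    using w by (simp add: uminus_zero_mat left_mult_zero_mat[of _ m m] right_mult_zero_mat[of _ m m])
  finally have "K4 = 0\<^sub>m m m" by (rule smult_mat_cancel[OF _ q k(4) z])
  then have K_eq: "K = four_block_mat K1 N K3 (0\<^sub>m m m)" using K_eq by simp
  have "K\<^sup>T = U * ?J\<^sup>T * U\<^sup>T"
    unfolding K_def using Uc J
    by (simp add: transpose_mult[of _ ?N ?N _ ?N] assoc_mult_mat[of _ ?N ?N _ ?N _ ?N] mult_carrier_mat[of _ ?N ?N _ ?N])
  also have "\<dots> = - K"
    unfolding K_def Jmat_transpose using Uc J
    by (simp add: mult_uminus_right[of _ ?N ?N _ ?N] uminus_mult_left_mat mult_carrier_mat[of _ ?N ?N _ ?N])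
  also have "\<dots> = four_block_mat (- K1) (- N) (- K3) (- 0\<^sub>m m m)"
    unfolding K_eq using k by (intro eq_matI) auto
  finally have "four_block_mat (K1\<^sup>T) (K3\<^sup>T) (N\<^sup>T) ((0\<^sub>m m m)\<^sup>T) = four_block_mat (- K1) (- N) (- K3) (- 0\<^sub>m m m)"
    unfolding K_eq transpose_four_block_mat[OF k(1-3) z] .
  from four_block_square_eqD[OF _ _ _ _ _ _ _ _ this, of m]
  have K1T: "K1\<^sup>T = - K1" and NT: "N\<^sup>T = - K3" using k by auto
  have "(- ?J) * ?J = 1\<^sub>m ?N" using J by (simp add: uminus_mult_left_mat Jmat_square)
  then have "?J \<in> unimod ?N" by (rule unimod_if_left_inverse[OF J, rotated]) (use J in simp)
  \<comment> \<open>With one block zero, the lower right block of K L = 1 reads K3 y = 1, so the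
    off-diagonal blocks of \<open>K\<close> are invertible over the integers.\<close>
  then have "K \<in> unimod ?N" unfolding K_def using U by (intro mult_unimod transpose_unimod)
  then obtain L where L: "L \<in> unimod ?N" "K * L = 1\<^sub>m ?N" using unimod_inverse by metis
  obtain x y v u where l: "x \<in> carrier_mat m m" "y \<in> carrier_mat m m" "v \<in> carrier_mat m m" "u \<in> carrier_mat m m"
    and L_eq: "L = four_block_mat x y v u"
    using four_block_square_cases[OF unimod_carrier[OF L(1)]] by metis
  have "four_block_mat (K1 * x + N * v) (K1 * y + N * u) (K3 * x + 0\<^sub>m m m * v) (K3 * y + 0\<^sub>m m m * u)
      = four_block_mat (1\<^sub>m m) (0\<^sub>m m m) (0\<^sub>m m m) (1\<^sub>m m)"
    using L(2) unfolding K_eq L_eq mult_four_block_square[OF k(1-3) z l] by (simp add: mult_2)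
  from four_block_square_eqD[OF _ _ _ _ _ _ _ _ this, of m]
  have "K3 * y + 0\<^sub>m m m * u = 1\<^sub>m m" using k l by auto
  then have K3y: "K3 * y = 1\<^sub>m m" using k l by (simp add: left_mult_zero_mat[of _ m m])
  \<comment> \<open>The inverse of \<open>N\<close>, because N = - K3^T; it turns the upper right
    block of the form into the identity.\<close>
  define M where "M = - y\<^sup>T"
  have Mc: "M \<in> carrier_mat m m" using l by (simp add: M_def)
  have "y * K3 = 1\<^sub>m m"
    using scalar_left_inverse_imp_right[OF k(3) l(2), of 1] K3y by (simp add: one_smult)
  have N_eq: "N = - K3\<^sup>T" using NT k by (metis transpose_transpose transpose_uminus)
  have "M * N = - (y\<^sup>T * - K3\<^sup>T)" unfolding M_def N_eq using l k by (intro uminus_mult_left_mat) auto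
  also have "- (y\<^sup>T * - K3\<^sup>T) = y\<^sup>T * K3\<^sup>T" using l k by (simp add: mult_uminus_right[of _ m m _ m])
  also have "\<dots> = (K3 * y)\<^sup>T" using l k by (simp add: transpose_mult[of _ m m _ m])
  finally have MN: "M * N = 1\<^sub>m m" unfolding K3y by simp
  have MT: "M\<^sup>T = - y" unfolding M_def transpose_uminus by simp
  have K3M: "K3 * M\<^sup>T = - 1\<^sub>m m" unfolding MT using k l K3y by (simp add: mult_uminus_right[of _ m m _ m])
  define S where "S = M * K1 * M\<^sup>T"
  have Sc: "S \<in> carrier_mat m m" unfolding S_def using Mc k by (simp add: mult_carrier_mat[of _ m m _ m])
  have "S\<^sup>T = M * K1\<^sup>T * M\<^sup>T"
    unfolding S_def using Mc k
    by (simp add: transpose_mult[of _ m m _ m] assoc_mult_mat[of _ m m _ m _ m] mult_carrier_mat[of _ m m _ m])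
  also have "\<dots> = - S"
    unfolding S_def K1T using Mc k
    by (simp add: mult_uminus_right[of _ m m _ m] uminus_mult_left_mat mult_carrier_mat[of _ m m _ m])
  finally have ST: "S\<^sup>T = - S" .
  have skew: "S $$ (j,i) = - S $$ (i,j)" if "i < m" "j < m" for i j
  proof -
    have "S\<^sup>T $$ (i,j) = (- S) $$ (i,j)" by (simp only: ST)
    then show ?thesis using that Sc by simp
  qed
  \<comment> \<open>An integral skew matrix has zero diagonal and equals X - X^T for its strictly
    upper part X. This avoids halving \<open>S\<close>.\<close>
  define X where "X = mat m m (\<lambda>(i,j). if i < j then S $$ (i,j) else 0)"
  have Xc: "X \<in> carrier_mat m m" by (simp add: X_def)
  have SX: "S + - X + X\<^sup>T = 0\<^sub>m m m"
  proof (rule eq_matI)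
    fix i j assume "i < dim_row (0\<^sub>m m m)" "j < dim_col (0\<^sub>m m m)"
    then have ij: "i < m" "j < m" by simp_all
    with skew[OF ij] Sc show "(S + - X + X\<^sup>T) $$ (i,j) = 0\<^sub>m m m $$ (i,j)"
      by (cases i j rule: linorder_cases) (auto simp: X_def)
  qed (use Sc Xc in auto)
  \<comment> \<open>The lower block row of \<open>P\<close> is (0, 1), so the zero block already
    produced in \<open>U * g\<close> survives multiplication by \<open>P\<close>.\<close>
  define P where "P = four_block_mat M X (0\<^sub>m m m) (1\<^sub>m m)"
  have Pc: "P \<in> carrier_mat ?N ?N" unfolding P_def by (rule four_block_square_carrier[OF Mc o])
  have "P * K = four_block_mat (M * K1 + X * K3) (M * N + X * 0\<^sub>m m m) (0\<^sub>m m m * K1 + 1\<^sub>m m * K3) (0\<^sub>m m m * N + 1\<^sub>m m * 0\<^sub>m m m)"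
    unfolding P_def K_eq by (rule mult_four_block_square[OF Mc Xc z o k(1-3) z])
  also have "\<dots> = four_block_mat (M * K1 + X * K3) (1\<^sub>m m) K3 (0\<^sub>m m m)"
    using k Xc MN
    by (simp add: left_mult_zero_mat[of _ m m] right_mult_zero_mat[of _ m m] left_mult_one_mat[of _ m m])
  finally have PK: "P * K = four_block_mat (M * K1 + X * K3) (1\<^sub>m m) K3 (0\<^sub>m m m)" .
  have MX: "M * K1 + X * K3 \<in> carrier_mat m m" using Mc k Xc by (simp add: mult_carrier_mat[of _ m m _ m])
  have "P * K * P\<^sup>T = four_block_mat ((M * K1 + X * K3) * M\<^sup>T + 1\<^sub>m m * X\<^sup>T) ((M * K1 + X * K3) * (0\<^sub>m m m)\<^sup>T + 1\<^sub>m m * (1\<^sub>m m)\<^sup>T)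
      (K3 * M\<^sup>T + 0\<^sub>m m m * X\<^sup>T) (K3 * (0\<^sub>m m m)\<^sup>T + 0\<^sub>m m m * (1\<^sub>m m)\<^sup>T)"
    unfolding PK unfolding P_def transpose_four_block_mat[OF Mc Xc z o]
    using Mc Xc k MX by (intro mult_four_block_square) auto
  also have "(M * K1 + X * K3) * M\<^sup>T + 1\<^sub>m m * X\<^sup>T = S + - X + X\<^sup>T"
  proof -
    have "(M * K1 + X * K3) * M\<^sup>T = M * K1 * M\<^sup>T + X * K3 * M\<^sup>T"
      using Mc Xc k by (intro add_mult_distrib_mat[of _ m m _ _ m]) (auto simp: mult_carrier_mat[of _ m m _ m])
    also have "X * K3 * M\<^sup>T = X * (K3 * M\<^sup>T)" using Mc Xc k by (intro assoc_mult_mat[of _ m m _ m _ m]) auto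
    also have "\<dots> = - X" unfolding K3M using Xc by (simp add: mult_uminus_right[of _ m m _ m] right_mult_one_mat[of _ m m])
    finally show ?thesis using Xc by (simp add: S_def left_mult_one_mat[of _ m m])
  qed
  also have "four_block_mat (S + - X + X\<^sup>T) ((M * K1 + X * K3) * (0\<^sub>m m m)\<^sup>T + 1\<^sub>m m * (1\<^sub>m m)\<^sup>T)
      (K3 * M\<^sup>T + 0\<^sub>m m m * X\<^sup>T) (K3 * (0\<^sub>m m m)\<^sup>T + 0\<^sub>m m m * (1\<^sub>m m)\<^sup>T)
      = four_block_mat (0\<^sub>m m m) (1\<^sub>m m) (- 1\<^sub>m m) (0\<^sub>m m m)"
    unfolding SX K3M using k Xc MX
    by (simp add: left_mult_zero_mat[of _ m m] right_mult_zero_mat[of _ m m] left_mult_one_mat[of _ m m])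
  finally have PKP: "P * K * P\<^sup>T = ?J" unfolding Jmat_def .
  have "(P * U) * ?J * (P * U)\<^sup>T = P * K * P\<^sup>T"
    unfolding K_def using Pc Uc J
    by (simp add: transpose_mult[of _ ?N ?N _ ?N] assoc_mult_mat[of _ ?N ?N _ ?N _ ?N] mult_carrier_mat[of _ ?N ?N _ ?N])
  then have "P * U \<in> Gamma m"
    unfolding PKP using Pc Uc by (intro Gamma_if_transposed_form) auto
  moreover have "P * U * g = four_block_mat (M * A) (M * B + X * D) (0\<^sub>m m m) D"
  proof -
    have "P * U * g = P * four_block_mat A B (0\<^sub>m m m) D"
      unfolding g_eq[symmetric] using Pc Uc c by (simp add: assoc_mult_mat[of _ ?N ?N _ ?N _ ?N])
    also have "\<dots> = four_block_mat (M * A + X * 0\<^sub>m m m) (M * B + X * D) (0\<^sub>m m m * A + 1\<^sub>m m * 0\<^sub>m m m) (0\<^sub>m m m * B + 1\<^sub>m m * D)"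
      unfolding P_def by (rule mult_four_block_square[OF Mc Xc z o w(1,2) z w(4)])
    finally show ?thesis
      using w Mc Xc
      by (simp add: left_mult_zero_mat[of _ m m] right_mult_zero_mat[of _ m m] left_mult_one_mat[of _ m m] mult_carrier_mat[of _ m m _ m])
  qed
  ultimately show thesis
    using that[of "P * U" "M * A" "M * B + X * D" D] w Mc Xc by simp
qed

subsection \<open>Cosets as pairs\<close>

text \<open>The matrix q D^(-T); for a divisor D of q and q nonzero the choice is unique by
  \<open>dual_mat_unique\<close>.\<close>

definition dual_mat :: "nat \<Rightarrow> int \<Rightarrow> int mat \<Rightarrow> int mat" where
  "dual_mat m q D = (SOME A. A \<in> carrier_mat m m \<and> A\<^sup>T * D = q \<cdot>\<^sub>m 1\<^sub>m m)"

lemma dual_mat: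
  assumes D: "D \<in> divisor_mats m q"
  shows "dual_mat m q D \<in> carrier_mat m m" "(dual_mat m q D)\<^sup>T * D = q \<cdot>\<^sub>m 1\<^sub>m m"
proof -
  obtain A where "A \<in> carrier_mat m m" "A * D = q \<cdot>\<^sub>m 1\<^sub>m m" using D by (auto simp: divisor_mats_def)
  then have "A\<^sup>T \<in> carrier_mat m m \<and> (A\<^sup>T)\<^sup>T * D = q \<cdot>\<^sub>m 1\<^sub>m m" by simp
  then have "dual_mat m q D \<in> carrier_mat m m \<and> (dual_mat m q D)\<^sup>T * D = q \<cdot>\<^sub>m 1\<^sub>m m"
    unfolding dual_mat_def by (rule someI)
  then show "dual_mat m q D \<in> carrier_mat m m" "(dual_mat m q D)\<^sup>T * D = q \<cdot>\<^sub>m 1\<^sub>m m" by blast+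
qed

lemma divisor_mats_right_cancel:
  assumes D: "D \<in> divisor_mats m q" and q: "q \<noteq> 0" and "X * D = Y * D"
    "X \<in> carrier_mat k m" "Y \<in> carrier_mat k m"
  shows "X = Y"
proof -
  have A: "(dual_mat m q D)\<^sup>T \<in> carrier_mat m m" using dual_mat[OF D] by simp
  have "D * (dual_mat m q D)\<^sup>T = q \<cdot>\<^sub>m 1\<^sub>m m"
    by (rule scalar_left_inverse_imp_right[OF A divisor_mats_carrier[OF D] dual_mat(2)[OF D] q])
  from mult_mat_right_cancel[OF assms(3-5) divisor_mats_carrier[OF D] A this q] show ?thesis .
qed

lemma dual_mat_unique:
  assumes D: "D \<in> divisor_mats m q" and q: "q \<noteq> 0" and A: "A \<in> carrier_mat m m" "A\<^sup>T * D = q \<cdot>\<^sub>m 1\<^sub>m m"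
  shows "A = dual_mat m q D"
proof -
  have "A\<^sup>T = (dual_mat m q D)\<^sup>T"
    by (rule divisor_mats_right_cancel[OF D q, of _ _ m]) (use dual_mat[OF D] A in auto)
  then show ?thesis by (metis transpose_transpose)
qed

text \<open>For S in \<open>sym_ann m q D\<close> the entrywise division is exact, and the upper
  right block is (S / q) D.\<close>

definition upper_mat :: "nat \<Rightarrow> int \<Rightarrow> int mat \<Rightarrow> int mat \<Rightarrow> int mat" where
  "upper_mat m q D S = four_block_mat (dual_mat m q D) (map_mat (\<lambda>x. x div q) (S * D)) (0\<^sub>m m m) D"

lemma smult_div_mat:
  assumes "mat_dvd m q M" "M \<in> carrier_mat m m"
  shows "q \<cdot>\<^sub>m map_mat (\<lambda>x. x div q) M = M"
  using assms by (intro eq_matI) (auto simp: mat_dvd_def)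

text \<open>By q B = S D, the condition B^T D = D^T B multiplied by q says that D^T S D is
  symmetric.\<close>

lemma upper_mat_GSp_int:
  assumes D: "D \<in> divisor_mats m q" and q: "q \<noteq> 0" and S: "S \<in> sym_ann m q D"
  shows "upper_mat m q D S \<in> GSp_int m q"
proof -
  note Dc = divisor_mats_carrier[OF D]
  have Sc: "S \<in> carrier_mat m m" and ST: "S\<^sup>T = S" and Sd: "mat_dvd m q (S * D)"
    using S symmetric_mat_iff_transpose by (auto simp: sym_ann_def)
  define B where "B = map_mat (\<lambda>x. x div q) (S * D)"
  have SDc: "S * D \<in> carrier_mat m m" using Sc Dc by simp
  have Bc: "B \<in> carrier_mat m m" using SDc by (simp add: B_def)
  have qB: "q \<cdot>\<^sub>m B = S * D" unfolding B_def by (rule smult_div_mat[OF Sd SDc])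
  have "q \<cdot>\<^sub>m (B\<^sup>T * D) = (q \<cdot>\<^sub>m B)\<^sup>T * D"
  proof -
    have "(q \<cdot>\<^sub>m B)\<^sup>T = q \<cdot>\<^sub>m B\<^sup>T" by (rule eq_matI) auto
    then show ?thesis using Bc Dc by (simp add: mult_smult_assoc_mat[of _ m m _ m])
  qed
  also have "\<dots> = D\<^sup>T * (S * D)"
    unfolding qB using Sc Dc ST by (simp add: transpose_mult[of _ m m _ m] assoc_mult_mat[of _ m m _ m _ m])
  also have "\<dots> = q \<cdot>\<^sub>m (D\<^sup>T * B)"
    unfolding qB[symmetric] using Bc Dc by (simp add: mult_smult_distrib[of _ m m _ m])
  finally have "B\<^sup>T * D = D\<^sup>T * B"
    by (rule smult_mat_cancel[OF _ q, of _ _ m m]) (use Bc Dc in auto)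
  then show ?thesis
    unfolding upper_mat_def B_def[symmetric] GSp_int_upper_iff[OF dual_mat(1)[OF D] Bc Dc] using dual_mat(2)[OF D] by simp
qed

definition pair_coset :: "nat \<Rightarrow> int \<Rightarrow> int mat set \<times> int mat \<Rightarrow> int mat set" where
  "pair_coset m q = (\<lambda>(C, S). (\<lambda>\<gamma>. \<gamma> * upper_mat m q (coset_rep C) S) ` Gamma m)"

lemma one_Gamma: "1\<^sub>m (2*m) \<in> Gamma m"
  using Jmat_carrier[of m]
  by (simp add: Gamma_def GSp_int_def one_smult left_mult_one_mat[of _ "2*m" "2*m"] right_mult_one_mat[of _ "2*m" "2*m"])

text \<open>A symplectic matrix linking two representatives multiplies D by a unimodular d, so the
  cosets C agree, and with them the chosen D. Then d = 1 by cancellation, and what is left is a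
  translation, which changes S by a multiple of q.\<close>

lemma inj_on_pair_coset:
  assumes q: "q > 0"
  shows "inj_on (pair_coset m q) (SIGMA C:lcosets m q. sym_ann m q (coset_rep C))"
proof (rule inj_onI, clarify)
  fix C S C' S' assume C: "C \<in> lcosets m q" "C' \<in> lcosets m q"
    and S: "S \<in> sym_ann m q (coset_rep C)" and S': "S' \<in> sym_ann m q (coset_rep C')"
    and e: "pair_coset m q (C, S) = pair_coset m q (C', S')"
  have q0: "q \<noteq> 0" using q by simp
  define D where "D = coset_rep C"
  define D' where "D' = coset_rep C'"
  have D: "D \<in> divisor_mats m q" "C = lcoset m D" using lcosetsE[OF C(1)] unfolding D_def by metis+
  have D': "D' \<in> divisor_mats m q" "C' = lcoset m D'" using lcosetsE[OF C(2)] unfolding D'_def by metis+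
  note Dc = divisor_mats_carrier[OF D(1)] divisor_mats_carrier[OF D'(1)]
  have Sc: "S \<in> carrier_mat m m" "S' \<in> carrier_mat m m" using S S' by (auto simp: sym_ann_def)
  define B where "B = map_mat (\<lambda>x. x div q) (S * D)"
  define B' where "B' = map_mat (\<lambda>x. x div q) (S' * D')"
  have Bc: "B \<in> carrier_mat m m" "B' \<in> carrier_mat m m" using Sc Dc by (auto simp: B_def B'_def)
  have qB: "q \<cdot>\<^sub>m B = S * D"
    unfolding B_def using S Sc Dc by (intro smult_div_mat[of m]) (auto simp: sym_ann_def D_def)
  have qB': "q \<cdot>\<^sub>m B' = S' * D'"
    unfolding B'_def using S' Sc Dc by (intro smult_div_mat[of m]) (auto simp: sym_ann_def D'_def)
  have "upper_mat m q D' S' \<in> pair_coset m q (C', S')"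
  proof -
    have "upper_mat m q D' S' = 1\<^sub>m (2*m) * upper_mat m q D' S'"
      using GSp_int_carrier[OF upper_mat_GSp_int[OF D'(1) q0 S'[folded D'_def]]] by simp
    then show ?thesis using one_Gamma unfolding pair_coset_def D'_def by auto
  qed
  then obtain \<gamma> where g: "\<gamma> \<in> Gamma m" "\<gamma> * upper_mat m q D S = upper_mat m q D' S'"
    unfolding e[symmetric] by (auto simp: pair_coset_def D_def)
  obtain a b d where w: "a \<in> carrier_mat m m" "b \<in> carrier_mat m m" "d \<in> unimod m" "a\<^sup>T * d = 1\<^sub>m m"
    "b\<^sup>T * d = d\<^sup>T * b" "B' = a * B + b * D" "D' = d * D"
    by (rule Gamma_stabilizer_blocks[OF g(1) dual_mat(1)[OF D(1)] Bc(1) Dc(1) dual_mat(1)[OF D'(1)] Bc(2) Dc(2) dual_mat(2)[OF D(1)] q0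
      g(2)[unfolded upper_mat_def, folded B_def B'_def]])
  have "C' = C" unfolding D(2) D'(2) w(7) by (rule lcoset_unimod_mult[OF w(3) Dc(1)])
  then have DD: "D' = D" by (simp add: D_def D'_def)
  note dc = unimod_carrier[OF w(3)]
  have "d = 1\<^sub>m m"
    by (rule divisor_mats_right_cancel[OF D(1) q0 _ dc]) (use w(7) DD Dc in auto)
  then have a1: "a = 1\<^sub>m m" and bT: "b\<^sup>T = b"
    using w(1,2,4,5) by (auto simp: right_mult_one_mat[of _ m m] left_mult_one_mat[of _ m m]) (metis transpose_one transpose_transpose)+
  have "S' * D = q \<cdot>\<^sub>m (B + b * D)"
    using qB' w(6) Bc unfolding DD a1 by simp
  also have "\<dots> = S * D + (q \<cdot>\<^sub>m b) * D"
    using Bc w(2) Dc by (simp add: add_smult_distrib_left_mat[of _ m m] qB mult_smult_assoc_mat[of _ m m _ m])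
  also have "\<dots> = (S + q \<cdot>\<^sub>m b) * D"
    using Sc w(2) Dc by (simp add: add_mult_distrib_mat[of _ m m])
  finally have SS: "S' = S + q \<cdot>\<^sub>m b"
    by (rule divisor_mats_right_cancel[OF D(1) q0, of _ _ m]) (use Sc w(2) in auto)
  have "S' = S"
  proof (rule eq_matI)
    fix i j assume "i < dim_row S" "j < dim_col S"
    then have ij: "i < m" "j < m" using Sc by auto
    have "S' $$ (i,j) mod q = S $$ (i,j) mod q" using SS ij Sc w(2) by simp
    moreover have "S $$ (i,j) \<in> {0..<q}" "S' $$ (i,j) \<in> {0..<q}" using S S' ij unfolding sym_ann_def by blast+
    ultimately show "S' $$ (i,j) = S $$ (i,j)" by simp
  qed (use Sc in auto)
  then show "C = C' \<and> S = S'" using \<open>C' = C\<close> by simp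
qed

text \<open>Three left multiplications normalise g: a reduction to block triangular form, a block
  diagonal matrix taking D to the chosen representative of its coset, and a translation reducing S
  modulo q.\<close>

lemma Tcosets_pair_coset:
  assumes p: "p > 0" and c: "c \<in> Tcosets m p r"
  shows "c \<in> pair_coset m (int p ^ r) ` (SIGMA C:lcosets m (int p ^ r). sym_ann m (int p ^ r) (coset_rep C))"
proof -
  let ?q = "int p ^ r" and ?N = "2 * m"
  have q: "?q > 0" and q0: "?q \<noteq> 0" using p by simp_all
  have z: "0\<^sub>m m m \<in> carrier_mat m m" and o: "1\<^sub>m m \<in> carrier_mat m m" by simp_all
  obtain g where g: "g \<in> GSp_int m ?q" and c_eq: "c = (\<lambda>\<gamma>. \<gamma> * g) ` Gamma m"
    using c by (auto simp: Tcosets_def)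
  obtain \<gamma> A0 B0 D0 where r0: "\<gamma> \<in> Gamma m" "A0 \<in> carrier_mat m m" "B0 \<in> carrier_mat m m" "D0 \<in> carrier_mat m m"
    "\<gamma> * g = four_block_mat A0 B0 (0\<^sub>m m m) D0"
    using Gamma_reduce[OF g q0] by blast
  have "A0\<^sup>T * D0 = ?q \<cdot>\<^sub>m 1\<^sub>m m"
    using Gamma_mult_GSp_int[OF r0(1) g] unfolding r0(5) GSp_int_upper_iff[OF r0(2-4)] by blast
  then have D0: "D0 \<in> divisor_mats m ?q"
    using r0 unfolding divisor_mats_def by (auto intro!: bexI[of _ "A0\<^sup>T"])
  define C where "C = lcoset m D0"
  define D where "D = coset_rep C"
  have C: "C \<in> lcosets m ?q" using D0 by (simp add: C_def lcosets_def)
  have D: "D \<in> divisor_mats m ?q" "C = lcoset m D" using lcosetsE[OF C] unfolding D_def by metis+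
  note Dc = divisor_mats_carrier[OF D(1)]
  have "D \<in> lcoset m D0" using coset_rep_in[OF r0(4)] unfolding D_def C_def .
  then obtain U where U: "U \<in> unimod m" "D = U * D0" by (auto simp: lcoset_def)
  note Uc = unimod_carrier[OF U(1)]
  obtain V where V: "V \<in> carrier_mat m m" "four_block_mat V (0\<^sub>m m m) (0\<^sub>m m m) U \<in> Gamma m"
    using Gamma_block_diagonal[OF U(1)] by metis
  define h1 where "h1 = four_block_mat V (0\<^sub>m m m) (0\<^sub>m m m) U * (\<gamma> * g)"
  define A where "A = V * A0"
  define B where "B = V * B0"
  have Ac: "A \<in> carrier_mat m m" and Bc: "B \<in> carrier_mat m m" using V(1) r0 by (auto simp: A_def B_def)
  have "h1 = four_block_mat (V * A0 + 0\<^sub>m m m * 0\<^sub>m m m) (V * B0 + 0\<^sub>m m m * D0) (0\<^sub>m m m * A0 + U * 0\<^sub>m m m) (0\<^sub>m m m * B0 + U * D0)"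
    unfolding h1_def r0(5) by (rule mult_four_block_square[OF V(1) z z Uc r0(2,3) z r0(4)])
  then have h1_eq: "h1 = four_block_mat A B (0\<^sub>m m m) D"
    using V(1) Uc r0(2-4) U(2) by (simp add: A_def B_def left_mult_zero_mat[of _ m m] right_mult_zero_mat[of _ m m])
  have h1: "h1 \<in> GSp_int m ?q" unfolding h1_def by (intro Gamma_mult_GSp_int V(2) r0(1) g)
  then have AD: "A\<^sup>T * D = ?q \<cdot>\<^sub>m 1\<^sub>m m" and BD: "B\<^sup>T * D = D\<^sup>T * B"
    unfolding h1_eq GSp_int_upper_iff[OF Ac Bc Dc] by blast+
  have A_eq: "A = dual_mat m ?q D" by (rule dual_mat_unique[OF D(1) q0 Ac AD])
  \<comment> \<open>This is q B D^(-1), since A^T = q D^(-1). Its symmetry comes from B^T D = D^T B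
    by multiplying with A from the left and with A^T from the right.\<close>
  define S0 where "S0 = B * A\<^sup>T"
  have S0c: "S0 \<in> carrier_mat m m" using Ac Bc by (simp add: S0_def)
  have S0D: "S0 * D = ?q \<cdot>\<^sub>m B"
  proof -
    have "S0 * D = B * (A\<^sup>T * D)" unfolding S0_def using Ac Bc Dc by (intro assoc_mult_mat[of _ m m _ m _ m]) auto
    then show ?thesis using AD Bc by (simp add: mult_scalar_mat[of _ m m])
  qed
  have "S0\<^sup>T = S0"
  proof -
    have DA: "D * A\<^sup>T = ?q \<cdot>\<^sub>m 1\<^sub>m m" by (rule scalar_left_inverse_imp_right[OF _ Dc AD q0]) (use Ac in simp)
    have DTA: "A * D\<^sup>T = ?q \<cdot>\<^sub>m 1\<^sub>m m"
    proof -
      have "A * D\<^sup>T = (D * A\<^sup>T)\<^sup>T" using Ac Dc by (simp add: transpose_mult[of _ m m _ m])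
      then show ?thesis unfolding DA by (auto intro!: eq_matI)
    qed
    have "A * (B\<^sup>T * D) * A\<^sup>T = A * (D\<^sup>T * B) * A\<^sup>T" unfolding BD ..
    also have "A * (B\<^sup>T * D) * A\<^sup>T = A * B\<^sup>T * (D * A\<^sup>T)"
      using Ac Bc Dc by (simp add: assoc_mult_mat[of _ m m _ m _ m] mult_carrier_mat[of _ m m _ m])
    also have "A * (D\<^sup>T * B) * A\<^sup>T = (A * D\<^sup>T) * (B * A\<^sup>T)"
      using Ac Bc Dc by (simp add: assoc_mult_mat[of _ m m _ m _ m] mult_carrier_mat[of _ m m _ m])
    finally have "?q \<cdot>\<^sub>m (A * B\<^sup>T) = ?q \<cdot>\<^sub>m (B * A\<^sup>T)"
      unfolding DA DTA using Ac Bc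
      by (simp add: mult_scalar_mat[of _ m m] mult_smult_assoc_mat[of _ m m _ m] mult_carrier_mat[of _ m m _ m] left_mult_one_mat[of _ m m])
    then have "A * B\<^sup>T = B * A\<^sup>T" by (rule smult_mat_cancel[OF _ q0, of _ _ m m]) (use Ac Bc in auto)
    then show ?thesis unfolding S0_def using Ac Bc by (simp add: transpose_mult[of _ m m _ m])
  qed
  then have S0s: "symmetric_mat m S0" using symmetric_mat_iff_transpose[OF S0c] by simp
  define S where "S = mat_mod ?q S0"
  \<comment> \<open>The integral part of S0 / q: the translation by -T subtracts q T from
    \<open>S0\<close> and leaves the residue \<open>S\<close>.\<close>
  define T where "T = map_mat (\<lambda>x. x div ?q) S0"
  have Sc: "S \<in> carrier_mat m m" and Tc: "T \<in> carrier_mat m m" using S0c by (auto simp: S_def T_def)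
  have "mat_dvd m ?q (S0 * D)" unfolding S0D mat_dvd_def using Bc by auto
  then have Sd: "mat_dvd m ?q (S * D)" unfolding S_def by (simp add: mat_mod_mult_dvd_iff[OF S0c Dc])
  have S: "S \<in> sym_ann m ?q D"
    using Sd Sc S0s S0c q by (auto simp: sym_ann_def S_def symmetric_mat_def)
  have Ts: "symmetric_mat m (- T)" using S0s S0c by (auto simp: T_def symmetric_mat_def)
  have ST: "S = S0 + - (?q \<cdot>\<^sub>m T)"
    unfolding S_def T_def mat_mod_def using S0c by (intro eq_matI) (auto simp: minus_mult_div_eq_mod[symmetric])
  define E where "E = map_mat (\<lambda>x. x div ?q) (S * D)"
  have SDc: "S * D \<in> carrier_mat m m" using Sc Dc by simp
  have Ec: "E \<in> carrier_mat m m" using SDc by (simp add: E_def)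
  have "?q \<cdot>\<^sub>m E = S * D" unfolding E_def by (rule smult_div_mat[OF Sd SDc])
  also have "\<dots> = S0 * D + - (?q \<cdot>\<^sub>m T) * D"
    unfolding ST using S0c Tc Dc by (intro add_mult_distrib_mat[of _ m m _ _ m]) auto
  also have "- (?q \<cdot>\<^sub>m T) * D = ?q \<cdot>\<^sub>m (- T * D)"
  proof -
    have "- (?q \<cdot>\<^sub>m T) = ?q \<cdot>\<^sub>m (- T)" by (rule eq_matI) auto
    then show ?thesis using Tc Dc by (simp add: mult_smult_assoc_mat[of _ m m _ m])
  qed
  also have "S0 * D + ?q \<cdot>\<^sub>m (- T * D) = ?q \<cdot>\<^sub>m (B + - T * D)"
    unfolding S0D using Bc Tc Dc by (subst add_smult_distrib_left_mat[of _ m m]) auto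
  finally have E_eq: "E = B + - T * D"
    by (rule smult_mat_cancel[OF _ q0 Ec]) (use Bc Tc Dc in auto)
  have mTc: "- T \<in> carrier_mat m m" using Tc by simp
  note tr = Gamma_translation[OF mTc Ts]
  have "four_block_mat (1\<^sub>m m) (- T) (0\<^sub>m m m) (1\<^sub>m m) * h1 = four_block_mat
      (1\<^sub>m m * A + - T * 0\<^sub>m m m) (1\<^sub>m m * B + - T * D) (0\<^sub>m m m * A + 1\<^sub>m m * 0\<^sub>m m m) (0\<^sub>m m m * B + 1\<^sub>m m * D)"
    unfolding h1_eq by (rule mult_four_block_square[OF o mTc z o Ac Bc z Dc])
  also have "\<dots> = upper_mat m ?q D S"
    unfolding upper_mat_def E_def[symmetric] E_eq A_eq[symmetric] using Ac Bc Tc Dc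
    by (simp add: uminus_zero_mat left_mult_zero_mat[of _ m m] right_mult_zero_mat[of _ m m] left_mult_one_mat[of _ m m] mult_carrier_mat[of _ m m _ m])
  finally have up: "upper_mat m ?q D S = four_block_mat (1\<^sub>m m) (- T) (0\<^sub>m m m) (1\<^sub>m m) * h1" ..
  have gc: "g \<in> carrier_mat ?N ?N" using GSp_int_carrier[OF g] .
  have gg: "\<gamma> * g \<in> carrier_mat ?N ?N" using GSp_int_carrier[OF Gamma_mult_GSp_int[OF r0(1) g]] .
  have "pair_coset m ?q (C, S) = c"
    unfolding pair_coset_def c_eq prod.case D_def[symmetric] up Gamma_coset_eq[OF tr GSp_int_carrier[OF h1]]
    unfolding h1_def Gamma_coset_eq[OF V(2) gg] Gamma_coset_eq[OF r0(1) gc] ..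
  moreover have "(C, S) \<in> (SIGMA C:lcosets m ?q. sym_ann m ?q (coset_rep C))" using C S by (simp add: D_def)
  ultimately show ?thesis by blast
qed

lemma bij_betw_pair_coset:
  assumes p: "p > 0"
  shows "bij_betw (pair_coset m (int p ^ r)) (SIGMA C:lcosets m (int p ^ r). sym_ann m (int p ^ r) (coset_rep C)) (Tcosets m p r)"
  unfolding bij_betw_def
proof (intro conjI equalityI subsetI)
  show "inj_on (pair_coset m (int p ^ r)) (SIGMA C:lcosets m (int p ^ r). sym_ann m (int p ^ r) (coset_rep C))"
    using p by (intro inj_on_pair_coset) simp
  fix c assume "c \<in> pair_coset m (int p ^ r) ` (SIGMA C:lcosets m (int p ^ r). sym_ann m (int p ^ r) (coset_rep C))"
  then obtain C S where c: "c = pair_coset m (int p ^ r) (C, S)" "C \<in> lcosets m (int p ^ r)"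
    "S \<in> sym_ann m (int p ^ r) (coset_rep C)" by auto
  have "coset_rep C \<in> divisor_mats m (int p ^ r)" using lcosetsE[OF c(2)] by metis
  then have "upper_mat m (int p ^ r) (coset_rep C) S \<in> GSp_int m (int p ^ r)"
    using c(3) p by (intro upper_mat_GSp_int) auto
  then show "c \<in> Tcosets m p r" unfolding c(1) pair_coset_def Tcosets_def by auto
qed (rule Tcosets_pair_coset[OF p])

subsection \<open>The eigenvalue\<close>

text \<open>With a common value z for all indices only the total exponent of p on the diagonal
  enters, which is the valuation of the determinant. Every admissible representative has lower right
  block d D with d unimodular, so the arbitrary choice in \<open>satake_coset\<close> does no
  harm.\<close>

lemma satake_coset_pair:
  assumes p: "prime p" and C: "C \<in> lcosets m (int p ^ r)"
    and S: "S \<in> sym_ann m (int p ^ r) (coset_rep C)"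
    and z: "\<And>i. i < m \<Longrightarrow> x (Suc i) / of_nat p ^ Suc i = z"
  shows "satake_coset m p r x (pair_coset m (int p ^ r) (C, S)) = x 0 ^ r * z ^ det_val p C"
proof -
  let ?q = "int p ^ r"
  have q0: "?q \<noteq> 0" using p by auto
  have zero: "0\<^sub>m m m \<in> carrier_mat m m" by simp
  define D where "D = coset_rep C"
  define c where "c = pair_coset m ?q (C, S)"
  have D: "D \<in> divisor_mats m ?q" using lcosetsE[OF C] unfolding D_def by metis
  note Dc = divisor_mats_carrier[OF D]
  have S': "S \<in> sym_ann m ?q D" using S by (simp add: D_def)
  define A where "A = dual_mat m ?q D"
  define B where "B = map_mat (\<lambda>x. x div ?q) (S * D)"
  have Ac: "A \<in> carrier_mat m m" and AD: "A\<^sup>T * D = ?q \<cdot>\<^sub>m 1\<^sub>m m" using dual_mat[OF D] by (auto simp: A_def)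
  have Bc: "B \<in> carrier_mat m m" using S' Dc by (auto simp: B_def sym_ann_def)
  have up: "upper_mat m ?q D S = four_block_mat A B (0\<^sub>m m m) D" by (simp add: upper_mat_def A_def B_def)
  have c_eq: "c = (\<lambda>\<gamma>. \<gamma> * four_block_mat A B (0\<^sub>m m m) D) ` Gamma m"
    by (simp add: c_def pair_coset_def D_def[symmetric] up)
  have dD: "det D \<noteq> 0" by (rule divisor_mats_det_nonzero[OF D q0])
  \<comment> \<open>The Hermite form of D is used to show that an admissible representative exists,
    so that \<open>SOME\<close> yields one.\<close>
  obtain U where U: "U \<in> unimod m" "hermite m (U * D)" using hermite_form[OF Dc dD] by blast
  note Uc = unimod_carrier[OF U(1)]
  obtain V where V: "V \<in> carrier_mat m m" "four_block_mat V (0\<^sub>m m m) (0\<^sub>m m m) U \<in> Gamma m"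
    using Gamma_block_diagonal[OF U(1)] by metis
  have "four_block_mat V (0\<^sub>m m m) (0\<^sub>m m m) U * four_block_mat A B (0\<^sub>m m m) D
      = four_block_mat (V * A + 0\<^sub>m m m * 0\<^sub>m m m) (V * B + 0\<^sub>m m m * D) (0\<^sub>m m m * A + U * 0\<^sub>m m m) (0\<^sub>m m m * B + U * D)"
    by (rule mult_four_block_square[OF V(1) zero zero Uc Ac Bc zero Dc])
  also have "\<dots> = four_block_mat (V * A) (V * B) (0\<^sub>m m m) (U * D)"
    using V(1) Uc Ac Bc Dc by (simp add: left_mult_zero_mat[of _ m m] right_mult_zero_mat[of _ m m])
  finally have "four_block_mat (V * A) (V * B) (0\<^sub>m m m) (U * D) \<in> c" using V(2) unfolding c_eq by (metis image_eqI)
  moreover have "good_rep m (four_block_mat (V * A) (V * B) (0\<^sub>m m m) (U * D))"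
    using U(2) V(1) Uc Ac Bc Dc by (simp add: good_rep_def split_block_four_block hermite_def del: index_mult_mat)
  ultimately have ex: "\<exists>g. g \<in> c \<and> good_rep m g" by blast
  define g where "g = (SOME g. g \<in> c \<and> good_rep m g)"
  have g: "g \<in> c" "good_rep m g" using someI_ex[OF ex] by (auto simp: g_def)
  obtain \<gamma> where \<gamma>: "\<gamma> \<in> Gamma m" "g = \<gamma> * four_block_mat A B (0\<^sub>m m m) D" using g(1) unfolding c_eq by blast
  have gc: "g \<in> carrier_mat (2*m) (2*m)"
    unfolding \<gamma>(2) using GSp_int_carrier \<gamma>(1) unfolding Gamma_def
    by (intro mult_carrier_mat[of _ "2*m" "2*m"] four_block_square_carrier[OF Ac Dc])
  obtain A' B' C' D' where w: "A' \<in> carrier_mat m m" "B' \<in> carrier_mat m m" "C' \<in> carrier_mat m m" "D' \<in> carrier_mat m m"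
    "g = four_block_mat A' B' C' D'" "split_block g m m = (A', B', C', D')"
    by (rule four_block_square_cases[OF gc])
  have good: "C' = 0\<^sub>m m m" "upper_triangular D'" "\<And>i. i < m \<Longrightarrow> D' $$ (i,i) > 0"
    using g(2) w(6) by (auto simp: good_rep_def)
  obtain d where d: "d \<in> unimod m" "D' = d * D"
    using Gamma_stabilizer_blocks[OF \<gamma>(1) Ac Bc Dc w(1,2,4) AD q0] \<gamma>(2) w(5) good(1) by metis
  have "multiplicity (int p) (det D') = multiplicity (int p) (det D)"
    using d Dc unimod_carrier[OF d(1)]
    by (simp add: det_mult[of _ m] unimod_def multiplicity_times_unit_right)
  then have "multiplicity (int p) (det D') = det_val p C" by (simp add: det_val_def D_def)
  moreover have "det D' = (\<Prod>i<m. D' $$ (i,i))"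
    using det_upper_triangular[OF good(2) w(4)] w(4) by (simp add: prod_list_diag_prod atLeast0LessThan)
  moreover have "multiplicity (int p) (\<Prod>i<m. D' $$ (i,i)) = (\<Sum>i<m. multiplicity (int p) (D' $$ (i,i)))"
    using p good(3) by (intro prime_elem_multiplicity_prod_distrib) (auto dest!: good(3))
  ultimately have v: "(\<Sum>i<m. multiplicity (int p) (D' $$ (i,i))) = det_val p C" by simp
  have "satake_coset m p r x c = x 0 ^ r * (\<Prod>i<m. (x (Suc i) / of_nat p ^ Suc i) ^ multiplicity (int p) (D' $$ (i,i)))"
    unfolding satake_coset_def g_def[symmetric] Let_def w(6) by simp
  also have "(\<Prod>i<m. (x (Suc i) / of_nat p ^ Suc i) ^ multiplicity (int p) (D' $$ (i,i)))
      = (\<Prod>i<m. z ^ multiplicity (int p) (D' $$ (i,i)))"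
    by (intro prod.cong refl) (simp only: z lessThan_iff)
  also have "\<dots> = z ^ det_val p C" by (simp add: power_sum[symmetric] v)
  finally show ?thesis by (simp add: c_def)
qed

text \<open>The value at a pair (C, S) does not depend on S, so the sum over S contributes only the
  number of annihilators.\<close>

lemma hecke_eigenvalue_coset_sum:
  assumes p: "prime p" and z: "\<And>i. i < m \<Longrightarrow> x (Suc i) / of_nat p ^ Suc i = z"
  shows "hecke_eigenvalue m p r x =
    x 0 ^ r * (\<Sum>C\<in>lcosets m (int p ^ r). of_nat (sym_count m (int p ^ r) C) * z ^ det_val p C)"
proof -
  let ?q = "int p ^ r"
  let ?I = "SIGMA C:lcosets m ?q. sym_ann m ?q (coset_rep C)"
  have p0: "p > 0" using p by (simp add: prime_gt_0_nat)
  have fin: "finite (lcosets m ?q)" using p0 by (intro finite_lcosets) simp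
  have "hecke_eigenvalue m p r x = (\<Sum>y\<in>?I. satake_coset m p r x (pair_coset m ?q y))"
    unfolding hecke_eigenvalue_def by (rule sum.reindex_bij_betw[OF bij_betw_pair_coset[OF p0], symmetric])
  also have "\<dots> = (\<Sum>(C, S)\<in>?I. x 0 ^ r * z ^ det_val p C)"
    by (rule sum.cong) (auto simp: satake_coset_pair[OF p _ _ z])
  also have "\<dots> = (\<Sum>C\<in>lcosets m ?q. \<Sum>S\<in>sym_ann m ?q (coset_rep C). x 0 ^ r * z ^ det_val p C)"
    using fin by (subst sum.Sigma) (auto simp: finite_sym_ann)
  also have "\<dots> = x 0 ^ r * (\<Sum>C\<in>lcosets m ?q. of_nat (sym_count m ?q C) * z ^ det_val p C)"
    by (simp add: sum_distrib_left sym_count_def algebra_simps)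
  finally show ?thesis .
qed

section \<open>Weights and estimates at y = p^(-n-1/2)\<close>

lemma sum_Suc_lessThan: "real (\<Sum>j<m. Suc j) = real m * (real m + 1) / 2"
  by (induction m) (simp_all add: field_simps)

text \<open>Here the special y enters: y^(-2) = p^(2n+1) is exactly the factor by which duality
  rescales the number of annihilators per unit of valuation.\<close>

lemma dual_coset_weight:
  assumes p: "prime p" and C: "C \<in> lcosets (2*n) (int p ^ r)"
  defines "y \<equiv> real p powr - (real n + 1/2)"
  shows "real (sym_count (2*n) (int p ^ r) (dual_coset (2*n) (int p ^ r) C)) * y ^ det_val p (dual_coset (2*n) (int p ^ r) C)
    = real (sym_count (2*n) (int p ^ r) C) * y ^ det_val p C"
proof -
  define s s' d d' where "s = real (sym_count (2*n) (int p ^ r) C)"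
    and "s' = real (sym_count (2*n) (int p ^ r) (dual_coset (2*n) (int p ^ r) C))"
    and "d = det_val p C" and "d' = det_val p (dual_coset (2*n) (int p ^ r) C)"
  define b where "b = real p powr (real n + 1/2)"
  have p0: "real p > 0" using p by (simp add: prime_gt_0_nat)
  then have b: "b > 0" by (simp add: b_def)
  have y: "y = inverse b" unfolding y_def b_def by (simp only: powr_minus)
  have b2: "b ^ 2 = real p ^ (2*n + 1)"
  proof -
    have "b ^ 2 = real p powr real (2*n + 1)"
      unfolding b_def power2_eq_square powr_add[symmetric] by (simp add: algebra_simps)
    also have "\<dots> = real p ^ (2*n + 1)" by (rule powr_realpow[OF p0])
    finally show ?thesis .
  qed
  have dd: "d' + d = 2 * n * r"
    using dual_coset_invariants(3)[OF p C] by (simp add: d_def d'_def)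
  have "real (\<Sum>j<2*n. Suc j) = real (n * (2*n + 1))"
    unfolding sum_Suc_lessThan by (simp add: algebra_simps)
  then have ar: "(\<Sum>j<2*n. Suc j) = (2*n + 1) * n" unfolding of_nat_eq_iff by (simp add: mult.commute)
  have "s' * real p ^ ((2*n + 1) * d) = s * real p ^ (r * ((2*n + 1) * n))"
    using arg_cong[OF dual_coset_invariants(4)[OF p C], of real]
    by (simp add: s_def s'_def d_def ar)
  then have "s' * (b ^ 2) ^ d = s * (b ^ 2) ^ (r * n)"
    unfolding b2 power_mult[symmetric] by (simp add: algebra_simps)
  then have "s' * b ^ (2 * d) = s * b ^ (2 * (r * n))"
    by (simp only: power_mult)
  \<comment> \<open>Both exponents are written with a summand d, which then cancels because d + d' =
    2 n r.\<close>
  moreover have "2 * d = d + d" "2 * (r * n) = d' + d" using dd by simp_all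
  ultimately have "s' * b ^ (d + d) = s * b ^ (d' + d)" by (simp only:)
  then have "s' * b ^ d = s * b ^ d'"
    using b by (simp add: power_add)
  then show ?thesis
    unfolding y s_def[symmetric] s'_def[symmetric] d_def[symmetric] d'_def[symmetric]
    using b by (simp add: field_simps)
qed

text \<open>Counting j from 0, the powers have exponents c = j + 1/2 - n. For j < n they are at most
  -1/2, so the factor is at most 1 + t with t = P^(-1/2); for j >= n they are at least 1/2, and 1 +
  P^c <= P^c (1 + t).\<close>

lemma prod_one_plus_powers_le:
  fixes P :: real
  assumes P: "P > 1"
  shows "(\<Prod>j<2*n. 1 + P ^ Suc j * P powr - (real n + 1/2)) \<le> P powr (real n ^ 2 / 2) * (1 + P powr (-1/2)) ^ (2*n)"
proof -
  define t where "t = P powr (-1/2)"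
  have t: "t > 0" using P by (simp add: t_def)
  have e: "P ^ Suc j * P powr - (real n + 1/2) = P powr (real j + 1/2 - real n)" for j
  proof -
    have "P ^ Suc j = P powr real (Suc j)" using P by (intro powr_realpow[symmetric]) simp
    then show ?thesis by (simp only: powr_add[symmetric]) (simp add: algebra_simps)
  qed
  \<comment> \<open>The exponents 1/2, 3/2, ... of the second half add up to l^2/2.\<close>
  have half: "(\<Prod>j<n + l. if j < n then 1 else P powr (real j + 1/2 - real n)) = P powr (real l ^ 2 / 2)" for l
  proof (induction l)
    case (Suc l)
    then have "(\<Prod>j<n + Suc l. if j < n then 1 else P powr (real j + 1/2 - real n))
        = P powr (real l ^ 2 / 2) * P powr (real l + 1/2)" by simp
    also have "\<dots> = P powr (real (Suc l) ^ 2 / 2)"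
      unfolding powr_add[symmetric] by (simp add: power2_eq_square field_simps)
    finally show ?case .
  qed (use P in simp)
  have "(\<Prod>j<2*n. 1 + P ^ Suc j * P powr - (real n + 1/2))
      \<le> (\<Prod>j<2*n. (if j < n then 1 else P powr (real j + 1/2 - real n)) * (1 + t))"
  proof (rule prod_mono, rule conjI)
    fix j assume "j \<in> {..<2*n}"
    show "0 \<le> 1 + P ^ Suc j * P powr - (real n + 1/2)" using P by (simp add: add_nonneg_nonneg)
    show "1 + P ^ Suc j * P powr - (real n + 1/2) \<le> (if j < n then 1 else P powr (real j + 1/2 - real n)) * (1 + t)"
    proof (cases "j < n")
      case True
      then have "P powr (real j + 1/2 - real n) \<le> t"
        unfolding t_def using P by (intro powr_mono) auto
      with True show ?thesis unfolding e by simp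
    next
      case False
      then have "P powr 0 \<le> P powr (real j + 1/2 - real n + -1/2)"
        using P by (intro powr_mono) auto
      also have "\<dots> = P powr (real j + 1/2 - real n) * t" unfolding t_def by (rule powr_add)
      finally show ?thesis using False P unfolding e by (simp add: algebra_simps)
    qed
  qed
  also have "\<dots> = (\<Prod>j<2*n. if j < n then 1 else P powr (real j + 1/2 - real n)) * (1 + t) ^ (2*n)"
    by (simp add: prod.distrib)
  also have "(\<Prod>j<2*n. if j < n then 1 else P powr (real j + 1/2 - real n)) = P powr (real n ^ 2 / 2)"
    using half[of n] by (simp add: mult_2)
  finally show ?thesis by (simp add: t_def)
qed

text \<open>The power is at most exp(N t) <= exp(1/2), and comparing squares reduces the claim to e
  < 4.\<close>

lemma power_one_plus_less_two:
  fixes t :: real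
  assumes "t \<ge> 0" "2 * real N * t \<le> 1"
  shows "(1 + t) ^ N < 2"
proof -
  have "(1 + t) ^ N \<le> exp t ^ N" using assms by (intro power_mono exp_ge_add_one_self) auto
  also have "\<dots> = exp (real N * t)" by (simp add: exp_of_nat_mult)
  finally have "((1 + t) ^ N) ^ 2 \<le> exp (real N * t) ^ 2" using assms by (intro power_mono) auto
  also have "\<dots> = exp (2 * (real N * t))" by (simp add: exp_double)
  also have "\<dots> \<le> exp 1" using assms by simp
  also have "\<dots> < 2 ^ 2" using exp_le by simp
  finally show ?thesis by (rule power_less_imp_less_base) simp
qed

text \<open>Per unit of r the exponent is n^2 + n(n+1)/2 - n(n+1/2) = n^2/2, the same leading power
  as in \<open>prod_one_plus_powers_le\<close>.\<close>

lemma middle_weight: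
  fixes P :: real
  assumes "P > 0"
  shows "P ^ (r * n^2 + r * (\<Sum>j<n. Suc j)) * (P powr - (real n + 1/2)) ^ (n * r) = (P powr (real n ^ 2 / 2)) ^ r"
proof -
  have "P ^ (r * n^2 + r * (\<Sum>j<n. Suc j)) * (P powr - (real n + 1/2)) ^ (n * r)
      = P powr (real (r * n^2 + r * (\<Sum>j<n. Suc j)) + - (real n + 1/2) * real (n * r))"
    unfolding powr_add powr_realpow[OF assms] using assms
    by (simp add: powr_power mult.commute)
  also have "real (r * n^2 + r * (\<Sum>j<n. Suc j)) + - (real n + 1/2) * real (n * r) = real n ^ 2 / 2 * real r"
    by (simp add: sum_Suc_lessThan power2_eq_square field_simps del: of_nat_sum)
  also have "P powr (real n ^ 2 / 2 * real r) = (P powr (real n ^ 2 / 2)) ^ r"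
    using powr_power[of P "real n ^ 2 / 2" r] assms by (simp add: mult.commute)
  finally show ?thesis .
qed

theorem theorem4p6:
  fixes n k r p :: nat and a :: complex
  assumes "n \<ge> 1" and "r \<ge> 1"
    and "cmod a = 1"
    and "prime p"
    and "real p > (4 * real n * (2 * real r * real n ^ 2 + 2 * real n * (2 * real n - 1))) ^ 2"
  shows "hecke_eigenvalue (2*n) p r (ikeda_satake n k p a) \<in> \<real>
         \<and> Re (hecke_eigenvalue (2*n) p r (ikeda_satake n k p a)) > 0"
proof -
  let ?m = "2 * n" and ?q = "int p ^ r"
  note p = \<open>prime p\<close>
  have p1: "real p > 1" using prime_gt_1_nat[OF p] by simp
  have a0: "a \<noteq> 0" using assms(3) by auto
  define y where "y = real p powr - (real n + 1/2)"
  define P where "P = real p powr (real (n*k) - real n / 2)"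
  define w where "w C = real (sym_count ?m ?q C) * y ^ det_val p C" for C
  \<comment> \<open>The factor a^(-n r) of alpha_0^r is moved into the phase, so that valuation n r
    gets phase 1 and duality inverts the phase.\<close>
  define u where "u C = a powi (int (det_val p C) - int (n * r))" for C
  define L where "L = (\<Sum>C\<in>lcosets ?m ?q. of_real (w C) * u C)"
  have y0: "y \<ge> 0" by (simp add: y_def)
  have w0: "w C \<ge> 0" for C using y0 by (simp add: w_def)
  have P0: "P > 0" using p1 by (simp add: P_def)
  have fin: "finite (lcosets ?m ?q)" using p1 by (intro finite_lcosets) simp

  have z: "ikeda_satake n k p a (Suc i) / of_nat p ^ Suc i = a * of_real y" for i
  proof -
    have "real p powr (real (Suc i) - real n - 1/2) / real p ^ Suc i = real p powr (real (Suc i) - real n - 1/2 - real (Suc i))"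
      using p1 by (simp only: powr_diff[of _ _ "real (Suc i)"]) (simp add: powr_realpow del: power_Suc of_nat_Suc)
    also have "real (Suc i) - real n - 1/2 - real (Suc i) = - (real n + 1/2)" by simp
    finally have "complex_of_real (real p powr (real (Suc i) - real n - 1/2)) / of_nat p ^ Suc i = of_real y"
      unfolding y_def by (metis of_real_divide of_real_of_nat_eq of_real_power)
    then show ?thesis
      by (simp add: ikeda_satake_def times_divide_eq_right[symmetric] del: times_divide_eq_right power_Suc of_nat_Suc)
  qed
  have "(a powi - int n) ^ r = a powi - int (n * r)"
    by (simp add: power_int_minus power_mult power_inverse del: of_nat_mult)
  then have "ikeda_satake n k p a 0 ^ r = of_real (P ^ r) * a powi - int (n * r)"
    by (simp add: ikeda_satake_def P_def power_mult_distrib)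
  then have "hecke_eigenvalue ?m p r (ikeda_satake n k p a)
     = of_real (P ^ r) * (a powi - int (n * r) * (\<Sum>C\<in>lcosets ?m ?q. of_nat (sym_count ?m ?q C) * (a * of_real y) ^ det_val p C))"
    unfolding hecke_eigenvalue_coset_sum[OF p z] by simp
  also have "a powi - int (n * r) * (\<Sum>C\<in>lcosets ?m ?q. of_nat (sym_count ?m ?q C) * (a * of_real y) ^ det_val p C) = L"
    unfolding L_def sum_distrib_left
  proof (rule sum.cong)
    fix C
    have "u C = a powi - int (n * r) * a ^ det_val p C"
      unfolding u_def using a0 by (simp add: power_int_diff power_int_minus field_simps)
    then show "a powi - int (n * r) * (of_nat (sym_count ?m ?q C) * (a * of_real y) ^ det_val p C) = of_real (w C) * u C"
      by (simp add: w_def power_mult_distrib)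
  qed simp
  finally have hecke: "hecke_eigenvalue ?m p r (ikeda_satake n k p a) = of_real (P ^ r) * L" .

  \<comment> \<open>Conjugation inverts the phases because |a| = 1; the same permutation of phases
    is induced by duality, which fixes the weights.\<close>
  have "cnj a = inverse a"
    using assms(3) complex_div_cnj[of 1 a] by (simp add: divide_inverse)
  then have cu: "cnj (u C) = a powi (int (n * r) - int (det_val p C))" for C
  proof -
    have "int (n * r) - int (det_val p C) = - (int (det_val p C) - int (n * r))" by simp
    then show ?thesis
      using \<open>cnj a = inverse a\<close> by (simp only: u_def complex_cnj_power_int power_int_minus power_int_inverse)
  qed
  have "cnj L = (\<Sum>C\<in>lcosets ?m ?q. of_real (w C) * a powi (int (n * r) - int (det_val p C)))"
    by (simp add: L_def cu)
  also have "\<dots> = (\<Sum>C\<in>lcosets ?m ?q. of_real (w (dual_coset ?m ?q C)) * u (dual_coset ?m ?q C))"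
  proof (rule sum.cong)
    fix C assume C: "C \<in> lcosets ?m ?q"
    have "w (dual_coset ?m ?q C) = w C"
      unfolding w_def y_def by (rule dual_coset_weight[OF p C])
    moreover have "int (det_val p (dual_coset ?m ?q C)) - int (n * r) = int (n * r) - int (det_val p C)"
    proof -
      have "int (det_val p (dual_coset ?m ?q C) + det_val p C) = int (2 * n * r)"
        using dual_coset_invariants(3)[OF p C] by (simp only:)
      then show ?thesis by simp
    qed
    ultimately show "of_real (w C) * a powi (int (n * r) - int (det_val p C))
        = of_real (w (dual_coset ?m ?q C)) * u (dual_coset ?m ?q C)"
      by (simp only: u_def)
  qed simp
  also have "\<dots> = L"
    unfolding L_def by (rule sum.reindex_bij_betw[OF bij_betw_dual_coset[OF p]])
  finally have "L \<in> \<real>" by (simp add: Reals_cnj_iff)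

  \<comment> \<open>The weight of the terms with phase 1; it is compared below with the weight of
    all terms.\<close>
  define M where "M = (\<Sum>C\<in>{C \<in> lcosets ?m ?q. det_val p C = n * r}. w C)"
  define Q where "Q = (real p powr (real n ^ 2 / 2)) ^ r"
  define t where "t = real p powr (-1/2)"
  have Q0: "Q > 0" using p1 by (simp add: Q_def)
  have MQ: "Q \<le> M"
    using middle_coset_sum_ge[OF p y0, of r n] p1
    unfolding M_def w_def Q_def y_def by (simp only: middle_weight)
  have "(\<Sum>C\<in>lcosets ?m ?q. w C) \<le> coset_sum ?m p 1 y ^ r"
    using coset_sum_le_power[OF p y0] by (simp add: coset_sum_def w_def)
  also have "\<dots> \<le> (real p powr (real n ^ 2 / 2) * (1 + t) ^ (2*n)) ^ r"
    using coset_sum_1_le[OF p y0, of ?m] prod_one_plus_powers_le[OF p1, of n] coset_sum_nonneg[OF y0]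
    unfolding y_def t_def by (intro power_mono) (auto intro: order.trans)
  also have "\<dots> = Q * (1 + t) ^ (2 * n * r)"
    by (simp add: Q_def power_mult_distrib power_mult)
  also have "\<dots> < Q * 2"
  proof (rule mult_strict_left_mono[OF _ Q0], rule power_one_plus_less_two)
    \<comment> \<open>With N = 2 n r and t = p^(-1/2) the condition 2 N t <= 1 says 4 n r <= sqrt p,
      which follows from the assumed bound because n >= 1.\<close>
    have "4 * real n * real r * 1 \<le> 4 * real n * (2 * real r * real n ^ 2 + 2 * real n * (2 * real n - 1))"
    proof -
      have "1 \<le> real n ^ 2" using assms(1) by simp
      then have "real r * 1 \<le> real r * real n ^ 2" by (intro mult_left_mono) auto
      moreover have "0 \<le> 2 * real n * (2 * real n - 1)" using assms(1) by simp
      ultimately have "real r \<le> 2 * real r * real n ^ 2 + 2 * real n * (2 * real n - 1)" by simp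
      then show ?thesis using assms(1) by simp
    qed
    then have "(4 * real n * real r) ^ 2 \<le> (4 * real n * (2 * real r * real n ^ 2 + 2 * real n * (2 * real n - 1))) ^ 2"
      by (intro power_mono) auto
    with assms(5) have "sqrt ((4 * real n * real r) ^ 2) \<le> sqrt (real p)" by (intro real_sqrt_le_mono) simp
    then have "4 * real n * real r \<le> sqrt (real p)" by simp
    then have "4 * real n * real r * t \<le> sqrt (real p) * t"
      by (rule mult_right_mono) (simp add: t_def)
    also have "sqrt (real p) * t = 1"
      unfolding t_def powr_half_sqrt[OF of_nat_0_le_iff, symmetric] powr_add[symmetric] using p1 by simp
    finally show "2 * real (2 * n * r) * t \<le> 1" by simp
  qed (simp add: t_def)
  finally have tot: "(\<Sum>C\<in>lcosets ?m ?q. w C) < 2 * Q" by simp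
  \<comment> \<open>The worst case: phase 1 on the middle terms and -1 on all others. It bounds Re L
    below by twice the middle weight minus the total weight.\<close>
  have "2 * M - (\<Sum>C\<in>lcosets ?m ?q. w C) = (\<Sum>C\<in>lcosets ?m ?q. w C * (if det_val p C = n * r then 1 else -1))"
  proof -
    have "M = (\<Sum>C\<in>lcosets ?m ?q. if det_val p C = n * r then w C else 0)"
      unfolding M_def by (rule sum.inter_filter[OF fin])
    then show ?thesis
      unfolding sum_distrib_left by (simp only: sum_subtractf[symmetric] sum_distrib_left) (intro sum.cong, auto)
  qed
  also have "\<dots> \<le> (\<Sum>C\<in>lcosets ?m ?q. w C * Re (u C))"
  proof (intro sum_mono mult_left_mono w0)
    fix C
    have "cmod (u C) = 1" using assms(3) by (simp add: u_def norm_power_int)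
    then have "\<bar>Re (u C)\<bar> \<le> 1" using abs_Re_le_cmod[of "u C"] by simp
    then show "(if det_val p C = n * r then 1 else -1) \<le> Re (u C)"
      by (auto simp: u_def)
  qed
  also have "\<dots> = Re L" by (simp add: L_def)
  finally have "Re L > 0" using tot MQ by linarith
  with \<open>L \<in> \<real>\<close> P0 show ?thesis
    unfolding hecke by (auto intro!: Reals_mult)
qed

end
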